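(* In the condensation setting of the context, assume $\widehat f\in L^\infty(\mathcal D)\cap L^2(\mathcal D)$ and $\widehat f^{\,*}\in L^\infty(\mathcal D^* )\cap L^2(\mathcal D^* )$, with branches of $\sqrt{\widehat f},\sqrt{\widehat f^{\,*}}$ fixed. Then the finite-dimensional determinants converge to the continuum determinants: $$\tau_N^+(x,t)\longrightarrow\tau^+(x,t),\qquad\tau_N^-(x,t)\longrightarrow\tau^-(x,t),$$ locally uniformly for $(x,t)\in\mathbb R^2$. Furthermore, on every compact set on which $\tau^+(x,t)\tau^-(x,t)\neq0$, $$\partial_x\log\frac{\tau_N^+(x,t)}{\tau_N^-(x,t)}\longrightarrow\partial_x\log\frac{\tau^+(x,t)}{\tau^-(x,t)}$$ locally uniformly.
   Context: **Condensation.** $\mathcal D_+$ is a bounded simply connected domain with closure in the open first quadrant, area $\mathcal A$. For each $N$, $z_{1,N},\dots,z_{N,N}\in\mathcal D_+$ are distinct, $\frac1N\sum_j\delta_{z_{j,N}}$ converges weakly to $\frac{\chi_{\mathcal D_+}}{\mathcal A}d^2\lambda$, and the norming constants are $c_{j,N}=\frac{\mathcal A}{\pi N}f(z_{j,N},\bar z_{j,N})$ with $f\in C^\alpha(\operatorname{cl}(\mathcal D_+))$, $0<\alpha<1$. **Finite determinants.** $\widehat\theta(x,t,\lambda)=x\lambda+2t\lambda^2$, $\lambda_j=z_{j,N}^2$, $\alpha_j=c_{j,N}e^{2i\widehat\theta(x,t,\lambda_j)}$, $\alpha_j^*=\overline{c_{j,N}}e^{-2i\widehat\theta(x,t,\overline{\lambda_j})}$,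 $A_N=\operatorname{diag}(\alpha_j)$, $A_N^*=\operatorname{diag}(\alpha_j^* )$, $(\mathcal C_N)_{jk}=\frac{2z_{j,N}}{\lambda_j-\overline{\lambda_k}}$; $\tau_N^+=\det(\mathbb I_N-A_N^*\mathcal C_N^{\mathsf T}A_N\mathcal C_N)$, and $\tau_N^-=\det(\mathbb I_N-A_N\overline{\mathcal C_N}^{\,\mathsf T}A_N^*\overline{\mathcal C_N})$ is its Schwarz conjugate ($\overline{\mathcal C_N}$ entrywise conjugate). **Continuum determinants.** $\mathcal D=\{z^2:z\in\mathcal D_+\}$, $\mathcal D^*=\{\bar\lambda:\lambda\in\mathcal D\}$, $z_+(\lambda)\in\mathcal D_+$ the square root of $\lambda\in\mathcal D$, $z_+^*(\omega)=\overline{z_+(\bar\omega)}$; $d\nu=\frac1\pi dA$, $H_+=L^2(\mathcal D,d\nu)$, $H_-=L^2(\mathcal D^*,d\nu)$; $\widehat f(\lambda)=\frac{f(z_+(\lambda),\overline{z_+(\lambda)})}{4|z_+(\lambda)|^2}$, $\widehat f^{\,*}(\omega)=\overline{\widehat f(\bar\omega)}$. $Q_+:H_-\to H_+$, $Q_-:H_+\to H_-$ are integral operators (w.r.t. $d\nu$) with kernels $$Q_+(\lambda,\omega)=\frac{2iz_+(\lambda)\sqrt{\widehat f(\lambda)}\sqrt{\widehat f^{\,*}(\omega)}e^{i\widehat\theta(x,t,\lambda)-i\widehat\theta(x,t,\omega)}}{\lambda-\omega},\quad Q_-(\omega,\lambda)=\frac{2iz_+^*(\omega)\sqrt{\widehat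 f^{\,*}(\omega)}\sqrt{\widehat f(\lambda)}e^{-i\widehat\theta(x,t,\omega)+i\widehat\theta(x,t,\lambda)}}{\omega-\lambda}.$$ ${}^{\mathsf T}$ is the transpose with respect to the bilinear pairing $\int gh\,d\nu$; $\tau^+=\det_{H_-}(\mathbb I+Q_+^{\mathsf T}Q_+)$, $\tau^-=\det_{H_+}(\mathbb I+Q_-^{\mathsf T}Q_-)$ (Fredholm determinants). *)

theory Defs
  imports "HOL-Analysis.Analysis" "Jordan_Normal_Form.Determinant"
begin

definition weakly_converges_to ::
  "(nat \<Rightarrow> 'a::topological_space measure) \<Rightarrow> 'a measure \<Rightarrow> bool"
where
  "weakly_converges_to M M' \<longleftrightarrow>
     (\<forall>g::'a \<Rightarrow> real. continuous_on UNIV g \<and> bounded (range g) \<longrightarrow>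
        (\<lambda>n. \<integral>y. g y \<partial>M n) \<longlonglongrightarrow> (\<integral>y. g y \<partial>M'))"

(* (1/N) * (sum of the Dirac measures at zs 0, ..., zs (N - 1)) *)
definition empirical_measure :: "nat \<Rightarrow> (nat \<Rightarrow> complex) \<Rightarrow> complex measure" where
  "empirical_measure N zs = distr (uniform_count_measure {..<N}) borel zs"

definition hoelder_on :: "real \<Rightarrow> complex set \<Rightarrow> (complex \<Rightarrow> complex) \<Rightarrow> bool" where
  "hoelder_on \<alpha> S f \<longleftrightarrow>
     (\<exists>C. \<forall>u\<in>S. \<forall>v\<in>S. norm (f u - f v) \<le> C * norm (u - v) powr \<alpha>)"

definition in_L2 :: "'a measure \<Rightarrow> ('a \<Rightarrow> complex) \<Rightarrow> bool" where
  "in_L2 M g \<longleftrightarrow> g \<in> borel_measurable M \<and> integrable M (\<lambda>y. (norm (g y))\<^sup>2)"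

definition in_Linf :: "'a measure \<Rightarrow> ('a \<Rightarrow> complex) \<Rightarrow> bool" where
  "in_Linf M g \<longleftrightarrow> g \<in> borel_measurable M \<and> (\<exists>C. AE y in M. norm (g y) \<le> C)"

definition theta_hat :: "real \<Rightarrow> real \<Rightarrow> complex \<Rightarrow> complex" where
  "theta_hat x t l = of_real x * l + 2 * of_real t * l\<^sup>2"


section \<open>Finite determinants\<close>

text \<open>The points are \<open>zs 0, \<dots>, zs (N - 1)\<close> and the norming constants \<open>c 0, \<dots>, c (N - 1)\<close>;
  indices start at 0 as in the matrix library.\<close>

definition norming_const ::
  "complex set \<Rightarrow> (complex \<Rightarrow> complex) \<Rightarrow> nat \<Rightarrow> (nat \<Rightarrow> complex) \<Rightarrow> nat \<Rightarrow> complex"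
where
  "norming_const Dp f N zs j = of_real (measure lebesgue Dp / (pi * real N)) * f (zs j)"

definition A_mat ::
  "nat \<Rightarrow> (nat \<Rightarrow> complex) \<Rightarrow> (nat \<Rightarrow> complex) \<Rightarrow> real \<Rightarrow> real \<Rightarrow> complex mat"
where
  "A_mat N zs c x t = mat_diag N (\<lambda>j. c j * exp (2 * \<i> * theta_hat x t ((zs j)\<^sup>2)))"

definition A_star_mat ::
  "nat \<Rightarrow> (nat \<Rightarrow> complex) \<Rightarrow> (nat \<Rightarrow> complex) \<Rightarrow> real \<Rightarrow> real \<Rightarrow> complex mat"
where
  "A_star_mat N zs c x t =
     mat_diag N (\<lambda>j. cnj (c j) * exp (- 2 * \<i> * theta_hat x t (cnj ((zs j)\<^sup>2))))"

definition C_mat :: "nat \<Rightarrow> (nat \<Rightarrow> complex) \<Rightarrow> complex mat" where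
  "C_mat N zs = Matrix.mat N N (\<lambda>(j, k). 2 * zs j / ((zs j)\<^sup>2 - cnj ((zs k)\<^sup>2)))"

definition tauN_plus ::
  "nat \<Rightarrow> (nat \<Rightarrow> complex) \<Rightarrow> (nat \<Rightarrow> complex) \<Rightarrow> real \<Rightarrow> real \<Rightarrow> complex"
where
  "tauN_plus N zs c x t =
     Determinant.det (1\<^sub>m N - A_star_mat N zs c x t * transpose_mat (C_mat N zs)
                            * A_mat N zs c x t * C_mat N zs)"

definition tauN_minus ::
  "nat \<Rightarrow> (nat \<Rightarrow> complex) \<Rightarrow> (nat \<Rightarrow> complex) \<Rightarrow> real \<Rightarrow> real \<Rightarrow> complex"
where
  "tauN_minus N zs c x t =
     Determinant.det (1\<^sub>m N - A_mat N zs c x t * transpose_mat (map_mat cnj (C_mat N zs))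
                            * A_star_mat N zs c x t * map_mat cnj (C_mat N zs))"


section \<open>Integral operators and Fredholm determinants\<close>

text \<open>An integral operator from functions on \<open>M\<close> to functions on \<open>L\<close> is represented by its
  kernel \<open>K\<close>, with the argument in the target space \<open>L\<close> first. The two lemmas below justify the
  kernels used for compositions and for transposes in the case that matters here, bounded kernels
  on finite measure spaces (where square-integrable functions are integrable).\<close>

definition integral_op ::
  "'b measure \<Rightarrow> ('a \<Rightarrow> 'b \<Rightarrow> complex) \<Rightarrow> ('b \<Rightarrow> complex) \<Rightarrow> 'a \<Rightarrow> complex"
where
  "integral_op M K g u = (\<integral>v. K u v * g v \<partial>M)"

definition kernel_transpose :: "('a \<Rightarrow> 'b \<Rightarrow> complex) \<Rightarrow> 'b \<Rightarrow> 'a \<Rightarrow> complex" where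
  "kernel_transpose K v u = K u v"

definition kernel_comp ::
  "'b measure \<Rightarrow> ('a \<Rightarrow> 'b \<Rightarrow> complex) \<Rightarrow> ('b \<Rightarrow> 'c \<Rightarrow> complex) \<Rightarrow> 'a \<Rightarrow> 'c \<Rightarrow> complex"
where
  "kernel_comp M K K' u w = (\<integral>v. K u v * K' v w \<partial>M)"

lemma integrable_kernel_product:
  fixes k :: "'a \<times> 'b \<Rightarrow> complex"
  assumes "finite_measure M" "finite_measure L"
    and k: "k \<in> borel_measurable (M \<Otimes>\<^sub>M L)"
    and bdd: "\<And>p. p \<in> space (M \<Otimes>\<^sub>M L) \<Longrightarrow> norm (k p) \<le> B"
    and g: "integrable L g"
  shows "integrable (M \<Otimes>\<^sub>M L) (\<lambda>p. k p * g (snd p))"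
proof -
  interpret M: finite_measure M by fact
  interpret L: finite_measure L by fact
  interpret pair_sigma_finite M L ..
  have [measurable]: "g \<in> borel_measurable L" using g by auto
  have gi: "integrable (M \<Otimes>\<^sub>M L) (\<lambda>p. g (snd p))"
    by (rule Fubini_integrable) (use g in \<open>auto simp: case_prod_beta\<close>)
  have "integrable (M \<Otimes>\<^sub>M L) (\<lambda>p. B * norm (g (snd p)))"
    using gi by simp
  then show ?thesis
  proof (rule Bochner_Integration.integrable_bound)
    show "(\<lambda>p. k p * g (snd p)) \<in> borel_measurable (M \<Otimes>\<^sub>M L)"
      using k by measurable
    show "AE p in M \<Otimes>\<^sub>M L. norm (k p * g (snd p)) \<le> norm (B * norm (g (snd p)))"
    proof (rule AE_I2)
      fix p assume p: "p \<in> space (M \<Otimes>\<^sub>M L)"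
      have "norm (k p) * norm (g (snd p)) \<le> B * norm (g (snd p))"
        by (rule mult_right_mono[OF bdd[OF p]]) simp
      also have "\<dots> \<le> norm (B * norm (g (snd p)))" by simp
      finally show "norm (k p * g (snd p)) \<le> norm (B * norm (g (snd p)))"
        by (simp add: norm_mult)
    qed
  qed
qed

lemma integral_op_kernel_comp:
  assumes fin: "finite_measure M" "finite_measure L"
    and K: "(\<lambda>v. K u v) \<in> borel_measurable M" "\<And>v. v \<in> space M \<Longrightarrow> norm (K u v) \<le> B"
    and K': "(\<lambda>p. K' (fst p) (snd p)) \<in> borel_measurable (M \<Otimes>\<^sub>M L)"
      "\<And>v w. v \<in> space M \<Longrightarrow> w \<in> space L \<Longrightarrow> norm (K' v w) \<le> B'"
    and g: "integrable L g"
  shows "integral_op L (kernel_comp M K K') g u = integral_op M K (integral_op L K' g) u"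
proof -
  interpret M: finite_measure M by fact
  interpret L: finite_measure L by fact
  interpret pair_sigma_finite M L ..
  have "integrable (M \<Otimes>\<^sub>M L) (\<lambda>p. (K u (fst p) * K' (fst p) (snd p)) * g (snd p))"
  proof (rule integrable_kernel_product[OF fin _ _ g])
    show "(\<lambda>p. K u (fst p) * K' (fst p) (snd p)) \<in> borel_measurable (M \<Otimes>\<^sub>M L)"
      using K'(1) measurable_compose[OF measurable_fst K(1)] by measurable
    fix p assume "p \<in> space (M \<Otimes>\<^sub>M L)"
    then have "norm (K u (fst p)) \<le> B" "norm (K' (fst p) (snd p)) \<le> B'"
      using K(2) K'(2) by (auto simp: space_pair_measure)
    then show "norm (K u (fst p) * K' (fst p) (snd p)) \<le> B * B'"
      unfolding norm_mult by (rule mult_mono') auto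
  qed
  then have "(\<integral>w. \<integral>v. (K u v * K' v w) * g w \<partial>M \<partial>L) = (\<integral>v. \<integral>w. (K u v * K' v w) * g w \<partial>L \<partial>M)"
    by (intro Fubini_integral) (simp add: case_prod_unfold)
  then show ?thesis
    by (simp add: integral_op_def kernel_comp_def mult.assoc
        flip: integral_mult_left_zero)
qed

lemma integral_op_kernel_transpose:
  assumes fin: "finite_measure M" "finite_measure L"
    and K: "(\<lambda>p. K (fst p) (snd p)) \<in> borel_measurable (L \<Otimes>\<^sub>M M)"
      "\<And>u v. u \<in> space L \<Longrightarrow> v \<in> space M \<Longrightarrow> norm (K u v) \<le> B"
    and g: "integrable M g" and h: "integrable L h"
  shows "(\<integral>u. integral_op M K g u * h u \<partial>L)
       = (\<integral>v. g v * integral_op L (kernel_transpose K) h v \<partial>M)"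
proof -
  interpret M: finite_measure M by fact
  interpret L: finite_measure L by fact
  interpret pair_sigma_finite L M ..
  have [measurable]: "g \<in> borel_measurable M" "h \<in> borel_measurable L" using g h by auto
  have "integrable (L \<Otimes>\<^sub>M M) (\<lambda>p. h (fst p) * g (snd p))"
    by (rule Fubini_integrable)
       (use g h in \<open>auto simp: case_prod_beta norm_mult intro!: integrable_mult_right\<close>)
  then have "integrable (L \<Otimes>\<^sub>M M) (\<lambda>p. B * norm (h (fst p) * g (snd p)))"
    by simp
  then have "integrable (L \<Otimes>\<^sub>M M) (\<lambda>p. K (fst p) (snd p) * (h (fst p) * g (snd p)))"
  proof (rule Bochner_Integration.integrable_bound)
    show "(\<lambda>p. K (fst p) (snd p) * (h (fst p) * g (snd p))) \<in> borel_measurable (L \<Otimes>\<^sub>M M)"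
      using K(1) by measurable
    show "AE p in L \<Otimes>\<^sub>M M. norm (K (fst p) (snd p) * (h (fst p) * g (snd p)))
            \<le> norm (B * norm (h (fst p) * g (snd p)))"
    proof (rule AE_I2)
      fix p assume "p \<in> space (L \<Otimes>\<^sub>M M)"
      then have "norm (K (fst p) (snd p)) \<le> B" using K(2) by (auto simp: space_pair_measure)
      then have "norm (K (fst p) (snd p)) * norm (h (fst p) * g (snd p))
          \<le> B * norm (h (fst p) * g (snd p))" by (rule mult_right_mono) simp
      also have "\<dots> \<le> norm (B * norm (h (fst p) * g (snd p)))" by simp
      finally show "norm (K (fst p) (snd p) * (h (fst p) * g (snd p)))
            \<le> norm (B * norm (h (fst p) * g (snd p)))" by (simp add: norm_mult)
    qed
  qed
  then have "(\<integral>v. \<integral>u. K u v * (h u * g v) \<partial>L \<partial>M) = (\<integral>u. \<integral>v. K u v * (h u * g v) \<partial>M \<partial>L)"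
    by (intro Fubini_integral) (simp add: case_prod_unfold)
  then show ?thesis
    by (simp add: integral_op_def kernel_transpose_def mult_ac
        flip: integral_mult_left_zero integral_mult_right_zero)
qed

text \<open>\<open>det (1 + K)\<close> for the integral operator on \<open>L\<^sup>2(M)\<close> with kernel \<open>K\<close>, by Fredholm's series.
  The values of \<open>K\<close> on the diagonal matter; for a composition of two operators they are those
  given by \<open>kernel_comp\<close>, so that the first-order term is the trace.\<close>

definition fredholm_det :: "'a measure \<Rightarrow> ('a \<Rightarrow> 'a \<Rightarrow> complex) \<Rightarrow> complex" where
  "fredholm_det M K =
     (\<Sum>n. (\<integral>y. Determinant.det (Matrix.mat n n (\<lambda>(i, j). K (y i) (y j)))
             \<partial>(\<Pi>\<^sub>M i\<in>{..<n}. M)) / fact n)"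


section \<open>Continuum determinants\<close>

text \<open>\<open>Dp\<close> is the domain in the first quadrant; \<open>s\<close> and \<open>r\<close> are the branches of the square roots
  of \<open>f_hat\<close> on \<open>sq_dom Dp\<close> and of \<open>f_hat_star\<close> on \<open>sq_dom_star Dp\<close>.\<close>

definition sq_dom :: "complex set \<Rightarrow> complex set" where
  "sq_dom Dp = (\<lambda>z. z\<^sup>2) ` Dp"

definition sq_dom_star :: "complex set \<Rightarrow> complex set" where
  "sq_dom_star Dp = cnj ` sq_dom Dp"

definition z_plus :: "complex set \<Rightarrow> complex \<Rightarrow> complex" where
  "z_plus Dp l = (THE z. z \<in> Dp \<and> z\<^sup>2 = l)"

definition z_plus_star :: "complex set \<Rightarrow> complex \<Rightarrow> complex" where
  "z_plus_star Dp w = cnj (z_plus Dp (cnj w))"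

definition f_hat :: "complex set \<Rightarrow> (complex \<Rightarrow> complex) \<Rightarrow> complex \<Rightarrow> complex" where
  "f_hat Dp f l = f (z_plus Dp l) / of_real (4 * (norm (z_plus Dp l))\<^sup>2)"

definition f_hat_star :: "complex set \<Rightarrow> (complex \<Rightarrow> complex) \<Rightarrow> complex \<Rightarrow> complex" where
  "f_hat_star Dp f w = cnj (f_hat Dp f (cnj w))"

definition nu :: "complex set \<Rightarrow> complex measure" where
  "nu S = density (lebesgue_on S) (\<lambda>_. ennreal (1 / pi))"

definition Q_plus ::
  "complex set \<Rightarrow> (complex \<Rightarrow> complex) \<Rightarrow> (complex \<Rightarrow> complex) \<Rightarrow> real \<Rightarrow> real
     \<Rightarrow> complex \<Rightarrow> complex \<Rightarrow> complex"
where
  "Q_plus Dp s r x t l w =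
     2 * \<i> * z_plus Dp l * s l * r w * exp (\<i> * theta_hat x t l - \<i> * theta_hat x t w) / (l - w)"

definition Q_minus ::
  "complex set \<Rightarrow> (complex \<Rightarrow> complex) \<Rightarrow> (complex \<Rightarrow> complex) \<Rightarrow> real \<Rightarrow> real
     \<Rightarrow> complex \<Rightarrow> complex \<Rightarrow> complex"
where
  "Q_minus Dp s r x t w l =
     2 * \<i> * z_plus_star Dp w * r w * s l * exp (- \<i> * theta_hat x t w + \<i> * theta_hat x t l) / (w - l)"

definition tau_plus ::
  "complex set \<Rightarrow> (complex \<Rightarrow> complex) \<Rightarrow> (complex \<Rightarrow> complex) \<Rightarrow> real \<Rightarrow> real \<Rightarrow> complex"
where
  "tau_plus Dp s r x t =
     fredholm_det (nu (sq_dom_star Dp))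
       (kernel_comp (nu (sq_dom Dp)) (kernel_transpose (Q_plus Dp s r x t)) (Q_plus Dp s r x t))"

definition tau_minus ::
  "complex set \<Rightarrow> (complex \<Rightarrow> complex) \<Rightarrow> (complex \<Rightarrow> complex) \<Rightarrow> real \<Rightarrow> real \<Rightarrow> complex"
where
  "tau_minus Dp s r x t =
     fredholm_det (nu (sq_dom Dp))
       (kernel_comp (nu (sq_dom_star Dp)) (kernel_transpose (Q_minus Dp s r x t)) (Q_minus Dp s r x t))"


section \<open>Logarithmic derivative\<close>

text \<open>The derivative at \<open>x\<close> of a local branch \<open>L\<close> of \<open>log \<circ> h\<close>; a fixed branch such as \<open>Ln\<close> would
  introduce spurious discontinuities.\<close>

definition has_log_deriv :: "(real \<Rightarrow> complex) \<Rightarrow> complex \<Rightarrow> real \<Rightarrow> bool" where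
  "has_log_deriv h d x \<longleftrightarrow>
     (\<exists>L. (\<forall>\<^sub>F y in nhds x. exp (L y) = h y) \<and> (L has_vector_derivative d) (at x))"

definition log_deriv :: "(real \<Rightarrow> complex) \<Rightarrow> real \<Rightarrow> complex" where
  "log_deriv h x = (THE d. has_log_deriv h d x)"

lemma has_log_deriv_iff:
  "has_log_deriv h d x \<longleftrightarrow> h x \<noteq> 0 \<and> (h has_vector_derivative d * h x) (at x)"
proof
  assume "has_log_deriv h d x"
  then obtain L where L: "\<forall>\<^sub>F y in nhds x. exp (L y) = h y" "(L has_vector_derivative d) (at x)"
    by (auto simp: has_log_deriv_def)
  have hx: "exp (L x) = h x" using L(1) by (rule eventually_nhds_x_imp_x)
  have "((exp \<circ> L) has_vector_derivative d * exp (L x)) (at x)"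
    by (rule field_vector_diff_chain_at[OF L(2) DERIV_exp])
  then have "(h has_vector_derivative d * exp (L x)) (at x)"
    unfolding has_vector_derivative_def
    by (rule has_derivative_transform_eventually)
       (use L(1) hx in \<open>auto simp: eventually_at_filter elim: eventually_mono\<close>)
  with hx show "h x \<noteq> 0 \<and> (h has_vector_derivative d * h x) (at x)"
    by (metis exp_not_eq_zero)
next
  assume h: "h x \<noteq> 0 \<and> (h has_vector_derivative d * h x) (at x)"
  define L where "L = (\<lambda>y. Ln (h y / h x) + Ln (h x))"
  have "isCont h x"
    using h has_vector_derivative_continuous by blast
  then have "\<forall>\<^sub>F y in nhds x. h y \<noteq> 0"
    using h by (simp add: continuous_at tendsto_imp_eventually_ne eventually_nhds_conv_at)
  then have 1: "\<forall>\<^sub>F y in nhds x. exp (L y) = h y"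
    by eventually_elim (use h in \<open>simp add: L_def exp_add\<close>)
  have "((\<lambda>y. h y / h x) has_vector_derivative d) (at x)"
    using has_vector_derivative_divide[of h "d * h x" "at x" "h x"] h by simp
  moreover have "(Ln has_field_derivative 1) (at (h x / h x))"
    using h has_field_derivative_Ln[of 1] by simp
  ultimately have "((Ln \<circ> (\<lambda>y. h y / h x)) has_vector_derivative d * 1) (at x)"
    by (rule field_vector_diff_chain_at)
  then have "(L has_vector_derivative d) (at x)"
    by (auto simp: L_def o_def intro!: derivative_eq_intros)
  with 1 show "has_log_deriv h d x" by (auto simp: has_log_deriv_def)
qed

lemma log_deriv_eq: "has_log_deriv h d x \<Longrightarrow> log_deriv h x = d"
  unfolding log_deriv_def
  by (rule the_equality) (auto simp: has_log_deriv_iff dest: vector_derivative_unique_at)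

end

theory Submission
  imports Defs "HOL-Complex_Analysis.Cauchy_Integral_Formula"
begin

text \<open>
  Both determinants are Fredholm series: for a matrix, \<open>det (1 + M)\<close> is the sum over \<open>n\<close> of the
  \<open>n\<close>-point sums of \<open>det (M (\<sigma> i, \<sigma> j)) / n!\<close>, which are the \<open>n\<close>-fold integrals of the continuum
  series with the measure replaced by weighted point masses. Weak convergence of the point masses,
  together with compactness (all kernels are continuous since \<open>\<lambda>\<close> and \<open>\<omega>\<close> stay in disjoint compact
  sets), gives convergence of each term, uniformly for \<open>(x, t)\<close> in a compact subset of \<open>\<complex>\<^sup>2\<close>.
  Hadamard's inequality dominates the series. As everything is holomorphic in \<open>x\<close>, Cauchy's
  inequality transfers the convergence to the \<open>x\<close>-derivatives.
\<close>

section \<open>Hadamard's inequality and the Fredholm expansion of a matrix determinant\<close>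

text \<open>The branches of the square roots are merely measurable, so \<open>Q_plus\<close> and
  \<open>Q_minus\<close> themselves need not be continuous. Determinants remove this obstacle: from
  an n-point determinant of \<open>b w * ker w w' * b w'\<close> the outer factors leave as a
  product of \<open>(b w)\<^sup>2\<close>, and the inner square root already occurs squared in the
  composition. What remains depends on \<open>f_hat\<close> and \<open>f_hat_star\<close> only, and
  these extend continuously to the images of \<open>closure Dp\<close>. The finite matrix carries
  its whole outer weight on the left; a symmetric splitting of that weight would give the same
  n-point determinants.

  A norming constant is the value of \<open>f_hat\<close> at the squared node times
  \<open>4 * (norm z)\<^sup>2 * A / (pi * N)\<close>, with \<open>A\<close> the area of
  \<open>Dp\<close>. This turns averages over the points \<open>z\<close> into integrals against
  \<open>nu\<close> over the squared domain.

  The two tau functions are one construction with the domain and its mirror image exchanged and the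
  sign of the phase reversed, so every analytic statement is proved once for a general pair of
  discretized measures. Complex parameters are used because uniform convergence on the real plane
  alone does not control derivatives.\<close>

lemma det_mat_lessThan:
  "Determinant.det (Matrix.mat n n (\<lambda>(i, j). X i j))
    = (\<Sum>p | p permutes {..<n}. of_int (sign p) * (\<Prod>i<n. X i (p i)))"
  for X :: "nat \<Rightarrow> nat \<Rightarrow> complex"
proof (subst det_def'[where n = n], simp, unfold atLeast0LessThan,
    intro sum.cong refl arg_cong2[of _ _ _ _ "(*)"] prod.cong)
  fix p i assume "p \<in> {p. p permutes {..<n}}" and i: "i \<in> {..<n}"
  then have "p i < n" using permutes_in_image[of p "{..<n}" i] by simp
  then show "Matrix.mat n n (\<lambda>(i, j). X i j) $$ (i, p i) = X i (p i)" using i by simp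
qed

section \<open>Orthogonalisation of rows and Hadamard's inequality\<close>

definition row_inner :: "complex mat \<Rightarrow> nat \<Rightarrow> nat \<Rightarrow> complex" where
  "row_inner A i k = (\<Sum>j<dim_col A. A $$ (i, j) * cnj (A $$ (k, j)))"

lemma row_inner_self: "row_inner A i i = of_real (\<Sum>j<dim_col A. (norm (A $$ (i, j)))\<^sup>2)"
  by (simp only: row_inner_def of_real_sum complex_norm_square)

lemma row_inner_commute: "row_inner A k i = cnj (row_inner A i k)"
  by (simp add: row_inner_def mult.commute)

text \<open>Subtracting from every later row its projection onto row \<open>k\<close> is left
  multiplication by a lower triangular matrix with unit diagonal, so the determinant is kept; by
  Pythagoras no row gets longer. Rows before \<open>k\<close> are already orthogonal to all others,
  including row \<open>k\<close>, so the subtraction does not disturb them.\<close>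

lemma gram_schmidt_rows_step:
  fixes B :: "complex mat"
  assumes B: "B \<in> carrier_mat n n" and k: "k < n"
    and orth: "\<And>i j. i < k \<Longrightarrow> j < n \<Longrightarrow> i \<noteq> j \<Longrightarrow> row_inner B i j = 0"
  obtains B' where "B' \<in> carrier_mat n n" "Determinant.det B' = Determinant.det B"
    "\<And>i. i < n \<Longrightarrow> Re (row_inner B' i i) \<le> Re (row_inner B i i)"
    "\<And>i j. i < Suc k \<Longrightarrow> j < n \<Longrightarrow> i \<noteq> j \<Longrightarrow> row_inner B' i j = 0"
proof -
  define a where "a = row_inner B k k"
  \<comment> \<open>The projection coefficients. If row \<open>k\<close> vanishes they are set to 0:
    that row is then orthogonal to everything, and no division by \<open>a\<close> takes
    place.\<close>
  define c where "c i = (if i > k \<and> a \<noteq> 0 then row_inner B i k / a else 0)" for i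
  define B' where "B' = Matrix.mat n n (\<lambda>(i, j). B $$ (i, j) - c i * B $$ (k, j))"
  define L where "L = Matrix.mat n n (\<lambda>(i, j). if i = j then 1 else if j = k then - c i else 0)"
  have dims: "dim_col B = n" "dim_row B = n" "dim_col B' = n" using B by (auto simp: B'_def)
  have L: "L \<in> carrier_mat n n" by (simp add: L_def)
  have "B' = L * B"
  proof (rule eq_matI)
    fix i j assume ij: "i < dim_row (L * B)" "j < dim_col (L * B)"
    then have i: "i < n" and j: "j < n" using B by (auto simp: L_def)
    have "(L * B) $$ (i, j) = (\<Sum>l<n. L $$ (i, l) * B $$ (l, j))"
      using i j B L by (simp add: scalar_prod_def atLeast0LessThan)
    also have "\<dots> = (\<Sum>l<n. (if l = i then B $$ (i, j) else 0) + (if l = k then - c i * B $$ (k, j) else 0))"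
      by (rule sum.cong) (use i in \<open>auto simp: L_def c_def\<close>)
    also have "\<dots> = B $$ (i, j) - c i * B $$ (k, j)"
      using i k by (simp add: sum.distrib)
    finally show "B' $$ (i, j) = (L * B) $$ (i, j)" using i j by (simp add: B'_def)
  qed (use B in \<open>auto simp: B'_def L_def\<close>)
  moreover have "Determinant.det L = 1"
  proof -
    have "Determinant.det L = prod_list (diag_mat L)"
      by (rule det_lower_triangular[OF _ L]) (auto simp: L_def c_def)
    also have "diag_mat L = replicate n 1"
      by (rule nth_equalityI) (auto simp: diag_mat_def L_def)
    finally show ?thesis by simp
  qed
  ultimately have det: "Determinant.det B' = Determinant.det B"
    using det_mult[OF L B] by simp
  have ip: "row_inner B' i m = row_inner B i m - c i * row_inner B k m
      - cnj (c m) * row_inner B i k + c i * cnj (c m) * a" if "i < n" "m < n" for i m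
  proof -
    have "row_inner B' i m = (\<Sum>j<n. (B $$ (i, j) - c i * B $$ (k, j)) * cnj (B $$ (m, j) - c m * B $$ (k, j)))"
      unfolding row_inner_def dims by (rule sum.cong) (use that in \<open>auto simp: B'_def\<close>)
    then show ?thesis
      by (simp add: row_inner_def dims a_def algebra_simps sum.distrib sum_subtractf sum_distrib_left)
  qed
  have a_real: "a = of_real (Re a)" "Re a \<ge> 0"
    by (simp_all add: a_def row_inner_self sum_nonneg)
  have cnj_a: "cnj a = a" by (metis a_real(1) complex_cnj_complex_of_real)
  have zero: "row_inner B k m = 0" if "a = 0" "m < n" for m
  proof -
    have "(\<Sum>j<n. (norm (B $$ (k, j)))\<^sup>2) = 0"
      using that(1) unfolding a_def row_inner_self dims of_real_eq_0_iff .
    then have "\<forall>j<n. B $$ (k, j) = 0" by (simp add: sum_nonneg_eq_0_iff)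
    then show ?thesis by (simp add: row_inner_def dims)
  qed
  show ?thesis
  proof (rule that[of B'])
    show "B' \<in> carrier_mat n n" by (simp add: B'_def)
    show "Determinant.det B' = Determinant.det B" by (rule det)
  next
    fix i assume i: "i < n"
    show "Re (row_inner B' i i) \<le> Re (row_inner B i i)"
    proof (cases "i > k \<and> a \<noteq> 0")
      case True
      have "row_inner B' i i = row_inner B i i - row_inner B i k * cnj (row_inner B i k) / a"
        using True unfolding ip[OF i i] c_def row_inner_commute[of B k i]
        by (simp add: cnj_a field_simps)
      also have "\<dots> = row_inner B i i - of_real ((norm (row_inner B i k))\<^sup>2 / Re a)"
        using a_real(1) by (metis complex_norm_square of_real_divide)
      finally show ?thesis using a_real(2) by simp
    qed (auto simp: ip[OF i i] c_def)
  next
    fix i m assume im: "i < Suc k" "m < n" "i \<noteq> m"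
    then have ci: "c i = 0" and i: "i < n" using k by (auto simp: c_def)
    have *: "row_inner B' i m = row_inner B i m - cnj (c m) * row_inner B i k"
      using ip[OF i im(2)] ci by simp
    show "row_inner B' i m = 0"
    proof (cases "i < k")
      case True
      then show ?thesis using * orth[of i m] orth[of i k] im k by simp
    next
      case False
      then have [simp]: "i = k" using im by simp
      consider "m < k" | "m > k" "a = 0" | "m > k" "a \<noteq> 0" using im by fastforce
      then show ?thesis
      proof cases
        case 1
        then have "row_inner B k m = 0" using orth[of m k] k row_inner_commute[of B k m] by simp
        then show ?thesis using * 1 by (simp add: c_def)
      next
        case 2
        then show ?thesis using * zero[of m] im by (simp add: c_def)
      next
        case 3
        then show ?thesis using *
          by (simp add: c_def row_inner_commute[of B k m] a_def[symmetric] cnj_a)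
      qed
    qed
  qed
qed

lemma gram_schmidt_rows:
  fixes A :: "complex mat"
  assumes A: "A \<in> carrier_mat n n" and "k \<le> n"
  shows "\<exists>B \<in> carrier_mat n n. Determinant.det B = Determinant.det A
    \<and> (\<forall>i<n. Re (row_inner B i i) \<le> Re (row_inner A i i))
    \<and> (\<forall>i<k. \<forall>j<n. i \<noteq> j \<longrightarrow> row_inner B i j = 0)"
  using \<open>k \<le> n\<close>
proof (induction k)
  case 0
  then show ?case using A by auto
next
  case (Suc k)
  then obtain B where B: "B \<in> carrier_mat n n" "Determinant.det B = Determinant.det A"
    "\<forall>i<n. Re (row_inner B i i) \<le> Re (row_inner A i i)"
    "\<forall>i<k. \<forall>j<n. i \<noteq> j \<longrightarrow> row_inner B i j = 0" by auto
  obtain B' where "B' \<in> carrier_mat n n" "Determinant.det B' = Determinant.det B"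
    "\<And>i. i < n \<Longrightarrow> Re (row_inner B' i i) \<le> Re (row_inner B i i)"
    "\<And>i j. i < Suc k \<Longrightarrow> j < n \<Longrightarrow> i \<noteq> j \<Longrightarrow> row_inner B' i j = 0"
    using gram_schmidt_rows_step[of B n k] B Suc.prems by (metis Suc_le_eq)
  then show ?case using B by (metis order_trans)
qed

lemma det_map_mat_cnj: "Determinant.det (map_mat cnj A) = cnj (Determinant.det A)"
proof -
  interpret cnj: comm_ring_hom cnj by unfold_locales auto
  show ?thesis by (rule cnj.hom_det)
qed

text \<open>With orthogonal rows, \<open>B\<close> times its conjugate transpose is diagonal, so the
  squared modulus of the determinant equals the product of the squared row lengths.
  Orthogonalisation has kept the determinant of \<open>A\<close> and only shortened its
  rows.\<close>

theorem hadamard_inequality: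
  fixes A :: "complex mat"
  assumes A: "A \<in> carrier_mat n n"
  shows "(norm (Determinant.det A))\<^sup>2 \<le> (\<Prod>i<n. \<Sum>j<n. (norm (A $$ (i, j)))\<^sup>2)"
proof -
  obtain B where B: "B \<in> carrier_mat n n" "Determinant.det B = Determinant.det A"
    "\<forall>i<n. Re (row_inner B i i) \<le> Re (row_inner A i i)"
    "\<forall>i<n. \<forall>j<n. i \<noteq> j \<longrightarrow> row_inner B i j = 0"
    using gram_schmidt_rows[OF A order_refl] by blast
  define H where "H = map_mat cnj (transpose_mat B)"
  have H: "H \<in> carrier_mat n n" using B(1) by (simp add: H_def)
  have BH: "(B * H) $$ (i, j) = row_inner B i j" if "i < n" "j < n" for i j
    using that B(1) by (simp add: H_def row_inner_def scalar_prod_def atLeast0LessThan)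
  have "of_real ((norm (Determinant.det B))\<^sup>2) = Determinant.det B * Determinant.det H"
    unfolding complex_norm_square H_def det_map_mat_cnj using det_transpose[OF B(1)] by simp
  also have "\<dots> = Determinant.det (B * H)" using det_mult[OF B(1) H] by simp
  also have "\<dots> = prod_list (diag_mat (B * H))"
  proof (rule det_upper_triangular[where n = n])
    show "upper_triangular (B * H)"
    proof (rule upper_triangularI)
      fix i j assume "j < i" "i < dim_row (B * H)"
      then show "(B * H) $$ (i, j) = 0" using BH[of i j] B by auto
    qed
  qed (use B H in auto)
  also have "\<dots> = (\<Prod>i<n. row_inner B i i)"
  proof -
    have "diag_mat (B * H) = map (\<lambda>i. row_inner B i i) [0..<n]"
      using B(1) by (simp add: diag_mat_def BH del: index_mult_mat(1))
    then show ?thesis using prod.distinct_set_conv_list[of "[0..<n]" "\<lambda>i. row_inner B i i"] by (simp add: atLeast0LessThan)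
  qed
  also have "\<dots> = of_real (\<Prod>i<n. Re (row_inner B i i))"
    by (simp add: row_inner_self)
  finally have "(norm (Determinant.det B))\<^sup>2 = (\<Prod>i<n. Re (row_inner B i i))"
    by (simp only: of_real_eq_iff)
  also have "\<dots> \<le> (\<Prod>i<n. Re (row_inner A i i))"
    by (rule prod_mono) (use B(3) in \<open>auto simp: row_inner_self sum_nonneg\<close>)
  finally show ?thesis using B(2) A by (simp add: row_inner_self)
qed

text \<open>Each row has squared length at most \<open>n * b\<^sup>2\<close>. The growth
  \<open>n\<close> to the power \<open>n / 2\<close> is what the factor \<open>fact n\<close> of the
  Fredholm series can absorb for every \<open>b\<close>; the Leibniz formula would give
  \<open>fact n * b ^ n\<close>, which suffices only for \<open>b < 1\<close>.\<close>

lemma hadamard_bound: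
  fixes A :: "complex mat"
  assumes A: "A \<in> carrier_mat n n" and b: "\<And>i j. i < n \<Longrightarrow> j < n \<Longrightarrow> norm (A $$ (i, j)) \<le> b"
    and "b \<ge> 0"
  shows "norm (Determinant.det A) \<le> (sqrt (real n) * b) ^ n"
proof -
  have "(norm (Determinant.det A))\<^sup>2 \<le> (\<Prod>i<n. \<Sum>j<n. (norm (A $$ (i, j)))\<^sup>2)"
    by (rule hadamard_inequality[OF A])
  also have "\<dots> \<le> (\<Prod>i<n. \<Sum>j<n. b\<^sup>2)"
    by (intro prod_mono conjI sum_mono sum_nonneg power_mono b) auto
  also have "\<dots> = ((sqrt (real n) * b) ^ n)\<^sup>2"
  proof -
    have "((sqrt (real n) * b) ^ n)\<^sup>2 = ((sqrt (real n) * b)\<^sup>2) ^ n"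
      by (simp only: mult.commute flip: power_mult)
    then show ?thesis by (simp add: power_mult_distrib)
  qed
  finally show ?thesis by (rule power2_le_imp_le) (use \<open>b \<ge> 0\<close> in simp)
qed

section \<open>The determinant of 1 + M as a sum of principal minors\<close>

text \<open>Multiplying out the product over \<open>i\<close> in the Leibniz formula selects a set
  \<open>S\<close> of rows that contribute an entry of \<open>M\<close>; the remaining rows
  contribute Kronecker deltas, which vanish unless \<open>p\<close> fixes the complement of
  \<open>S\<close>. The inner sum is the principal minor of \<open>M\<close> on
  \<open>S\<close>.\<close>

lemma det_one_plus_principal_minors:
  fixes M :: "complex mat"
  assumes M: "M \<in> carrier_mat N N"
  shows "Determinant.det (1\<^sub>m N + M)
    = (\<Sum>S\<in>Pow {..<N}. \<Sum>p | p permutes S. of_int (sign p) * (\<Prod>i\<in>S. M $$ (i, p i)))"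
proof -
  let ?d = "\<lambda>i j::nat. if i = j then 1 else 0 :: complex"
  have fin: "finite {p. p permutes S}" if "S \<in> Pow {..<N}" for S
    using that by (intro finite_permutations) (auto intro: finite_subset)
  have "Determinant.det (1\<^sub>m N + M) = (\<Sum>p | p permutes {..<N}. of_int (sign p) * (\<Prod>i<N. (1\<^sub>m N + M) $$ (i, p i)))"
    using M by (subst det_def'[where n = N]) (auto simp: atLeast0LessThan)
  also have "\<dots> = (\<Sum>p | p permutes {..<N}. of_int (sign p) * (\<Prod>i<N. M $$ (i, p i) + ?d i (p i)))"
  proof (intro sum.cong refl arg_cong2[of _ _ _ _ "(*)"] prod.cong)
    fix p i assume "p \<in> {p. p permutes {..<N}}" and i: "i \<in> {..<N}"
    then have "p i < N" using permutes_in_image[of p "{..<N}" i] by simp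
    then show "(1\<^sub>m N + M) $$ (i, p i) = M $$ (i, p i) + ?d i (p i)" using i M by simp
  qed
  also have "\<dots> = (\<Sum>p | p permutes {..<N}. \<Sum>S\<in>Pow {..<N}.
      of_int (sign p) * ((\<Prod>i\<in>S. M $$ (i, p i)) * (\<Prod>i\<in>{..<N} - S. ?d i (p i))))"
    by (simp add: prod_add sum_distrib_left)
  also have "\<dots> = (\<Sum>S\<in>Pow {..<N}. \<Sum>p | p permutes {..<N}.
      of_int (sign p) * ((\<Prod>i\<in>S. M $$ (i, p i)) * (\<Prod>i\<in>{..<N} - S. ?d i (p i))))"
    by (rule sum.swap)
  also have "\<dots> = (\<Sum>S\<in>Pow {..<N}. \<Sum>p | p permutes S. of_int (sign p) * (\<Prod>i\<in>S. M $$ (i, p i)))"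
  proof (rule sum.cong[OF refl])
    fix S assume S: "S \<in> Pow {..<N}"
    show "(\<Sum>p | p permutes {..<N}.
      of_int (sign p) * ((\<Prod>i\<in>S. M $$ (i, p i)) * (\<Prod>i\<in>{..<N} - S. ?d i (p i))))
      = (\<Sum>p | p permutes S. of_int (sign p) * (\<Prod>i\<in>S. M $$ (i, p i)))"
    proof (rule sum.mono_neutral_cong_right)
      show "finite {p. p permutes {..<N}}" by (simp add: finite_permutations)
      show "{p. p permutes S} \<subseteq> {p. p permutes {..<N}}"
        using S by (auto intro: permutes_subset)
      show "\<forall>p\<in>{p. p permutes {..<N}} - {p. p permutes S}.
          of_int (sign p) * ((\<Prod>i\<in>S. M $$ (i, p i)) * (\<Prod>i\<in>{..<N} - S. ?d i (p i))) = 0"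
      proof
        fix p assume p: "p \<in> {p. p permutes {..<N}} - {p. p permutes S}"
        then have "\<exists>i\<in>{..<N} - S. i \<noteq> p i"
          using permutes_superset[of p "{..<N}" S] by (metis (mono_tags) DiffE mem_Collect_eq)
        then have "(\<Prod>i\<in>{..<N} - S. ?d i (p i)) = 0"
          by (intro prod_zero) (auto intro: bexI[rotated])
        then show "of_int (sign p) * ((\<Prod>i\<in>S. M $$ (i, p i)) * (\<Prod>i\<in>{..<N} - S. ?d i (p i))) = 0"
          by simp
      qed
      fix p assume "p \<in> {p. p permutes S}"
      then have "(\<Prod>i\<in>{..<N} - S. ?d i (p i)) = 1"
        by (intro prod.neutral) (auto simp: permutes_not_in)
      then show "of_int (sign p) * ((\<Prod>i\<in>S. M $$ (i, p i)) * (\<Prod>i\<in>{..<N} - S. ?d i (p i)))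
          = of_int (sign p) * (\<Prod>i\<in>S. M $$ (i, p i))" by simp
    qed
  qed
  finally show ?thesis .
qed

text \<open>An enumeration \<open>\<sigma>\<close> of \<open>S\<close> conjugates the permutations
  of \<open>{..<n}\<close> into those of \<open>S\<close> and preserves signs. Hence the value does
  not depend on the enumeration.\<close>

lemma det_reindex_bij:
  fixes M :: "complex mat"
  assumes \<sigma>: "bij_betw \<sigma> {..<n} S"
  shows "Determinant.det (Matrix.mat n n (\<lambda>(i, j). M $$ (\<sigma> i, \<sigma> j)))
    = (\<Sum>p | p permutes S. of_int (sign p) * (\<Prod>i\<in>S. M $$ (i, p i)))"
proof -
  have inj: "inj_on \<sigma> {..<n}" and im: "\<sigma> ` {..<n} = S" using \<sigma> by (auto simp: bij_betw_def)
  have "Determinant.det (Matrix.mat n n (\<lambda>(i, j). M $$ (\<sigma> i, \<sigma> j)))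
    = (\<Sum>p | p permutes {..<n}. of_int (sign p) * (\<Prod>i<n. M $$ (\<sigma> i, \<sigma> (p i))))"
    by (rule det_mat_lessThan)
  also have "\<dots> = (\<Sum>p | p permutes S. of_int (sign p) * (\<Prod>i\<in>S. M $$ (i, p i)))"
  proof (rule sum.reindex_bij_witness[where i = "map_permutation S (inv_into {..<n} \<sigma>)"
        and j = "map_permutation {..<n} \<sigma>"])
    fix p assume p: "p \<in> {p. p permutes {..<n}}"
    then have p: "p permutes {..<n}" by simp
    show "map_permutation S (inv_into {..<n} \<sigma>) (map_permutation {..<n} \<sigma> p) = p"
      by (rule map_permutation_compose_inv[OF \<sigma> p]) (simp add: inj)
    show "map_permutation {..<n} \<sigma> p \<in> {p. p permutes S}"
      using map_permutation_permutes[OF \<sigma> p] by simp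
    have "(\<Prod>i\<in>S. M $$ (i, map_permutation {..<n} \<sigma> p i)) = (\<Prod>i<n. M $$ (\<sigma> i, \<sigma> (p i)))"
      using inj by (simp flip: im add: prod.reindex map_permutation_apply)
    then show "of_int (sign (map_permutation {..<n} \<sigma> p)) * (\<Prod>i\<in>S. M $$ (i, map_permutation {..<n} \<sigma> p i))
      = of_int (sign p) * (\<Prod>i<n. M $$ (\<sigma> i, \<sigma> (p i)))"
      using sign_map_permutation[OF inj p] by simp
  next
    fix p assume p: "p \<in> {p. p permutes S}"
    then have p: "p permutes S" by simp
    have inv: "bij_betw (inv_into {..<n} \<sigma>) S {..<n}" using \<sigma> by (rule bij_betw_inv_into)
    show "map_permutation S (inv_into {..<n} \<sigma>) p \<in> {p. p permutes {..<n}}"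
      using map_permutation_permutes[OF inv p] by simp
    show "map_permutation {..<n} \<sigma> (map_permutation S (inv_into {..<n} \<sigma>) p) = p"
      by (rule map_permutation_compose_inv[OF inv p]) (use im f_inv_into_f[of _ \<sigma> "{..<n}"] in auto)
  qed
  finally show ?thesis .
qed

text \<open>An injection into a set of the same finite size is onto, so it is enough to count
  injections. The number is what cancels \<open>fact n\<close> when index maps are grouped by their
  image.\<close>

lemma card_extensional_bij_betw:
  assumes "finite S"
  shows "card {\<sigma> \<in> {..<card S} \<rightarrow>\<^sub>E S. bij_betw \<sigma> {..<card S} S} = fact (card S)"
proof -
  have "{\<sigma> \<in> {..<card S} \<rightarrow>\<^sub>E S. bij_betw \<sigma> {..<card S} S}
      = {\<sigma> \<in> {..<card S} \<rightarrow>\<^sub>E S. inj_on \<sigma> {..<card S}}"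
  proof (intro Collect_cong conj_cong refl)
    fix \<sigma> assume \<sigma>: "\<sigma> \<in> {..<card S} \<rightarrow>\<^sub>E S"
    have "\<sigma> ` {..<card S} = S" if "inj_on \<sigma> {..<card S}"
      using \<sigma> card_image[OF that] by (intro card_subset_eq[OF assms]) auto
    then show "bij_betw \<sigma> {..<card S} S \<longleftrightarrow> inj_on \<sigma> {..<card S}"
      by (auto simp: bij_betw_def)
  qed
  then show ?thesis
    using card_inj_on_subset_funcset[of "{..<card S}" S "{..<card S}"] assms
      fact_prod_rev[of "card S", where 'a = nat]
    by simp
qed

text \<open>Non-injective index maps contribute determinants with two equal rows.\<close>

lemma sum_det_reindex:
  fixes M :: "complex mat"
  assumes M: "M \<in> carrier_mat N N"
  shows "(\<Sum>\<sigma>\<in>{..<n} \<rightarrow>\<^sub>E {..<N}. Determinant.det (Matrix.mat n n (\<lambda>(i, j). M $$ (\<sigma> i, \<sigma> j)))) / fact n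
    = (\<Sum>S | S \<subseteq> {..<N} \<and> card S = n. \<Sum>p | p permutes S. of_int (sign p) * (\<Prod>i\<in>S. M $$ (i, p i)))"
proof -
  let ?D = "\<lambda>\<sigma>. Determinant.det (Matrix.mat n n (\<lambda>(i, j). M $$ (\<sigma> i, \<sigma> j)))"
  let ?F = "{..<n} \<rightarrow>\<^sub>E {..<N}"
  let ?G = "{\<sigma> \<in> ?F. inj_on \<sigma> {..<n}}"
  let ?T = "{S. S \<subseteq> {..<N} \<and> card S = n}"
  let ?m = "\<lambda>S. \<Sum>p | p permutes S. of_int (sign p) * (\<Prod>i\<in>S. M $$ (i, p i))"
  have "(\<Sum>\<sigma>\<in>?F. ?D \<sigma>) = (\<Sum>\<sigma>\<in>?G. ?D \<sigma>)"
  proof (rule sum.mono_neutral_right)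
    show "finite ?F" by (simp add: finite_PiE)
    show "\<forall>\<sigma>\<in>?F - ?G. ?D \<sigma> = 0"
    proof
      fix \<sigma> assume "\<sigma> \<in> ?F - ?G"
      then obtain i j where ij: "i < n" "j < n" "i \<noteq> j" "\<sigma> i = \<sigma> j" by (auto simp: inj_on_def)
      show "?D \<sigma> = 0"
        by (rule det_identical_rows[where n = n and i = i and j = j])
           (use ij in \<open>auto intro!: eq_vecI\<close>)
    qed
  qed auto
  also have "\<dots> = (\<Sum>S\<in>?T. \<Sum>\<sigma> | \<sigma> \<in> ?G \<and> \<sigma> ` {..<n} = S. ?D \<sigma>)"
  proof (rule sum.group[symmetric])
    show "finite ?G" by (simp add: finite_PiE)
    show "finite ?T" by (rule finite_subset[of _ "Pow {..<N}"]) auto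
    show "(\<lambda>\<sigma>. \<sigma> ` {..<n}) ` ?G \<subseteq> ?T"
      by (auto simp: card_image PiE_def Pi_def)
  qed
  also have "\<dots> = (\<Sum>S\<in>?T. fact n * ?m S)"
  proof (rule sum.cong[OF refl])
    fix S assume S: "S \<in> ?T"
    then have "finite S" by (auto intro: finite_subset)
    have eq: "{\<sigma>. \<sigma> \<in> ?G \<and> \<sigma> ` {..<n} = S} = {\<sigma> \<in> {..<card S} \<rightarrow>\<^sub>E S. bij_betw \<sigma> {..<card S} S}"
    proof -
      have card: "card S = n" and sub: "S \<subseteq> {..<N}" using S by auto
      have "(\<sigma> \<in> ?F \<and> inj_on \<sigma> {..<n}) \<and> \<sigma> ` {..<n} = S
        \<longleftrightarrow> \<sigma> \<in> {..<n} \<rightarrow>\<^sub>E S \<and> inj_on \<sigma> {..<n} \<and> \<sigma> ` {..<n} = S" for \<sigma>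
      proof (cases "\<sigma> ` {..<n} = S")
        case True
        then have "\<sigma> i \<in> S" "\<sigma> i \<in> {..<N}" if "i \<in> {..<n}" for i
          using sub that by blast+
        then have "\<sigma> \<in> ?F \<longleftrightarrow> \<sigma> \<in> {..<n} \<rightarrow>\<^sub>E S" by (simp add: PiE_iff)
        then show ?thesis by simp
      qed simp
      then show ?thesis unfolding card bij_betw_def mem_Collect_eq by (intro Collect_cong)
    qed
    have "(\<Sum>\<sigma> | \<sigma> \<in> ?G \<and> \<sigma> ` {..<n} = S. ?D \<sigma>) = (\<Sum>\<sigma> | \<sigma> \<in> ?G \<and> \<sigma> ` {..<n} = S. ?m S)"
    proof (rule sum.cong[OF refl])
      fix \<sigma> assume "\<sigma> \<in> {\<sigma>. \<sigma> \<in> ?G \<and> \<sigma> ` {..<n} = S}"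
      then have "bij_betw \<sigma> {..<n} S" by (simp add: bij_betw_def)
      then show "?D \<sigma> = ?m S" by (rule det_reindex_bij)
    qed
    also have "\<dots> = fact n * ?m S"
      unfolding sum_constant eq card_extensional_bij_betw[OF \<open>finite S\<close>] using S by simp
    finally show "(\<Sum>\<sigma> | \<sigma> \<in> ?G \<and> \<sigma> ` {..<n} = S. ?D \<sigma>) = fact n * ?m S" .
  qed
  also have "\<dots> = fact n * (\<Sum>S\<in>?T. ?m S)" by (simp only: sum_distrib_left)
  finally show ?thesis by (simp only: nonzero_mult_div_cancel_left fact_nonzero not_False_eq_True)
qed

text \<open>The terms with \<open>n > N\<close> vanish because \<open>{..<N}\<close> has no subset
  of that size. Stating the finite expansion as an infinite series indexed by all \<open>n\<close>
  allows a comparison with the Fredholm series term by term.\<close>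

theorem det_one_plus_sums:
  fixes M :: "complex mat"
  assumes M: "M \<in> carrier_mat N N"
  shows "(\<lambda>n. (\<Sum>\<sigma>\<in>{..<n} \<rightarrow>\<^sub>E {..<N}. Determinant.det (Matrix.mat n n (\<lambda>(i, j). M $$ (\<sigma> i, \<sigma> j)))) / fact n)
    sums Determinant.det (1\<^sub>m N + M)"
proof -
  let ?m = "\<lambda>S. \<Sum>p | p permutes S. of_int (sign p) * (\<Prod>i\<in>S. M $$ (i, p i))"
  have "Determinant.det (1\<^sub>m N + M) = (\<Sum>S\<in>Pow {..<N}. ?m S)"
    by (rule det_one_plus_principal_minors[OF M])
  also have "\<dots> = (\<Sum>n\<le>N. \<Sum>S | S \<in> Pow {..<N} \<and> card S = n. ?m S)"
    by (rule sum.group[symmetric]) (auto dest: card_mono[rotated])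
  also have "\<dots> = (\<Sum>n\<le>N. \<Sum>S | S \<subseteq> {..<N} \<and> card S = n. ?m S)" by simp
  finally have *: "Determinant.det (1\<^sub>m N + M) = (\<Sum>n\<le>N. \<Sum>S | S \<subseteq> {..<N} \<and> card S = n. ?m S)" .
  show ?thesis unfolding sum_det_reindex[OF M] *
  proof (rule sums_finite)
    fix n assume "n \<notin> {..N}"
    have "card S \<noteq> n" if "S \<subseteq> {..<N}" for S
      using card_mono[OF _ that] \<open>n \<notin> {..N}\<close> by auto
    then have "{S. S \<subseteq> {..<N} \<and> card S = n} = {}" by auto
    then show "(\<Sum>S | S \<subseteq> {..<N} \<and> card S = n. ?m S) = 0" by (simp only: sum.empty)
  qed simp
qed

text \<open>A permutation only reorders the column factors, so both kinds of factor leave the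
  determinant as full products. This extracts the weights from the finite matrix and the square
  roots from the continuum kernel.\<close>

lemma det_scale_rows_cols:
  "Determinant.det (Matrix.mat n n (\<lambda>(i, j). c i * X i j * d j))
    = (\<Prod>i<n. c i) * (\<Prod>i<n. d i) * Determinant.det (Matrix.mat n n (\<lambda>(i, j). X i j))"
  for c d :: "nat \<Rightarrow> complex"
proof -
  have "Determinant.det (Matrix.mat n n (\<lambda>(i, j). c i * X i j * d j))
      = (\<Sum>p | p permutes {..<n}. of_int (sign p) * (\<Prod>i<n. c i * X i (p i) * d (p i)))"
    by (rule det_mat_lessThan)
  also have "\<dots> = (\<Sum>p | p permutes {..<n}. (\<Prod>i<n. c i) * (\<Prod>i<n. d i) *
      (of_int (sign p) * (\<Prod>i<n. X i (p i))))"
  proof (rule sum.cong[OF refl])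
    fix p assume "p \<in> {p. p permutes {..<n}}"
    then have "(\<Prod>i<n. d (p i)) = (\<Prod>i<n. d i)"
      using prod.permute[of p "{..<n}" d] by (simp add: o_def)
    then show "of_int (sign p) * (\<Prod>i<n. c i * X i (p i) * d (p i)) = (\<Prod>i<n. c i) * (\<Prod>i<n. d i) *
      (of_int (sign p) * (\<Prod>i<n. X i (p i)))"
      by (simp add: prod.distrib)
  qed
  also have "\<dots> = (\<Prod>i<n. c i) * (\<Prod>i<n. d i) *
      (\<Sum>p | p permutes {..<n}. of_int (sign p) * (\<Prod>i<n. X i (p i)))"
    by (simp only: sum_distrib_left)
  also have "(\<Sum>p | p permutes {..<n}. of_int (sign p) * (\<Prod>i<n. X i (p i)))
      = Determinant.det (Matrix.mat n n (\<lambda>(i, j). X i j))"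
    by (rule det_mat_lessThan[symmetric])
  finally show ?thesis .
qed

text \<open>From \<open>n ^ n \<le> exp n * fact n\<close> the terms are at most
  \<open>(c * sqrt (exp 1)) ^ n / sqrt (fact n)\<close>, and the ratio test applies to
  these.\<close>

lemma summable_hadamard_series:
  assumes "c \<ge> 0"
  shows "summable (\<lambda>n. (c * sqrt (real n)) ^ n / fact n)"
proof -
  define d where "d = c * sqrt (exp 1)"
  have d: "d \<ge> 0" using assms by (simp add: d_def)
  \<comment> \<open>From index \<open>m\<close> on, \<open>2 * d \<le> sqrt (Suc n)\<close>, which
    makes the quotient of successive terms at most 1/2.\<close>
  obtain m :: nat where m: "real m \<ge> 4 * d\<^sup>2" using real_arch_simple by blast
  have "summable (\<lambda>n. d ^ n / sqrt (fact n))"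
  proof (rule summable_ratio_test)
    fix n assume n: "m \<le> n"
    have "(2 * d)\<^sup>2 \<le> real (Suc n)" using m n by (simp add: power_mult_distrib)
    then have "2 * d \<le> sqrt (real (Suc n))" by (rule real_le_rsqrt)
    then have "d / sqrt (real (Suc n)) \<le> 1 / 2" by (simp add: field_simps)
    then have "d / sqrt (real (Suc n)) * (d ^ n / sqrt (fact n)) \<le> 1 / 2 * (d ^ n / sqrt (fact n))"
      by (rule mult_right_mono) (use d in simp)
    moreover have "d ^ Suc n / sqrt (fact (Suc n)) = d / sqrt (real (Suc n)) * (d ^ n / sqrt (fact n))"
    proof -
      have "sqrt (fact (Suc n)) = sqrt (real (Suc n)) * sqrt (fact n)"
        unfolding fact_Suc of_nat_mult by (simp only: real_sqrt_mult of_nat_fact)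
      then show ?thesis by simp
    qed
    moreover have "norm (d ^ k / sqrt (fact k)) = d ^ k / sqrt (fact k)" for k :: nat
      using d by simp
    ultimately show "norm (d ^ Suc n / sqrt (fact (Suc n))) \<le> 1 / 2 * norm (d ^ n / sqrt (fact n))"
      by metis
  qed simp
  then show ?thesis
  proof (rule summable_comparison_test'[where N = 0])
    fix n :: nat
    have "real n ^ n / fact n \<le> exp (real n)"
    proof -
      \<comment> \<open>A single term of the exponential series at \<open>n\<close>, namely the one
        with \<open>k = n\<close>, is bounded by the whole sum.\<close>
      have "(\<Sum>k\<in>{n}. real n ^ k /\<^sub>R fact k) \<le> (\<Sum>k. real n ^ k /\<^sub>R fact k)"
        by (rule sum_le_suminf[OF summable_exp_generic]) auto
      then show ?thesis by (simp add: exp_def divide_inverse mult.commute)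
    qed
    then have "real n ^ n \<le> exp 1 ^ n * fact n"
      by (simp add: field_simps flip: exp_of_nat_mult)
    then have "sqrt (real n) ^ n \<le> sqrt (exp 1) ^ n * sqrt (fact n)"
      by (metis real_sqrt_le_iff real_sqrt_mult real_sqrt_power)
    then have "(c * sqrt (real n)) ^ n \<le> d ^ n * sqrt (fact n)"
      unfolding d_def power_mult_distrib using assms by (simp add: mult_left_mono mult.assoc)
    then have "(c * sqrt (real n)) ^ n / fact n \<le> d ^ n * sqrt (fact n) / fact n"
      by (rule divide_right_mono) simp
    also have "\<dots> = d ^ n / sqrt (fact n)"
      by (simp add: field_simps flip: real_sqrt_mult)
    finally show "norm ((c * sqrt (real n)) ^ n / fact n) \<le> d ^ n / sqrt (fact n)"
      using assms by simp
  qed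
qed

section \<open>Uniform convergence to continuous limits\<close>

text \<open>Uniform convergence alone is not stable under products. On a compact set, continuity of
  the limit makes it bounded, which repairs this; bundled together, the two properties pass through
  sums, products, determinants, quadratures and dominated series.\<close>

definition cconv :: "'a::metric_space set \<Rightarrow> (nat \<Rightarrow> 'a \<Rightarrow> complex) \<Rightarrow> ('a \<Rightarrow> complex) \<Rightarrow> bool" where
  "cconv S f l \<longleftrightarrow> uniform_limit S f l sequentially \<and> continuous_on S l"

lemma cconv_const: "continuous_on S l \<Longrightarrow> cconv S (\<lambda>N. l) l"
  by (simp add: cconv_def uniform_limit_const)

lemma cconv_mult:
  assumes "compact S" "cconv S f l" "cconv S g m"
  shows "cconv S (\<lambda>N x. f N x * g N x) (\<lambda>x. l x * m x)"
  using assms unfolding cconv_def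
  by (auto intro!: uniform_lim_mult continuous_intros compact_imp_bounded compact_continuous_image)

lemma cconv_add:
  assumes "cconv S f l" "cconv S g m"
  shows "cconv S (\<lambda>N x. f N x + g N x) (\<lambda>x. l x + m x)"
  using assms unfolding cconv_def by (auto intro!: uniform_limit_intros continuous_intros)

lemma cconv_sum:
  assumes "finite I" "\<And>i. i \<in> I \<Longrightarrow> cconv S (f i) (l i)"
  shows "cconv S (\<lambda>N x. \<Sum>i\<in>I. f i N x) (\<lambda>x. \<Sum>i\<in>I. l i x)"
  using assms by (induction I rule: finite_induct) (auto intro: cconv_add cconv_const)

lemma cconv_prod:
  assumes "compact S" "finite I" "\<And>i. i \<in> I \<Longrightarrow> cconv S (f i) (l i)"
  shows "cconv S (\<lambda>N x. \<Prod>i\<in>I. f i N x) (\<lambda>x. \<Prod>i\<in>I. l i x)"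
  using assms(2,3) by (induction I rule: finite_induct) (auto intro: cconv_mult[OF \<open>compact S\<close>] cconv_const)

lemma cconv_compose:
  assumes "cconv T f l" "continuous_on S h" "h ` S \<subseteq> T"
  shows "cconv S (\<lambda>N x. f N (h x)) (\<lambda>x. l (h x))"
  using assms unfolding cconv_def
  by (auto intro!: uniform_limit_compose'[where A = T] intro: continuous_on_compose2)

lemma cconv_det:
  assumes S: "compact S" and f: "\<And>i j. i < n \<Longrightarrow> j < n \<Longrightarrow> cconv S (f i j) (l i j)"
  shows "cconv S (\<lambda>N x. Determinant.det (Matrix.mat n n (\<lambda>(i, j). f i j N x)))
    (\<lambda>x. Determinant.det (Matrix.mat n n (\<lambda>(i, j). l i j x)))"
proof -
  show ?thesis unfolding det_mat_lessThan
  proof (intro cconv_sum cconv_mult[OF S] cconv_const continuous_on_const cconv_prod[OF S] f)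
    fix p i assume "p \<in> {p. p permutes {..<n}}" "i \<in> {..<n}"
    then show "i < n" "p i < n" using permutes_in_image[of p "{..<n}" i] by auto
  qed (auto simp: finite_permutations)
qed

text \<open>A majorant that depends neither on \<open>N\<close> nor on \<open>x\<close> bounds all
  tails at once, so only finitely many terms have to converge.\<close>

lemma cconv_suminf:
  assumes f: "\<And>n. cconv S (f n) (l n)"
    and b: "\<And>n N x. x \<in> S \<Longrightarrow> norm (f n N x) \<le> b n" and "summable b"
  shows "cconv S (\<lambda>N x. \<Sum>n. f n N x) (\<lambda>x. \<Sum>n. l n x)"
proof -
  \<comment> \<open>The majorant is assumed for \<open>f\<close> only; it passes to the limits
    \<open>l\<close>.\<close>
  have lb: "norm (l n x) \<le> b n" if "x \<in> S" for n x
  proof (rule tendsto_upperbound)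
    show "((\<lambda>N. norm (f n N x)) \<longlongrightarrow> norm (l n x)) sequentially"
      using f[of n] that by (intro tendsto_norm tendsto_uniform_limitI[where S = S]) (auto simp: cconv_def)
    show "\<forall>\<^sub>F N in sequentially. norm (f n N x) \<le> b n"
      by (intro always_eventually allI b[OF that])
  qed simp
  have "uniform_limit S (\<lambda>m x. \<Sum>n<m. l n x) (\<lambda>x. \<Sum>n. l n x) sequentially"
    by (rule Weierstrass_m_test[OF lb \<open>summable b\<close>])
  moreover have "\<forall>\<^sub>F m in sequentially. continuous_on S (\<lambda>x. \<Sum>n<m. l n x)"
    by (intro always_eventually allI continuous_on_sum) (use f in \<open>simp add: cconv_def\<close>)
  ultimately have cont: "continuous_on S (\<lambda>x. \<Sum>n. l n x)"
    by (intro uniform_limit_theorem) auto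
  have "uniform_limit S (\<lambda>N x. \<Sum>n. f n N x) (\<lambda>x. \<Sum>n. l n x) sequentially"
  proof (rule uniform_limitI)
    fix e :: real assume e: "e > 0"
    \<comment> \<open>The two tails receive \<open>e / 4\<close> each and the common finite part
      \<open>e / 2\<close>.\<close>
    obtain m where m: "norm (\<Sum>n. b (n + m)) < e / 4"
      using suminf_exist_split[of "e / 4" b] e \<open>summable b\<close> by auto
    have sb: "summable (\<lambda>n. b (n + m))" using \<open>summable b\<close> by (simp add: summable_iff_shift)
    have "cconv S (\<lambda>N x. \<Sum>n<m. f n N x) (\<lambda>x. \<Sum>n<m. l n x)"
      by (rule cconv_sum) (auto intro: f)
    then have "\<forall>\<^sub>F N in sequentially. \<forall>x\<in>S. dist (\<Sum>n<m. f n N x) (\<Sum>n<m. l n x) < e / 2"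
      unfolding cconv_def by (rule uniform_limitD[OF conjunct1]) (use e in simp)
    then show "\<forall>\<^sub>F N in sequentially. \<forall>x\<in>S. dist (\<Sum>n. f n N x) (\<Sum>n. l n x) < e"
    proof eventually_elim
      case (elim N)
      show ?case
      proof
        fix x assume x: "x \<in> S"
        have tail: "summable (\<lambda>n. g (n + m))" "norm (\<Sum>n. g (n + m)) < e / 4"
          "(\<Sum>n. g n) = (\<Sum>n. g (n + m)) + (\<Sum>n<m. g n)" if "\<And>n. norm (g n) \<le> b n" for g :: "nat \<Rightarrow> complex"
        proof -
          have "summable g"
            by (rule summable_comparison_test'[OF \<open>summable b\<close>]) (rule that)
          then show "(\<Sum>n. g n) = (\<Sum>n. g (n + m)) + (\<Sum>n<m. g n)" by (rule suminf_split_initial_segment)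
          show "summable (\<lambda>n. g (n + m))" using \<open>summable g\<close> by (simp add: summable_iff_shift)
          have "norm (\<Sum>n. g (n + m)) \<le> (\<Sum>n. b (n + m))"
            by (rule norm_suminf_le[OF that sb])
          then show "norm (\<Sum>n. g (n + m)) < e / 4" using m by simp
        qed
        note tf = tail[of "\<lambda>n. f n N x", OF b[OF x]] and tl = tail[of "\<lambda>n. l n x", OF lb[OF x]]
        have "dist (\<Sum>n. f n N x) (\<Sum>n. l n x)
          = norm ((\<Sum>n<m. f n N x) - (\<Sum>n<m. l n x) + ((\<Sum>n. f (n + m) N x) - (\<Sum>n. l (n + m) x)))"
          unfolding dist_norm tf(3) tl(3) by (simp add: algebra_simps)
        also have "\<dots> \<le> norm ((\<Sum>n<m. f n N x) - (\<Sum>n<m. l n x))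
            + (norm (\<Sum>n. f (n + m) N x) + norm (\<Sum>n. l (n + m) x))"
          by (intro order_trans[OF norm_triangle_ineq] add_mono order_refl norm_triangle_ineq4)
        also have "\<dots> < e"
          using elim[rule_format, OF x] tf(2) tl(2) unfolding dist_norm by linarith
        finally show "dist (\<Sum>n. f n N x) (\<Sum>n. l n x) < e" .
      qed
    qed
  qed
  with cont show ?thesis by (simp add: cconv_def)
qed

section \<open>Discretized measures\<close>

text \<open>Weak convergence of weighted point masses to \<open>M\<close>, tested against functions
  continuous on a compact \<open>T\<close>. The space of \<open>M\<close> may be smaller than
  \<open>T\<close>: in the application it is the open image of \<open>Dp\<close>, and
  \<open>T\<close> the image of the closure. The sigma-algebra of \<open>M\<close> is left open, so
  measurability of the test functions is part of the interface.\<close>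

locale discretization =
  fixes T :: "complex set" and M :: "complex measure"
    and wt :: "nat \<Rightarrow> nat \<Rightarrow> real" and u :: "nat \<Rightarrow> nat \<Rightarrow> complex"
  assumes compact_T: "compact T"
    and finite_measure_M: "finite_measure M"
    and space_M: "space M \<subseteq> T"
    and continuous_measurable: "\<And>g :: complex \<Rightarrow> complex. continuous_on T g \<Longrightarrow> g \<in> borel_measurable M"
    and nodes: "\<And>N j. j < N \<Longrightarrow> u N j \<in> T"
    and weights: "\<And>N j. wt N j \<ge> 0"
    and converges: "\<And>g :: complex \<Rightarrow> complex. continuous_on T g \<Longrightarrow>
      (\<lambda>N. \<Sum>j<N. of_real (wt N j) * g (u N j)) \<longlonglongrightarrow> (\<integral>w. g w \<partial>M)"
begin

definition quad :: "nat \<Rightarrow> (complex \<Rightarrow> complex) \<Rightarrow> complex" where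
  "quad N g = (\<Sum>j<N. of_real (wt N j) * g (u N j))"

text \<open>Testing with the constant 1 shows that the total masses converge, hence are bounded. The
  bound is made positive so that it can be divided by.\<close>

lemma weights_bounded: obtains C where "C > 0" "\<And>N. (\<Sum>j<N. wt N j) \<le> C"
proof atomize_elim
  have "convergent (\<lambda>N. \<Sum>j<N. complex_of_real (wt N j))"
    using converges[of "\<lambda>_. 1"] by (auto simp: convergent_def)
  then obtain C where C: "\<And>N. norm (\<Sum>j<N. complex_of_real (wt N j)) \<le> C"
    by (elim convergent_imp_Bseq[THEN BseqE]) blast
  have "norm (\<Sum>j<N. complex_of_real (wt N j)) = (\<Sum>j<N. wt N j)" for N
    unfolding of_real_sum[symmetric] norm_of_real by (simp add: sum_nonneg weights)
  then show "\<exists>C>0. \<forall>N. (\<Sum>j<N. wt N j) \<le> C"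
    using C by (intro exI[of _ "max C 1"]) (simp add: max.coboundedI1)
qed

lemma quad_norm_le:
  assumes "(\<Sum>j<N. wt N j) \<le> C" "\<And>w. w \<in> T \<Longrightarrow> norm (g w) \<le> B" "B \<ge> 0"
  shows "norm (quad N g) \<le> C * B"
proof -
  have "norm (quad N g) \<le> (\<Sum>j<N. wt N j * B)"
    unfolding quad_def
    by (rule sum_norm_le) (auto simp: norm_mult weights nodes assms(2) intro!: mult_left_mono)
  also have "\<dots> \<le> C * B"
    unfolding sum_distrib_right[symmetric] using assms by (intro mult_right_mono) auto
  finally show ?thesis .
qed

lemma quad_diff: "quad N g - quad N h = quad N (\<lambda>w. g w - h w)"
  by (simp add: quad_def sum_subtractf algebra_simps)

text \<open>Convergence is given for each single \<open>p\<close>. It becomes uniform because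
  \<open>G'\<close> is uniformly continuous on \<open>P \<times> T\<close> and the total weights are
  bounded: the quadratures are then equicontinuous in \<open>p\<close>, uniformly in
  \<open>N\<close>, and a finite net in \<open>P\<close> suffices. Replacing \<open>G'\<close> by
  \<open>G N\<close> costs the total weight times a uniform error.\<close>

lemma cconv_quad:
  fixes P :: "'p::metric_space set"
  assumes P: "compact P"
    and G: "cconv (P \<times> T) (\<lambda>N q. G N (fst q) (snd q)) (\<lambda>q. G' (fst q) (snd q))"
  shows "cconv P (\<lambda>N p. quad N (G N p)) (\<lambda>p. \<integral>w. G' p w \<partial>M)"
proof -
  obtain C where C: "C > 0" "\<And>N. (\<Sum>j<N. wt N j) \<le> C" using weights_bounded by blast
  have cont: "continuous_on (P \<times> T) (\<lambda>q. G' (fst q) (snd q))" using G by (simp add: cconv_def)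
  have "continuous_on T (\<lambda>w. G' (fst (p, w)) (snd (p, w)))" if "p \<in> P" for p
    by (rule continuous_on_compose2[OF cont]) (use that in \<open>auto intro!: continuous_intros\<close>)
  then have "continuous_on T (G' p)" if "p \<in> P" for p using that by simp
  then have lim: "(\<lambda>N. quad N (G' p)) \<longlonglongrightarrow> (\<integral>w. G' p w \<partial>M)" if "p \<in> P" for p
    unfolding quad_def using that converges by blast
  \<comment> \<open>One modulus of continuity serves all quadratures and, by passage to the limit,
    the integral as well; no estimate on \<open>M\<close> itself is required.\<close>
  have equi: "\<exists>d>0. \<forall>p\<in>P. \<forall>p'\<in>P. dist p p' < d \<longrightarrow> (\<forall>N. norm (quad N (G' p) - quad N (G' p')) \<le> e)
      \<and> norm ((\<integral>w. G' p w \<partial>M) - (\<integral>w. G' p' w \<partial>M)) \<le> e" if e: "e > 0" for e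
  proof -
    have "uniformly_continuous_on (P \<times> T) (\<lambda>q. G' (fst q) (snd q))"
      by (rule compact_uniformly_continuous[OF cont compact_Times[OF P compact_T]])
    then obtain d where d: "d > 0" "\<And>q q'. q \<in> P \<times> T \<Longrightarrow> q' \<in> P \<times> T \<Longrightarrow> dist q q' < d
        \<Longrightarrow> dist (G' (fst q) (snd q)) (G' (fst q') (snd q')) < e / C"
      unfolding uniformly_continuous_on_def using e C(1) by (metis divide_pos_pos dist_commute)
    show ?thesis
    proof (intro exI[of _ d] conjI ballI impI allI)
      fix p p' assume pp: "p \<in> P" "p' \<in> P" "dist p p' < d"
      have "norm (G' p w - G' p' w) \<le> e / C" if "w \<in> T" for w
        using d(2)[of "(p, w)" "(p', w)"] pp that by (simp add: dist_Pair_Pair dist_norm less_imp_le)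
      then have "norm (quad N (\<lambda>w. G' p w - G' p' w)) \<le> C * (e / C)" for N
        using e C by (intro quad_norm_le) auto
      then show *: "norm (quad N (G' p) - quad N (G' p')) \<le> e" for N
        using C(1) by (simp add: quad_diff)
      show "norm ((\<integral>w. G' p w \<partial>M) - (\<integral>w. G' p' w \<partial>M)) \<le> e"
      proof (rule tendsto_upperbound)
        show "((\<lambda>N. norm (quad N (G' p) - quad N (G' p'))) \<longlongrightarrow> norm ((\<integral>w. G' p w \<partial>M) - (\<integral>w. G' p' w \<partial>M))) sequentially"
          by (intro tendsto_intros lim pp)
        show "\<forall>\<^sub>F N in sequentially. norm (quad N (G' p) - quad N (G' p')) \<le> e"
          by (intro always_eventually allI *)
      qed simp
    qed (rule d(1))
  qed
  have contI: "continuous_on P (\<lambda>p. \<integral>w. G' p w \<partial>M)"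
    unfolding continuous_on_iff
  proof (intro ballI allI impI)
    fix p and e :: real assume p: "p \<in> P" and e: "e > 0"
    obtain d where "d > 0" "\<forall>p\<in>P. \<forall>p'\<in>P. dist p p' < d \<longrightarrow>
        norm ((\<integral>w. G' p w \<partial>M) - (\<integral>w. G' p' w \<partial>M)) \<le> e / 2"
      using equi[of "e / 2"] e by auto
    then show "\<exists>d>0. \<forall>p'\<in>P. dist p' p < d \<longrightarrow> dist (\<integral>w. G' p' w \<partial>M) (\<integral>w. G' p w \<partial>M) < e"
      using p e by (intro exI[of _ d]) (force simp: dist_norm)
  qed
  have 1: "uniform_limit P (\<lambda>N p. quad N (G' p)) (\<lambda>p. \<integral>w. G' p w \<partial>M) sequentially"
  proof (rule uniform_limitI)
    fix e :: real assume e: "e > 0"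
    obtain d where d: "d > 0" "\<And>p p'. p \<in> P \<Longrightarrow> p' \<in> P \<Longrightarrow> dist p p' < d \<Longrightarrow>
        (\<forall>N. norm (quad N (G' p) - quad N (G' p')) \<le> e / 4)
        \<and> norm ((\<integral>w. G' p w \<partial>M) - (\<integral>w. G' p' w \<partial>M)) \<le> e / 4"
      using equi[of "e / 4"] e by (metis zero_less_divide_iff zero_less_numeral)
    \<comment> \<open>A finite \<open>d\<close>-net. The error at \<open>p\<close> consists of three
      parts of at most \<open>e / 4\<close>: from \<open>p\<close> to a net point in the quadrature,
      the convergence at the net point, and back to \<open>p\<close> in the integral.\<close>
    obtain F where F: "F \<subseteq> P" "finite F" "P \<subseteq> (\<Union>c\<in>F. ball c d)"
      using compactE_image[OF P, of P "\<lambda>c. ball c d"] d(1) by force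
    have "\<forall>\<^sub>F N in sequentially. \<forall>c\<in>F. dist (quad N (G' c)) (\<integral>w. G' c w \<partial>M) < e / 4"
    proof (intro eventually_ball_finite ballI)
      fix c assume "c \<in> F"
      then show "\<forall>\<^sub>F N in sequentially. dist (quad N (G' c)) (\<integral>w. G' c w \<partial>M) < e / 4"
        using F(1) e by (intro tendstoD[OF lim]) auto
    qed (use F in simp)
    then show "\<forall>\<^sub>F N in sequentially. \<forall>p\<in>P. dist (quad N (G' p)) (\<integral>w. G' p w \<partial>M) < e"
    proof eventually_elim
      case (elim N)
      show ?case
      proof
        fix p assume p: "p \<in> P"
        then obtain c where c: "c \<in> F" "dist p c < d" using F by (auto simp: dist_commute)
        then have "c \<in> P" using F by auto
        note dd = d(2)[OF p this c(2)]
        have "dist (quad N (G' p)) (\<integral>w. G' p w \<partial>M)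
          \<le> norm (quad N (G' p) - quad N (G' c)) + (norm (quad N (G' c) - (\<integral>w. G' c w \<partial>M))
            + norm ((\<integral>w. G' p w \<partial>M) - (\<integral>w. G' c w \<partial>M)))"
          unfolding dist_norm by norm
        also have "\<dots> < e"
          using dd[THEN conjunct1, rule_format, of N] dd[THEN conjunct2] elim[rule_format, OF c(1)] e
          unfolding dist_norm by linarith
        finally show "dist (quad N (G' p)) (\<integral>w. G' p w \<partial>M) < e" .
      qed
    qed
  qed
  have 2: "uniform_limit P (\<lambda>N p. quad N (G N p) - quad N (G' p)) (\<lambda>p. 0) sequentially"
  proof (rule uniform_limitI)
    fix e :: real assume e: "e > 0"
    have "\<forall>\<^sub>F N in sequentially. \<forall>q\<in>P \<times> T. dist (G N (fst q) (snd q)) (G' (fst q) (snd q)) < e / (2 * C)"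
      using G e C unfolding cconv_def uniform_limit_iff by simp
    then show "\<forall>\<^sub>F N in sequentially. \<forall>p\<in>P. dist (quad N (G N p) - quad N (G' p)) 0 < e"
    proof eventually_elim
      case (elim N)
      show ?case
      proof
        fix p assume "p \<in> P"
        then have "norm (quad N (\<lambda>w. G N p w - G' p w)) \<le> C * (e / (2 * C))"
          using elim e C by (intro quad_norm_le) (fastforce simp: dist_norm)+
        then show "dist (quad N (G N p) - quad N (G' p)) 0 < e"
          using e C(1) by (simp add: quad_diff)
      qed
    qed
  qed
  show ?thesis
    using uniform_limit_add[OF 1 2] contI by (simp add: cconv_def)
qed

end

section \<open>n-fold sums and n-fold integrals as iterated functionals\<close>

text \<open>Taking for \<open>L\<close> the quadrature or the integral yields the n-fold sum or the
  n-fold integral, so a single induction compares the two. The last coordinate is the innermost;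
  starting from \<open>undefined\<close> keeps all arguments extensional, as in the product
  measure.\<close>

primrec iter_functional ::
  "((complex \<Rightarrow> complex) \<Rightarrow> complex) \<Rightarrow> nat \<Rightarrow> ((nat \<Rightarrow> complex) \<Rightarrow> complex) \<Rightarrow> complex"
where
  "iter_functional L 0 G = G (\<lambda>_. undefined)"
| "iter_functional L (Suc n) G = iter_functional L n (\<lambda>y. L (\<lambda>w. G (y(n := w))))"

text \<open>Tychonoff: the extensional functions form a full product in which every coordinate from
  \<open>n\<close> on is confined to the one-point set of \<open>undefined\<close>.\<close>

lemma compact_PiE_lessThan:
  fixes T :: "complex set"
  assumes "compact T"
  shows "compact ({..<n} \<rightarrow>\<^sub>E T)"
proof -
  let ?S = "\<lambda>i. if i < n then T else {undefined}"
  have "compactin (product_topology (\<lambda>i. euclidean) UNIV) (PiE UNIV ?S)"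
    unfolding compactin_PiE using assms by auto
  moreover have "PiE UNIV ?S = {..<n} \<rightarrow>\<^sub>E T"
    by (auto simp: PiE_def Pi_def extensional_def split: if_splits)
  ultimately show ?thesis by (simp add: euclidean_product_topology)
qed

lemma continuous_on_fun_upd:
  fixes a :: "'a::topological_space \<Rightarrow> nat \<Rightarrow> complex"
  assumes "continuous_on S a" "continuous_on S b"
  shows "continuous_on S (\<lambda>x. (a x)(n := b x))"
proof (rule continuous_on_coordinatewise_then_product)
  fix i show "continuous_on S (\<lambda>x. ((a x)(n := b x)) i)"
    using assms(2) continuous_on_product_then_coordinatewise[OF assms(1), of i] by (cases "i = n") auto
qed

lemma fun_upd_PiE_lessThan:
  assumes "y \<in> {..<n} \<rightarrow>\<^sub>E T" "w \<in> T"
  shows "y(n := w) \<in> {..<Suc n} \<rightarrow>\<^sub>E T"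
  using assms by (auto simp: PiE_def Pi_def extensional_def less_Suc_eq)

context discretization
begin

text \<open>The coordinates not yet integrated join the parameter: \<open>cconv_quad\<close> is
  applied over the compact set of pairs \<open>(p, y)\<close>. For this reason it admits parameters
  from an arbitrary metric space.\<close>

lemma cconv_iter:
  fixes P :: "'p::metric_space set"
  assumes P: "compact P"
    and G: "cconv (P \<times> ({..<n} \<rightarrow>\<^sub>E T)) (\<lambda>N q. G N (fst q) (snd q)) (\<lambda>q. G' (fst q) (snd q))"
  shows "cconv P (\<lambda>N p. iter_functional (quad N) n (G N p))
    (\<lambda>p. iter_functional (integral\<^sup>L M) n (G' p))"
  using G
proof (induction n arbitrary: G G')
  case 0
  have "continuous_on P (\<lambda>p. (p, \<lambda>_::nat. undefined :: complex))"
    by (intro continuous_on_Pair continuous_on_id continuous_on_const)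
  from cconv_compose[OF 0 this] show ?case by auto
next
  case (Suc n)
  let ?Y = "\<lambda>n. {..<n} \<rightarrow>\<^sub>E T"
  have "cconv ((P \<times> ?Y n) \<times> T)
      (\<lambda>N q. G N (fst (fst (fst q), (snd (fst q))(n := snd q))) (snd (fst (fst q), (snd (fst q))(n := snd q))))
      (\<lambda>q. G' (fst (fst (fst q), (snd (fst q))(n := snd q))) (snd (fst (fst q), (snd (fst q))(n := snd q))))"
  proof (rule cconv_compose[OF Suc.prems])
    show "continuous_on ((P \<times> ?Y n) \<times> T) (\<lambda>q. (fst (fst q), (snd (fst q))(n := snd q)))"
      by (intro continuous_on_Pair continuous_on_fun_upd continuous_on_fst continuous_on_snd continuous_on_id)
    show "(\<lambda>q. (fst (fst q), (snd (fst q))(n := snd q))) ` ((P \<times> ?Y n) \<times> T) \<subseteq> P \<times> ?Y (Suc n)"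
    proof (rule image_subsetI)
      fix q assume "q \<in> (P \<times> ?Y n) \<times> T"
      then have "fst (fst q) \<in> P" "snd (fst q) \<in> ?Y n" "snd q \<in> T" by (simp_all add: mem_Times_iff)
      then show "(fst (fst q), (snd (fst q))(n := snd q)) \<in> P \<times> ?Y (Suc n)"
        using fun_upd_PiE_lessThan[of "snd (fst q)" n T "snd q"] by (simp add: mem_Times_iff)
    qed
  qed
  then have "cconv ((P \<times> ?Y n) \<times> T)
      (\<lambda>N q. (\<lambda>r w. G N (fst r) ((snd r)(n := w))) (fst q) (snd q))
      (\<lambda>q. (\<lambda>r w. G' (fst r) ((snd r)(n := w))) (fst q) (snd q))" by simp
  then have "cconv (P \<times> ?Y n)
      (\<lambda>N r. quad N (\<lambda>w. G N (fst r) ((snd r)(n := w))))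
      (\<lambda>r. \<integral>w. G' (fst r) ((snd r)(n := w)) \<partial>M)"
    by (rule cconv_quad[OF compact_Times[OF P compact_PiE_lessThan[OF compact_T]]])
  from Suc.IH[of "\<lambda>N p y. quad N (\<lambda>w. G N p (y(n := w)))" "\<lambda>p y. \<integral>w. G' p (y(n := w)) \<partial>M", OF this]
  show ?case by simp
qed

text \<open>Continuity of the limit is half of \<open>cconv\<close>, so a constant sequence of
  integrands in \<open>cconv_quad\<close> already gives the claim.\<close>

lemma continuous_on_integral_last:
  fixes G :: "(nat \<Rightarrow> complex) \<Rightarrow> complex"
  assumes "continuous_on ({..<Suc n} \<rightarrow>\<^sub>E T) G"
  shows "continuous_on ({..<n} \<rightarrow>\<^sub>E T) (\<lambda>y. \<integral>w. G (y(n := w)) \<partial>M)"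
proof -
  have "continuous_on (({..<n} \<rightarrow>\<^sub>E T) \<times> T) (\<lambda>q. G ((fst q)(n := snd q)))"
  proof (rule continuous_on_compose2[OF assms])
    show "continuous_on (({..<n} \<rightarrow>\<^sub>E T) \<times> T) (\<lambda>q. (fst q)(n := snd q))"
      by (intro continuous_on_fun_upd continuous_on_fst continuous_on_snd continuous_on_id)
    show "(\<lambda>q. (fst q)(n := snd q)) ` (({..<n} \<rightarrow>\<^sub>E T) \<times> T) \<subseteq> {..<Suc n} \<rightarrow>\<^sub>E T"
      by (rule image_subsetI) (rule fun_upd_PiE_lessThan; simp add: mem_Times_iff)
  qed
  then have "cconv (({..<n} \<rightarrow>\<^sub>E T) \<times> T) (\<lambda>N q. G ((fst q)(n := snd q))) (\<lambda>q. G ((fst q)(n := snd q)))"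
    by (rule cconv_const)
  from cconv_quad[OF compact_PiE_lessThan[OF compact_T], of n "\<lambda>N y w. G (y(n := w))" "\<lambda>y w. G (y(n := w))", OF this]
  show ?thesis by (simp add: cconv_def)
qed

text \<open>\<open>G\<close> is continuous only on a closed subset of the function space. Its
  extension by zero is Borel, and the inclusion of the finite product into the space of all
  functions is measurable because a countable product of Borel sigma-algebras is the Borel
  sigma-algebra of the product.\<close>

lemma continuous_measurable_PiM:
  fixes G :: "(nat \<Rightarrow> complex) \<Rightarrow> complex"
  assumes G: "continuous_on ({..<n} \<rightarrow>\<^sub>E T) G"
  shows "G \<in> borel_measurable (Pi\<^sub>M {..<n} (\<lambda>_. M))"
proof -
  let ?Y = "{..<n} \<rightarrow>\<^sub>E T"
  have space: "space (Pi\<^sub>M {..<n} (\<lambda>_. M)) \<subseteq> ?Y"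
    using space_M unfolding space_PiM by (intro PiE_mono) auto
  have id: "(\<lambda>w. w) \<in> measurable M borel"
    by (rule continuous_measurable) simp
  have "(\<lambda>y. y) \<in> measurable (Pi\<^sub>M {..<n} (\<lambda>_. M)) (Pi\<^sub>M UNIV (\<lambda>i::nat. borel :: complex measure))"
  proof (rule measurable_PiM_single')
    fix i :: nat
    show "(\<lambda>y. y i) \<in> borel_measurable (Pi\<^sub>M {..<n} (\<lambda>_. M))"
    proof (cases "i < n")
      case True
      then show ?thesis
        by (intro measurable_compose[OF measurable_component_singleton[of i "{..<n}" "\<lambda>_. M"] id]) simp
    next
      case False
      then show ?thesis
        by (subst measurable_cong[of _ _ "\<lambda>_. undefined"]) (auto simp: space_PiM PiE_def extensional_def)
    qed
  qed auto
  then have id': "(\<lambda>y. y) \<in> borel_measurable (Pi\<^sub>M {..<n} (\<lambda>_. M))"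
    by (simp add: measurable_def sets_PiM_equal_borel space_PiM)
  have "closed ?Y" using compact_PiE_lessThan[OF compact_T] by (rule compact_imp_closed)
  then have "(\<lambda>y. indicator ?Y y *\<^sub>R G y) \<in> borel_measurable borel"
    by (intro borel_measurable_continuous_on_indicator G) auto
  from measurable_compose[OF id' this] show ?thesis
    by (rule measurable_cong[THEN iffD1, rotated]) (use space in \<open>auto simp: indicator_def\<close>)
qed

lemma integrable_PiM_continuous:
  fixes G :: "(nat \<Rightarrow> complex) \<Rightarrow> complex"
  assumes G: "continuous_on ({..<n} \<rightarrow>\<^sub>E T) G"
  shows "integrable (Pi\<^sub>M {..<n} (\<lambda>_. M)) G"
proof -
  interpret M: finite_measure M by (rule finite_measure_M)
  interpret product_sigma_finite "\<lambda>_::nat. M" by standard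
  let ?Y = "{..<n} \<rightarrow>\<^sub>E T"
  have space: "space (Pi\<^sub>M {..<n} (\<lambda>_. M)) \<subseteq> ?Y"
    using space_M unfolding space_PiM by (intro PiE_mono) auto
  have "emeasure (Pi\<^sub>M {..<n} (\<lambda>_. M)) (space (Pi\<^sub>M {..<n} (\<lambda>_. M))) = (\<Prod>i<n. emeasure M (space M))"
    unfolding space_PiM by (subst emeasure_PiM) auto
  also have "\<dots> \<noteq> \<infinity>"
    by (simp add: M.emeasure_eq_measure ennreal_power)
  finally interpret PM: finite_measure "Pi\<^sub>M {..<n} (\<lambda>_. M)" by (intro finite_measureI)
  have "bounded (G ` ?Y)"
    by (intro compact_imp_bounded compact_continuous_image G compact_PiE_lessThan compact_T)
  then obtain B where B: "\<And>y. y \<in> ?Y \<Longrightarrow> norm (G y) \<le> B" by (auto simp: bounded_iff)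
  show ?thesis
    by (rule PM.integrable_const_bound[where B = B])
       (use B space in \<open>auto intro!: AE_I2 continuous_measurable_PiM G\<close>)
qed

text \<open>Fubini splits off the last coordinate, and the inner integral is again continuous in the
  others, which keeps the induction going. For \<open>n = 0\<close> the product measure is the point
  mass at the everywhere undefined function.\<close>

lemma iter_functional_integral:
  assumes "continuous_on ({..<n} \<rightarrow>\<^sub>E T) G"
  shows "iter_functional (integral\<^sup>L M) n G = (\<integral>y. G y \<partial>Pi\<^sub>M {..<n} (\<lambda>_. M))"
  using assms
proof (induction n arbitrary: G)
  case 0
  then show ?case by (simp add: PiM_empty lebesgue_integral_count_space_finite)
next
  case (Suc n)
  interpret M: finite_measure M by (rule finite_measure_M)
  interpret product_sigma_finite "\<lambda>_::nat. M" by standard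
  have "(\<integral>y. G y \<partial>Pi\<^sub>M {..<Suc n} (\<lambda>_. M)) = (\<integral>y. (\<integral>w. G (y(n := w)) \<partial>M) \<partial>Pi\<^sub>M {..<n} (\<lambda>_. M))"
    unfolding lessThan_Suc
    by (rule product_integral_insert)
       (use integrable_PiM_continuous[OF Suc.prems] in \<open>simp_all add: lessThan_Suc\<close>)
  then show ?case
    unfolding iter_functional.simps using Suc.IH[OF continuous_on_integral_last[OF Suc.prems]] by (simp only:)
qed

lemma iter_functional_quad:
  "iter_functional (quad N) n G
    = (\<Sum>\<sigma>\<in>{..<n} \<rightarrow>\<^sub>E {..<N}. (\<Prod>i<n. of_real (wt N (\<sigma> i))) * G (\<lambda>i\<in>{..<n}. u N (\<sigma> i)))"
proof (induction n arbitrary: G)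
  case 0
  then show ?case by (simp add: restrict_def)
next
  case (Suc n)
  let ?t = "\<lambda>n \<sigma>. (\<Prod>i<n. complex_of_real (wt N (\<sigma> i))) * G (\<lambda>i\<in>{..<n}. u N (\<sigma> i))"
  have "(\<Sum>\<sigma>\<in>{..<Suc n} \<rightarrow>\<^sub>E {..<N}. ?t (Suc n) \<sigma>)
      = (\<Sum>(j, \<sigma>)\<in>{..<N} \<times> ({..<n} \<rightarrow>\<^sub>E {..<N}). ?t (Suc n) (\<sigma>(n := j)))"
    unfolding lessThan_Suc[of n] PiE_insert_eq
    by (subst sum.reindex[OF inj_combinator]) (auto simp: lessThan_Suc case_prod_unfold)
  also have "\<dots> = (\<Sum>j<N. \<Sum>\<sigma>\<in>{..<n} \<rightarrow>\<^sub>E {..<N}. ?t (Suc n) (\<sigma>(n := j)))"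
    by (simp add: sum.cartesian_product)
  also have "\<dots> = (\<Sum>\<sigma>\<in>{..<n} \<rightarrow>\<^sub>E {..<N}. \<Sum>j<N. ?t (Suc n) (\<sigma>(n := j)))"
    by (rule sum.swap)
  also have "\<dots> = (\<Sum>\<sigma>\<in>{..<n} \<rightarrow>\<^sub>E {..<N}. (\<Prod>i<n. of_real (wt N (\<sigma> i))) *
      quad N (\<lambda>w. G ((\<lambda>i\<in>{..<n}. u N (\<sigma> i))(n := w))))"
  proof (rule sum.cong[OF refl])
    fix \<sigma>
    have prod: "(\<Prod>i<n. complex_of_real (wt N ((\<sigma>(n := j)) i))) = (\<Prod>i<n. of_real (wt N (\<sigma> i)))" for j
      by (rule prod.cong) auto
    have restr: "(\<lambda>i\<in>{..<Suc n}. u N ((\<sigma>(n := j)) i)) = (\<lambda>i\<in>{..<n}. u N (\<sigma> i))(n := u N j)" for j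
      by (auto simp: fun_eq_iff)
    show "(\<Sum>j<N. ?t (Suc n) (\<sigma>(n := j))) = (\<Prod>i<n. of_real (wt N (\<sigma> i))) *
      quad N (\<lambda>w. G ((\<lambda>i\<in>{..<n}. u N (\<sigma> i))(n := w)))"
      unfolding prod.lessThan_Suc restr prod quad_def sum_distrib_left by (simp add: mult.assoc)
  qed
  finally show ?case unfolding iter_functional.simps Suc.IH by (rule sym)
qed

lemma iter_functional_quad_norm_le:
  assumes C: "(\<Sum>j<N. wt N j) \<le> C" "C \<ge> 0"
    and G: "\<And>y. y \<in> {..<n} \<rightarrow>\<^sub>E T \<Longrightarrow> norm (G y) \<le> B" and "B \<ge> 0"
  shows "norm (iter_functional (quad N) n G) \<le> C ^ n * B"
  using G \<open>B \<ge> 0\<close>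
proof (induction n arbitrary: G B)
  case 0
  then show ?case by auto
next
  case (Suc n)
  have "norm (quad N (\<lambda>w. G (y(n := w)))) \<le> C * B" if "y \<in> {..<n} \<rightarrow>\<^sub>E T" for y
    by (rule quad_norm_le[OF C(1)]) (use fun_upd_PiE_lessThan[OF that] Suc.prems in \<open>blast+\<close>)
  then have "norm (iter_functional (quad N) n (\<lambda>y. quad N (\<lambda>w. G (y(n := w))))) \<le> C ^ n * (C * B)"
    by (rule Suc.IH) (use Suc.prems C in auto)
  then show ?case by (simp only: iter_functional.simps power_Suc mult_ac)
qed

end

section \<open>Fredholm determinants of discretized kernels\<close>

text \<open>The determinant is taken over \<open>M1\<close>, while \<open>M2\<close> is integrated
  out in the composition of an operator with its transpose. The factor \<open>a\<close> collects
  everything that depends on one outer variable and stands as a row factor; the rest of the composed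
  kernel is the integral of \<open>k\<close>. The nesting of pairs groups \<open>(p, w, w')\<close>
  as the parameter for a quadrature over \<open>T2\<close>.\<close>

locale discretization_pair =
  D1: discretization T1 M1 wt1 u + D2: discretization T2 M2 wt2 v
  for T1 M1 wt1 u T2 M2 wt2 v +
  fixes P :: "'p::metric_space set"
    and a :: "'p \<Rightarrow> complex \<Rightarrow> complex" and k :: "'p \<Rightarrow> complex \<Rightarrow> complex \<Rightarrow> complex \<Rightarrow> complex"
  assumes compact_P: "compact P"
    and cont_a: "continuous_on (P \<times> T1) (\<lambda>q. a (fst q) (snd q))"
    and cont_k: "continuous_on ((P \<times> T1 \<times> T1) \<times> T2)
      (\<lambda>q. k (fst (fst q)) (fst (snd (fst q))) (snd (snd (fst q))) (snd q))"
begin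

definition kerN :: "nat \<Rightarrow> 'p \<Rightarrow> complex \<Rightarrow> complex \<Rightarrow> complex" where
  "kerN N p w w' = D2.quad N (k p w w')"

definition ker :: "'p \<Rightarrow> complex \<Rightarrow> complex \<Rightarrow> complex" where
  "ker p w w' = (\<integral>l. k p w w' l \<partial>M2)"

definition integrandN :: "nat \<Rightarrow> nat \<Rightarrow> 'p \<Rightarrow> (nat \<Rightarrow> complex) \<Rightarrow> complex" where
  "integrandN n N p y =
    (\<Prod>i<n. a p (y i)) * Determinant.det (Matrix.mat n n (\<lambda>(i, j). kerN N p (y i) (y j)))"

definition integrand :: "nat \<Rightarrow> 'p \<Rightarrow> (nat \<Rightarrow> complex) \<Rightarrow> complex" where
  "integrand n p y =
    (\<Prod>i<n. a p (y i)) * Determinant.det (Matrix.mat n n (\<lambda>(i, j). ker p (y i) (y j)))"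

definition fredholm_series :: "'p \<Rightarrow> complex" where
  "fredholm_series p = (\<Sum>n. (\<integral>y. integrand n p y \<partial>Pi\<^sub>M {..<n} (\<lambda>_. M1)) / fact n)"

lemma cconv_ker:
  "cconv (P \<times> T1 \<times> T1) (\<lambda>N q. kerN N (fst q) (fst (snd q)) (snd (snd q)))
    (\<lambda>q. ker (fst q) (fst (snd q)) (snd (snd q)))"
  unfolding kerN_def ker_def
  by (rule D2.cconv_quad)
     (intro compact_Times compact_P D1.compact_T, intro cconv_const cont_k)

lemma cconv_integrand:
  "cconv (P \<times> ({..<n} \<rightarrow>\<^sub>E T1)) (\<lambda>N q. integrandN n N (fst q) (snd q)) (\<lambda>q. integrand n (fst q) (snd q))"
proof -
  let ?S = "P \<times> ({..<n} \<rightarrow>\<^sub>E T1)"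
  have S: "compact ?S" by (intro compact_Times compact_P compact_PiE_lessThan D1.compact_T)
  have coord: "continuous_on ?S (\<lambda>q. snd q i)" for i
    by (rule continuous_on_product_then_coordinatewise) (intro continuous_on_snd continuous_on_id)
  have mem: "fst q \<in> P" "snd q i \<in> T1" if "q \<in> ?S" "i < n" for q i
    using that PiE_mem[of "snd q" "{..<n}" "\<lambda>_. T1" i] by (simp_all add: mem_Times_iff)
  have "cconv ?S (\<lambda>N q. a (fst q) (snd q i)) (\<lambda>q. a (fst q) (snd q i))" if "i \<in> {..<n}" for i
  proof -
    have "continuous_on ?S (\<lambda>q. (fst q, snd q i))"
      by (rule continuous_on_Pair[OF continuous_on_fst[OF continuous_on_id] coord])
    moreover have "(\<lambda>q. (fst q, snd q i)) ` ?S \<subseteq> P \<times> T1"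
      using that mem by (intro image_subsetI) simp
    ultimately show ?thesis
      using cconv_compose[OF cconv_const[OF cont_a], of ?S "\<lambda>q. (fst q, snd q i)"] by simp
  qed
  then have 1: "cconv ?S (\<lambda>N q. \<Prod>i<n. a (fst q) (snd q i)) (\<lambda>q. \<Prod>i<n. a (fst q) (snd q i))"
    by (rule cconv_prod[OF S finite_lessThan])
  have "cconv ?S (\<lambda>N q. kerN N (fst q) (snd q i) (snd q j)) (\<lambda>q. ker (fst q) (snd q i) (snd q j))"
    if "i < n" "j < n" for i j
  proof -
    have cont: "continuous_on ?S (\<lambda>q. (fst q, snd q i, snd q j))"
      by (rule continuous_on_Pair[OF continuous_on_fst[OF continuous_on_id] continuous_on_Pair[OF coord coord]])
    have "(\<lambda>q. (fst q, snd q i, snd q j)) ` ?S \<subseteq> P \<times> T1 \<times> T1"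
      using that mem by (intro image_subsetI) simp
    from cconv_compose[OF cconv_ker cont this] show ?thesis by simp
  qed
  then have 2: "cconv ?S
      (\<lambda>N q. Determinant.det (Matrix.mat n n (\<lambda>(i, j). kerN N (fst q) (snd q i) (snd q j))))
      (\<lambda>q. Determinant.det (Matrix.mat n n (\<lambda>(i, j). ker (fst q) (snd q i) (snd q j))))"
    by (rule cconv_det[OF S])
  show ?thesis unfolding integrandN_def integrand_def by (rule cconv_mult[OF S 1 2])
qed

text \<open>An exact identity for each \<open>N\<close>: weights and outer factors leave the n-point
  determinants as row factors, and the weighted sum over all index maps is an iterated quadrature.
  Approximation enters only as \<open>N\<close> grows.\<close>

lemma det_sums:
  "(\<lambda>n. iter_functional (D1.quad N) n (integrandN n N p) / fact n) sums
    Determinant.det (1\<^sub>m N + Matrix.mat N N (\<lambda>(i, j).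
      of_real (wt1 N i) * a p (u N i) * kerN N p (u N i) (u N j)))"
proof -
  let ?X = "Matrix.mat N N (\<lambda>(i, j). of_real (wt1 N i) * a p (u N i) * kerN N p (u N i) (u N j))"
  have "iter_functional (D1.quad N) n (integrandN n N p)
      = (\<Sum>\<sigma>\<in>{..<n} \<rightarrow>\<^sub>E {..<N}. Determinant.det (Matrix.mat n n (\<lambda>(i, j). ?X $$ (\<sigma> i, \<sigma> j))))" for n
    unfolding D1.iter_functional_quad
  proof (rule sum.cong[OF refl])
    fix \<sigma> assume \<sigma>: "\<sigma> \<in> {..<n} \<rightarrow>\<^sub>E {..<N}"
    let ?y = "\<lambda>i\<in>{..<n}. u N (\<sigma> i)"
    have "Determinant.det (Matrix.mat n n (\<lambda>(i, j). ?X $$ (\<sigma> i, \<sigma> j)))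
      = Determinant.det (Matrix.mat n n (\<lambda>(i, j).
          (of_real (wt1 N (\<sigma> i)) * a p (?y i)) * kerN N p (?y i) (?y j) * 1))"
      by (rule arg_cong[where f = Determinant.det], rule cong_mat) (use \<sigma> in \<open>auto simp: PiE_def Pi_def\<close>)
    also have "\<dots> = (\<Prod>i<n. of_real (wt1 N (\<sigma> i)) * a p (?y i))
        * Determinant.det (Matrix.mat n n (\<lambda>(i, j). kerN N p (?y i) (?y j)))"
      by (subst det_scale_rows_cols) simp
    also have "\<dots> = (\<Prod>i<n. of_real (wt1 N (\<sigma> i))) * integrandN n N p ?y"
      unfolding integrandN_def prod.distrib by (simp only: mult.assoc)
    finally show "(\<Prod>i<n. of_real (wt1 N (\<sigma> i))) * integrandN n N p ?y
      = Determinant.det (Matrix.mat n n (\<lambda>(i, j). ?X $$ (\<sigma> i, \<sigma> j)))" ..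
  qed
  then show ?thesis using det_one_plus_sums[of ?X N] by simp
qed

text \<open>The term of index \<open>n\<close> is an iterated quadrature of a uniformly convergent
  integrand, so it converges; Hadamard's bound supplies a majorant free of \<open>N\<close> and
  \<open>p\<close>.\<close>

theorem cconv_det_fredholm_series:
  "cconv P (\<lambda>N p. Determinant.det (1\<^sub>m N + Matrix.mat N N (\<lambda>(i, j).
      of_real (wt1 N i) * a p (u N i) * kerN N p (u N i) (u N j)))) fredholm_series"
proof -
  obtain A where A: "\<And>q. q \<in> P \<times> T1 \<Longrightarrow> norm (a (fst q) (snd q)) \<le> A" "A > 0"
  proof -
    have "bounded ((\<lambda>q. a (fst q) (snd q)) ` (P \<times> T1))"
      by (intro compact_imp_bounded compact_continuous_image cont_a compact_Times compact_P D1.compact_T)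
    then show ?thesis using that unfolding bounded_pos by blast
  qed
  obtain B where B: "\<And>q. q \<in> (P \<times> T1 \<times> T1) \<times> T2 \<Longrightarrow>
      norm (k (fst (fst q)) (fst (snd (fst q))) (snd (snd (fst q))) (snd q)) \<le> B" "B > 0"
  proof -
    have "bounded ((\<lambda>q. k (fst (fst q)) (fst (snd (fst q))) (snd (snd (fst q))) (snd q)) ` ((P \<times> T1 \<times> T1) \<times> T2))"
      by (intro compact_imp_bounded compact_continuous_image cont_k compact_Times compact_P D1.compact_T D2.compact_T)
    then show ?thesis using that unfolding bounded_pos by blast
  qed
  obtain C1 where C1: "C1 > 0" "\<And>N. (\<Sum>j<N. wt1 N j) \<le> C1" using D1.weights_bounded by blast
  obtain C2 where C2: "C2 > 0" "\<And>N. (\<Sum>j<N. wt2 N j) \<le> C2" using D2.weights_bounded by blast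
  \<comment> \<open>\<open>C1\<close> and \<open>C2\<close> bound the total weights,
    \<open>A\<close> the outer factor and \<open>B\<close> the inner integrand. Every one of the n
    variables contributes one copy of each.\<close>
  define c where "c = C1 * A * (C2 * B)"
  have kerN: "norm (kerN N p w w') \<le> C2 * B" if "p \<in> P" "w \<in> T1" "w' \<in> T1" for N p w w'
    unfolding kerN_def
  proof (rule D2.quad_norm_le[OF C2(2)])
    fix l assume "l \<in> T2"
    then show "norm (k p w w' l) \<le> B" using B(1)[of "((p, w, w'), l)"] that by simp
  qed (use B in simp)
  have bound: "norm (iter_functional (D1.quad N) n (integrandN n N p) / fact n)
      \<le> (c * sqrt (real n)) ^ n / fact n" if p: "p \<in> P" for n N p
  proof -
    have "norm (iter_functional (D1.quad N) n (integrandN n N p))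
        \<le> C1 ^ n * (A ^ n * (sqrt (real n) * (C2 * B)) ^ n)"
    proof (rule D1.iter_functional_quad_norm_le[OF C1(2)])
      fix y assume y: "y \<in> {..<n} \<rightarrow>\<^sub>E T1"
      have "norm (a p (y i)) \<le> A" if "i < n" for i
        using A(1)[of "(p, y i)"] p y that by auto
      then have "norm (\<Prod>i<n. a p (y i)) \<le> A ^ n"
        unfolding prod_norm[symmetric] using prod_mono[of "{..<n}" "\<lambda>i. norm (a p (y i))" "\<lambda>_. A"] by simp
      moreover have "norm (Determinant.det (Matrix.mat n n (\<lambda>(i, j). kerN N p (y i) (y j))))
          \<le> (sqrt (real n) * (C2 * B)) ^ n"
        by (rule hadamard_bound) (use kerN[OF p] y C2(1) B(2) in auto)
      ultimately show "norm (integrandN n N p y) \<le> A ^ n * (sqrt (real n) * (C2 * B)) ^ n"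
        unfolding integrandN_def norm_mult by (intro mult_mono) (use A(2) in auto)
    qed (use A C1 C2 B in auto)
    also have "\<dots> = (c * sqrt (real n)) ^ n"
      by (simp add: c_def power_mult_distrib mult_ac)
    finally show ?thesis by (simp add: norm_divide divide_right_mono)
  qed
  have c: "c \<ge> 0" using A B C1 C2 by (simp add: c_def)
  have lim: "cconv P (\<lambda>N p. iter_functional (D1.quad N) n (integrandN n N p) / fact n)
      (\<lambda>p. (\<integral>y. integrand n p y \<partial>Pi\<^sub>M {..<n} (\<lambda>_. M1)) / fact n)" for n
  proof -
    have "continuous_on ({..<n} \<rightarrow>\<^sub>E T1) (integrand n p)" if "p \<in> P" for p
    proof -
      have "continuous_on ({..<n} \<rightarrow>\<^sub>E T1) (\<lambda>y. integrand n (fst (p, y)) (snd (p, y)))"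
        by (rule continuous_on_compose2[OF cconv_integrand[of n, unfolded cconv_def, THEN conjunct2]])
           (use that in \<open>auto intro!: continuous_on_Pair continuous_on_const continuous_on_id\<close>)
      then show ?thesis by simp
    qed
    then have eq: "iter_functional (integral\<^sup>L M1) n (integrand n p)
        = (\<integral>y. integrand n p y \<partial>Pi\<^sub>M {..<n} (\<lambda>_. M1))" if "p \<in> P" for p
      using D1.iter_functional_integral that by blast
    have "cconv P (\<lambda>N p. iter_functional (D1.quad N) n (integrandN n N p) * (1 / fact n))
      (\<lambda>p. iter_functional (integral\<^sup>L M1) n (integrand n p) * (1 / fact n))"
      by (intro cconv_mult[OF compact_P] cconv_const continuous_on_const D1.cconv_iter[OF compact_P] cconv_integrand)
    then show ?thesis
      unfolding cconv_def using eq
      by (auto cong: uniform_limit_cong' continuous_on_cong)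
  qed
  have "cconv P (\<lambda>N p. \<Sum>n. iter_functional (D1.quad N) n (integrandN n N p) / fact n) fredholm_series"
    unfolding fredholm_series_def
    by (rule cconv_suminf[OF lim bound summable_hadamard_series[OF c]])
  then show ?thesis using sums_unique[OF det_sums] by simp
qed

text \<open>The factor \<open>b\<close> stands on both sides of the kernel, so only its square
  leaves the determinant. The integrands agree pointwise, whichever square root \<open>b\<close> of
  \<open>a\<close> is chosen.\<close>

lemma fredholm_det_eq_series:
  assumes K: "\<And>w w'. w \<in> space M1 \<Longrightarrow> w' \<in> space M1 \<Longrightarrow> K w w' = b w * ker p w w' * b w'"
    and b: "\<And>w. w \<in> space M1 \<Longrightarrow> (b w)\<^sup>2 = a p w"
  shows "fredholm_det M1 K = fredholm_series p"
proof -
  have "(\<integral>y. Determinant.det (Matrix.mat n n (\<lambda>(i, j). K (y i) (y j))) \<partial>Pi\<^sub>M {..<n} (\<lambda>_. M1))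
      = (\<integral>y. integrand n p y \<partial>Pi\<^sub>M {..<n} (\<lambda>_. M1))" for n
  proof (rule Bochner_Integration.integral_cong[OF refl])
    fix y assume "y \<in> space (Pi\<^sub>M {..<n} (\<lambda>_. M1))"
    then have y: "y i \<in> space M1" if "i < n" for i using that by (auto simp: space_PiM)
    have "Determinant.det (Matrix.mat n n (\<lambda>(i, j). K (y i) (y j)))
      = Determinant.det (Matrix.mat n n (\<lambda>(i, j). b (y i) * ker p (y i) (y j) * b (y j)))"
      by (rule arg_cong[where f = Determinant.det], rule cong_mat) (use y K in auto)
    also have "\<dots> = (\<Prod>i<n. (b (y i))\<^sup>2) * Determinant.det (Matrix.mat n n (\<lambda>(i, j). ker p (y i) (y j)))"
      by (subst det_scale_rows_cols) (simp add: power2_eq_square prod.distrib)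
    also have "(\<Prod>i<n. (b (y i))\<^sup>2) = (\<Prod>i<n. a p (y i))"
      by (rule prod.cong) (use y b in auto)
    finally show "Determinant.det (Matrix.mat n n (\<lambda>(i, j). K (y i) (y j))) = integrand n p y"
      by (simp add: integrand_def)
  qed
  then show ?thesis by (simp add: fredholm_det_def fredholm_series_def)
qed

end

section \<open>The squaring map and planar Lebesgue measure\<close>

text \<open>Change of variables with a Jacobian determinant takes place on \<open>real ^ 2\<close>.
  This coordinate map and its inverse carry integrals over the complex plane there and back.\<close>

definition plane_to_complex :: "real ^ 2 \<Rightarrow> complex" where
  "plane_to_complex v = Complex (vec_nth v 1) (vec_nth v 2)"

definition complex_to_plane :: "complex \<Rightarrow> real ^ 2" where
  "complex_to_plane w = (\<chi> i. if i = 1 then Re w else Im w)"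

lemma plane_complex_inverse [simp]:
  "plane_to_complex (complex_to_plane w) = w" "complex_to_plane (plane_to_complex v) = v"
  by (simp_all add: plane_to_complex_def complex_to_plane_def Finite_Cartesian_Product.vec_eq_iff forall_2)

lemma bounded_linear_plane_to_complex: "bounded_linear plane_to_complex"
  by (intro linear_conv_bounded_linear[THEN iffD1] linearI)
     (auto simp: plane_to_complex_def complex_eq_iff)

lemma bounded_linear_complex_to_plane: "bounded_linear complex_to_plane"
  by (intro linear_conv_bounded_linear[THEN iffD1] linearI)
     (auto simp: complex_to_plane_def Finite_Cartesian_Product.vec_eq_iff)

lemma complex_to_plane_image: "complex_to_plane ` U = plane_to_complex -` U"
  by (auto simp: image_iff) (metis plane_complex_inverse(2))

lemma plane_to_complex_measurable [measurable]: "plane_to_complex \<in> borel_measurable borel"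
  by (intro borel_measurable_continuous_onI linear_continuous_on bounded_linear_plane_to_complex)

text \<open>Lebesgue measure is determined by its values on boxes, and the coordinate map takes
  boxes to boxes with the same side lengths.\<close>

lemma distr_plane_to_complex: "distr lborel borel plane_to_complex = lborel"
proof (rule lborel_eqI[symmetric])
  fix l u :: complex assume lu: "\<And>b. b \<in> Basis \<Longrightarrow> l \<bullet> b \<le> u \<bullet> b"
  have lu': "Re l \<le> Re u" "Im l \<le> Im u"
    using lu[of 1] lu[of \<i>] by (simp_all add: Basis_complex_def)
  have Basis2: "Basis = {axis 1 1, axis 2 1 :: real ^ 2}"
    by (auto simp: Basis_vec_def UNIV_2)
  have ax: "axis 1 1 \<noteq> (axis 2 1 :: real ^ 2)" by (simp add: axis_eq_axis)
  have "plane_to_complex -` box l u = box (complex_to_plane l) (complex_to_plane u)"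
    by (auto simp: box_def Basis2 Basis_complex_def plane_to_complex_def complex_to_plane_def inner_axis)
  then have "emeasure (distr lborel borel plane_to_complex) (box l u)
      = emeasure lborel (box (complex_to_plane l) (complex_to_plane u))"
    by (simp add: emeasure_distr)
  also have "\<dots> = ennreal (\<Prod>b\<in>Basis. (complex_to_plane u - complex_to_plane l) \<bullet> b)"
    by (rule emeasure_lborel_box)
       (use lu' in \<open>auto simp: Basis2 Basis_complex_def complex_to_plane_def inner_axis\<close>)
  also have "\<dots> = ennreal (\<Prod>b\<in>Basis. (u - l) \<bullet> b)"
    using ax by (simp add: Basis2 Basis_complex_def complex_to_plane_def inner_axis)
  finally show "emeasure (distr lborel borel plane_to_complex) (box l u) = (\<Prod>b\<in>Basis. (u - l) \<bullet> b)" .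
qed simp

text \<open>Boundedness of \<open>H\<close> and \<open>U\<close> gives integrability. Three
  descriptions of one integral are thereby identified: over restricted Lebesgue measure, over
  \<open>lborel\<close> with an indicator, and as a gauge integral on the real plane.\<close>

lemma integral_lebesgue_on_eq_plane:
  fixes H :: "complex \<Rightarrow> complex"
  assumes U: "open U" "bounded U" and H: "continuous_on U H" "\<And>w. w \<in> U \<Longrightarrow> norm (H w) \<le> B"
  shows "(\<lambda>v. H (plane_to_complex v)) absolutely_integrable_on complex_to_plane ` U"
    and "integral (complex_to_plane ` U) (\<lambda>v. H (plane_to_complex v)) = (\<integral>w. H w \<partial>lebesgue_on U)"
    and "(\<integral>w. H w \<partial>lebesgue_on U) = (\<integral>w. indicator U w *\<^sub>R H w \<partial>lborel)"
proof -
  have Ub: "U \<in> sets borel" using U by simp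
  let ?I = "\<lambda>w. indicator U w *\<^sub>R H w"
  have meas [measurable]: "?I \<in> borel_measurable borel"
    by (rule borel_measurable_continuous_on_indicator[OF Ub H(1)])
  have "AE w in lborel. w \<in> U \<longrightarrow> norm (?I w) \<le> B"
    using H(2) by (auto simp: indicator_def)
  then have "integrable lborel (\<lambda>w. indicator U w *\<^sub>R ?I w)"
    using Ub meas emeasure_bounded_finite[OF U(2)]
    by (intro integrableI_bounded_set_indicator[where B = B]) simp_all
  then have int: "integrable lborel ?I"
    by (rule Bochner_Integration.integrable_cong[THEN iffD1, rotated -1]) (auto simp: indicator_def)
  have int2: "integrable lborel (\<lambda>v. ?I (plane_to_complex v))"
    by (rule integrable_distr_eq[THEN iffD1, of _ _ borel])
       (use int in \<open>auto simp: distr_plane_to_complex\<close>)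
  have ind: "indicator (complex_to_plane ` U) v *\<^sub>R H (plane_to_complex v) = ?I (plane_to_complex v)" for v
    by (auto simp: complex_to_plane_image indicator_def)
  have "integrable lebesgue (\<lambda>v. ?I (plane_to_complex v))"
    using int2 by (simp add: integrable_completion)
  then have si: "set_integrable lebesgue (complex_to_plane ` U) (\<lambda>v. H (plane_to_complex v))"
    unfolding set_integrable_def ind .
  then show "(\<lambda>v. H (plane_to_complex v)) absolutely_integrable_on complex_to_plane ` U" .
  show eq: "(\<integral>w. H w \<partial>lebesgue_on U) = (\<integral>w. ?I w \<partial>lborel)"
    using Ub by (subst integral_restrict_space) (auto simp: integral_completion)
  have "integral (complex_to_plane ` U) (\<lambda>v. H (plane_to_complex v))
      = (LINT v:complex_to_plane ` U|lebesgue. H (plane_to_complex v))"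
    by (rule set_lebesgue_integral_eq_integral(2)[OF si, symmetric])
  also have "\<dots> = (\<integral>v. ?I (plane_to_complex v) \<partial>lborel)"
    unfolding set_lebesgue_integral_def ind by (rule integral_completion) simp
  also have "\<dots> = (\<integral>w. ?I w \<partial>lborel)"
    by (subst distr_plane_to_complex[symmetric], subst integral_distr) auto
  finally show "integral (complex_to_plane ` U) (\<lambda>v. H (plane_to_complex v)) = (\<integral>w. H w \<partial>lebesgue_on U)"
    using eq by simp
qed

text \<open>The derivative may be complex linear (\<open>\<kappa> = id\<close>) or antilinear (\<open>\<kappa> = cnj\<close>); the
  Jacobian is \<open>\<bar>c\<bar>\<^sup>2\<close> in both cases.\<close>

lemma complex_change_of_variables:
  fixes F g c \<kappa> :: "complex \<Rightarrow> complex"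
  assumes \<kappa>: "\<kappa> = (\<lambda>w. w) \<or> \<kappa> = cnj"
    and S: "open S" "bounded S" "open (g ` S)" "bounded (g ` S)" and inj: "inj_on g S"
    and g: "\<And>z. z \<in> S \<Longrightarrow> (g has_derivative (\<lambda>h. \<kappa> (c z * h))) (at z)"
    and c: "continuous_on S c" "\<And>z. z \<in> S \<Longrightarrow> norm (c z) \<le> C"
    and F: "continuous_on (g ` S) F" "\<And>w. w \<in> g ` S \<Longrightarrow> norm (F w) \<le> B"
  shows "(\<integral>w. F w \<partial>lebesgue_on (g ` S)) = (\<integral>z. of_real ((norm (c z))\<^sup>2) * F (g z) \<partial>lebesgue_on S)"
proof -
  let ?S = "complex_to_plane ` S" and ?G = "\<lambda>v. complex_to_plane (g (plane_to_complex v))"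
  let ?G' = "\<lambda>v h. complex_to_plane (\<kappa> (c (plane_to_complex v) * plane_to_complex h))"
  let ?H = "\<lambda>z. of_real ((norm (c z))\<^sup>2) * F (g z)"
  have img: "complex_to_plane ` g ` S = ?G ` ?S" by (simp add: image_image)
  have contg: "continuous_on S g"
    by (intro continuous_at_imp_continuous_on ballI) (rule has_derivative_continuous[OF g])
  have H: "continuous_on S ?H"
    by (intro continuous_intros c(1) continuous_on_compose2[OF F(1) contg]) auto
  have HB: "norm (?H z) \<le> C\<^sup>2 * B" if "z \<in> S" for z
    unfolding norm_mult norm_of_real
    using c(2)[OF that] F(2)[of "g z"] that by (intro mult_mono) (auto intro: power_mono)
  have S': "?S \<in> sets lebesgue"
  proof -
    have "?S \<in> sets borel"
      unfolding complex_to_plane_image using plane_to_complex_measurable S(1)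
      by (metis borel_open measurable_sets_borel)
    then show ?thesis by simp
  qed
  have der: "(?G has_derivative ?G' v) (at v within ?S)" if "v \<in> ?S" for v
  proof -
    from that have z: "plane_to_complex v \<in> S" by auto
    have "(plane_to_complex has_derivative plane_to_complex) (at v within ?S)"
      by (rule bounded_linear_imp_has_derivative[OF bounded_linear_plane_to_complex])
    from has_derivative_compose[OF this g[OF z]]
    have "((\<lambda>v. g (plane_to_complex v)) has_derivative
        (\<lambda>h. \<kappa> (c (plane_to_complex v) * plane_to_complex h))) (at v within ?S)" .
    from bounded_linear.has_derivative[OF bounded_linear_complex_to_plane this]
    show ?thesis .
  qed
  have det: "\<bar>Determinants.det (matrix (?G' v))\<bar> = (norm (c (plane_to_complex v)))\<^sup>2" for v
  proof -
    define w where "w = c (plane_to_complex v)"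
    have axis: "plane_to_complex (axis 1 1) = 1" "plane_to_complex (axis 2 1) = \<i>"
      by (simp_all add: plane_to_complex_def axis_def complex_eq_iff)
    have entries: "vec_nth (vec_nth (matrix (?G' v)) i) j
        = vec_nth (complex_to_plane (\<kappa> (w * plane_to_complex (axis j 1)))) i" for i j
      by (simp add: matrix_def w_def)
    have "Determinants.det (matrix (?G' v)) = Re (\<kappa> w) * Im (\<kappa> (w * \<i>)) - Re (\<kappa> (w * \<i>)) * Im (\<kappa> w)"
      unfolding det_2 entries axis by (simp add: complex_to_plane_def)
    \<comment> \<open>The determinant is positive in the linear case and negative in the antilinear
      one, which reverses orientation.\<close>
    also have "\<bar>\<dots>\<bar> = (Re w)\<^sup>2 + (Im w)\<^sup>2"
    proof -
      have "\<bar>- (Re w)\<^sup>2 - (Im w)\<^sup>2\<bar> = (Re w)\<^sup>2 + (Im w)\<^sup>2"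
        by (metis abs_minus_cancel abs_of_nonneg minus_add_distrib diff_conv_add_uminus sum_power2_ge_zero)
      then show ?thesis using \<kappa> by (auto simp: power2_eq_square)
    qed
    finally show ?thesis by (simp add: cmod_power2 w_def)
  qed
  have inj': "inj_on ?G ?S"
    using inj by (auto simp: inj_on_def dest!: arg_cong[where f = plane_to_complex])
  note FG = integral_lebesgue_on_eq_plane[OF S(3,4) F]
  \<comment> \<open>The values are moved to the real plane as well. As
    \<open>complex_to_plane\<close> is linear it commutes with the integrals, and it is undone at
    the very end.\<close>
  let ?f = "\<lambda>v. complex_to_plane (F (plane_to_complex v))"
  have scale: "complex_to_plane (of_real t * w) = t *\<^sub>R complex_to_plane w" for t w
    by (simp add: complex_to_plane_def Finite_Cartesian_Product.vec_eq_iff)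
  have "?f absolutely_integrable_on (?G ` ?S)"
    using absolutely_integrable_linear[OF FG(1) bounded_linear_complex_to_plane]
    by (simp add: img o_def)
  from integral_change_of_variables[OF S' der inj' disjI1[OF this]]
  have "integral (?G ` ?S) ?f = integral ?S (\<lambda>v. (norm (c (plane_to_complex v)))\<^sup>2 *\<^sub>R ?f (?G v))"
    unfolding det .
  also have "\<dots> = integral ?S (complex_to_plane \<circ> (\<lambda>v. ?H (plane_to_complex v)))"
    by (simp only: o_def scale plane_complex_inverse)
  also have "\<dots> = complex_to_plane (integral ?S (\<lambda>v. ?H (plane_to_complex v)))"
    by (intro integral_linear bounded_linear_complex_to_plane set_lebesgue_integral_eq_integral(1)
        integral_lebesgue_on_eq_plane(1)[OF S(1,2) H HB])
  also have "integral ?S (\<lambda>v. ?H (plane_to_complex v)) = (\<integral>z. ?H z \<partial>lebesgue_on S)"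
    by (rule integral_lebesgue_on_eq_plane(2)[OF S(1,2) H HB])
  also have "integral (?G ` ?S) ?f = integral (complex_to_plane ` g ` S) (complex_to_plane \<circ> (\<lambda>v. F (plane_to_complex v)))"
    by (simp add: img o_def)
  also have "\<dots> = complex_to_plane (integral (complex_to_plane ` g ` S) (\<lambda>v. F (plane_to_complex v)))"
    by (intro integral_linear bounded_linear_complex_to_plane set_lebesgue_integral_eq_integral(1) FG(1))
  also have "integral (complex_to_plane ` g ` S) (\<lambda>v. F (plane_to_complex v)) = (\<integral>w. F w \<partial>lebesgue_on (g ` S))"
    by (rule FG(2))
  finally show ?thesis by (metis plane_complex_inverse(1))
qed

lemma inj_on_square_quadrant:
  fixes S :: "complex set"
  assumes "S \<subseteq> {u. 0 < Re u \<and> 0 < Im u}"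
  shows "inj_on (\<lambda>z. z\<^sup>2) S"
proof (rule inj_onI)
  fix z w assume zw: "z \<in> S" "w \<in> S" "z\<^sup>2 = w\<^sup>2"
  then have "z = w \<or> z = - w" by (simp add: power2_eq_iff)
  moreover have "0 < Re z" "0 < Re w" using zw assms by auto
  ultimately show "z = w" by auto
qed

text \<open>Weak convergence tests real bounded functions on the whole plane, whereas
  \<open>H\<close> is complex and given on the closure only. A Tietze extension with the same bound
  and a splitting into real and imaginary parts close the gap. The area in the weights cancels the
  normalisation of the uniform measure and leaves \<open>1 / pi\<close>.\<close>

lemma weak_convergence_complex:
  fixes H :: "complex \<Rightarrow> complex"
  assumes w: "weakly_converges_to (\<lambda>N. empirical_measure N (z N)) (uniform_measure lborel Dp)"
    and Dp: "open Dp" "Dp \<noteq> {}" "bounded Dp" and z: "\<And>N j. j < N \<Longrightarrow> z N j \<in> Dp"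
    and H: "continuous_on (closure Dp) H"
  shows "(\<lambda>N. (\<Sum>j<N. of_real (measure lebesgue Dp / (pi * real N)) * H (z N j)))
    \<longlonglongrightarrow> of_real (1 / pi) * (\<integral>u. H u \<partial>lebesgue_on Dp)"
proof -
  have comp: "compact (closure Dp)" using Dp by (simp add: compact_closure)
  then have "bounded (H ` closure Dp)"
    by (intro compact_imp_bounded compact_continuous_image H)
  then obtain B where B: "\<And>u. u \<in> closure Dp \<Longrightarrow> norm (H u) \<le> B" "B > 0"
    unfolding bounded_pos by blast
  obtain G where G: "continuous_on UNIV G" "\<And>u. u \<in> closure Dp \<Longrightarrow> G u = H u" "\<And>u. norm (G u) \<le> B"
    using Tietze[of "closure Dp" H UNIV B] H B by auto
  have [measurable]: "G \<in> borel_measurable borel" by (rule borel_measurable_continuous_onI[OF G(1)])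
  define a where "a = measure lborel Dp"
  have fin: "emeasure lborel Dp < \<infinity>" by (rule emeasure_bounded_finite[OF Dp(3)])
  have a_eq: "emeasure lborel Dp = ennreal a"
    unfolding a_def by (rule emeasure_eq_ennreal_measure) (use fin in auto)
  \<comment> \<open>A nonempty open set has positive area, so the division by \<open>a\<close> is
    legitimate.\<close>
  have "emeasure lborel Dp \<noteq> 0"
    using open_not_negligible[OF Dp(1,2)] Dp(1) by (simp add: negligible_iff_emeasure0)
  then have a: "a > 0" using a_eq by (metis a_def ennreal_0 measure_nonneg less_eq_real_def)
  have a': "measure lebesgue Dp = a" using Dp(1) by (simp add: a_def)
  have lim: "(\<integral>u. g u \<partial>uniform_measure lborel Dp) = (\<integral>u. indicator Dp u *\<^sub>R g u \<partial>lborel) / a"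
    if [measurable]: "g \<in> borel_measurable borel" for g :: "complex \<Rightarrow> real"
  proof -
    have "uniform_measure lborel Dp = density lborel (\<lambda>u. ennreal (indicator Dp u / a))"
      unfolding uniform_measure_def a_eq using a
      by (intro arg_cong[where f = "density lborel"] ext) (auto simp: indicator_def divide_ennreal[symmetric] simp flip: ennreal_1)
    then have "(\<integral>u. g u \<partial>uniform_measure lborel Dp) = (\<integral>u. (indicator Dp u / a) *\<^sub>R g u \<partial>lborel)"
      using a Dp(1) by (simp only:) (rule integral_density, auto)
    also have "\<dots> = (\<integral>u. (indicator Dp u *\<^sub>R g u) / a \<partial>lborel)" by simp
    finally show ?thesis by simp
  qed
  have fin_avg: "(\<integral>u. g u \<partial>empirical_measure N (z N)) = (\<Sum>j<N. g (z N j)) / real N"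
    if [measurable]: "g \<in> borel_measurable borel" for g :: "complex \<Rightarrow> real" and N
  proof -
    have "z N \<in> measurable (uniform_count_measure {..<N}) borel"
      by (auto simp: measurable_def sets_uniform_count_measure space_uniform_count_measure)
    then show ?thesis
      unfolding empirical_measure_def by (simp add: integral_distr integral_uniform_count_measure)
  qed
  have main: "(\<lambda>N. (\<Sum>j<N. g (z N j)) / real N) \<longlonglongrightarrow> (\<integral>u. indicator Dp u *\<^sub>R g u \<partial>lborel) / a"
    if g: "continuous_on UNIV g" "bounded (range g)" for g :: "complex \<Rightarrow> real"
  proof -
    have m: "g \<in> borel_measurable borel" by (rule borel_measurable_continuous_onI[OF g(1)])
    have "(\<lambda>N. \<integral>u. g u \<partial>empirical_measure N (z N)) \<longlonglongrightarrow> (\<integral>u. g u \<partial>uniform_measure lborel Dp)"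
      using w g unfolding weakly_converges_to_def by blast
    then show ?thesis by (simp only: lim[OF m] fin_avg[OF m])
  qed
  have bd: "bounded (range (\<lambda>u. Re (G u)))" "bounded (range (\<lambda>u. Im (G u)))"
    using order_trans[OF abs_Re_le_cmod G(3)] order_trans[OF abs_Im_le_cmod G(3)]
    by (auto intro!: boundedI[where B = B])
  have int: "integrable lborel (\<lambda>u. indicator Dp u *\<^sub>R G u)"
    by (rule integrableI_bounded_set_indicator[where B = B]) (use Dp(1) fin G(3) in auto)
  have "(\<lambda>N. (\<Sum>j<N. G (z N j)) / of_nat N) \<longlonglongrightarrow> (\<integral>u. indicator Dp u *\<^sub>R G u \<partial>lborel) / of_real a"
  proof (subst tendsto_complex_iff, intro conjI)
    have "Re (\<integral>u. indicator Dp u *\<^sub>R G u \<partial>lborel) = (\<integral>u. indicator Dp u *\<^sub>R Re (G u) \<partial>lborel)"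
      using integral_Re[OF int] by simp
    then show "(\<lambda>N. Re ((\<Sum>j<N. G (z N j)) / of_nat N)) \<longlonglongrightarrow> Re ((\<integral>u. indicator Dp u *\<^sub>R G u \<partial>lborel) / of_real a)"
      using main[OF _ bd(1)] G(1) by (simp add: Re_divide_of_nat continuous_intros)
    have "Im (\<integral>u. indicator Dp u *\<^sub>R G u \<partial>lborel) = (\<integral>u. indicator Dp u *\<^sub>R Im (G u) \<partial>lborel)"
      using integral_Im[OF int] by simp
    then show "(\<lambda>N. Im ((\<Sum>j<N. G (z N j)) / of_nat N)) \<longlonglongrightarrow> Im ((\<integral>u. indicator Dp u *\<^sub>R G u \<partial>lborel) / of_real a)"
      using main[OF _ bd(2)] G(1) by (simp add: Im_divide_of_nat continuous_intros)
  qed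
  then have "(\<lambda>N. of_real (a / pi) * ((\<Sum>j<N. G (z N j)) / of_nat N))
      \<longlonglongrightarrow> of_real (a / pi) * ((\<integral>u. indicator Dp u *\<^sub>R G u \<partial>lborel) / of_real a)"
    by (rule tendsto_mult_left)
  moreover have "of_real (a / pi) * ((\<integral>u. indicator Dp u *\<^sub>R G u \<partial>lborel) / of_real a)
      = of_real (1 / pi) * (\<integral>u. H u \<partial>lebesgue_on Dp)"
  proof -
    have HG: "H u = G u" if "u \<in> Dp" for u
      using G(2)[of u] that closure_subset[of Dp] by auto
    have HD: "continuous_on Dp H" using H closure_subset continuous_on_subset by blast
    have "(\<integral>u. H u \<partial>lebesgue_on Dp) = (\<integral>u. indicator Dp u *\<^sub>R H u \<partial>lborel)"
      by (rule integral_lebesgue_on_eq_plane(3)[OF Dp(1,3) HD]) (use B closure_subset in blast)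
    also have "\<dots> = (\<integral>u. indicator Dp u *\<^sub>R G u \<partial>lborel)"
      by (rule Bochner_Integration.integral_cong) (auto simp: indicator_def HG)
    finally show ?thesis using a by simp
  qed
  moreover have "of_real (a / pi) * ((\<Sum>j<N. G (z N j)) / of_nat N)
      = (\<Sum>j<N. of_real (measure lebesgue Dp / (pi * real N)) * H (z N j))" for N
  proof -
    have "(\<Sum>j<N. G (z N j)) = (\<Sum>j<N. H (z N j))"
      using G(2) z closure_subset[of Dp] by (intro sum.cong) (auto simp: subset_iff)
    then show ?thesis by (simp add: a' sum_distrib_left sum_divide_distrib mult.assoc)
  qed
  ultimately show ?thesis by simp
qed

section \<open>Convergence of logarithmic derivatives\<close>

text \<open>For entire functions radius 1 is always available in Cauchy's inequality, so no constant
  depending on the compact set appears.\<close>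

lemma norm_deriv_le_unit_circle:
  assumes "f holomorphic_on UNIV" "\<And>w. norm (z - w) = 1 \<Longrightarrow> norm (f w) \<le> B"
  shows "norm (deriv f z) \<le> B"
  using Cauchy_inequality[of f z 1 B 1] assms
  by (simp add: holomorphic_on_subset holomorphic_on_imp_continuous_on)

definition partial_deriv :: "(complex \<times> complex \<Rightarrow> complex) \<Rightarrow> complex \<times> complex \<Rightarrow> complex" where
  "partial_deriv F p = deriv (\<lambda>x. F (x, snd p)) (fst p)"

text \<open>This set contains the unit circles in the first variable around all points of
  \<open>K\<close>, on which Cauchy's inequality is evaluated.\<close>

lemma compact_unit_thickening:
  fixes K :: "(complex \<times> complex) set"
  assumes "compact K"
  shows "compact ((\<lambda>q. (fst (fst q) + snd q, snd (fst q))) ` (K \<times> cball 0 1))"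
  by (intro compact_continuous_image compact_Times assms compact_cball continuous_intros)

lemma holomorphic_limit_first:
  assumes conv: "\<And>P. compact P \<Longrightarrow> cconv P FN F"
    and hol: "\<And>N t. (\<lambda>x. FN N (x, t)) holomorphic_on UNIV"
  shows "(\<lambda>x. F (x, t)) holomorphic_on UNIV"
proof (rule holomorphic_uniform_sequence)
  fix x :: complex
  have "cconv (cball x 1 \<times> {t}) FN F" by (intro conv compact_Times) auto
  then have "uniform_limit (cball x 1 \<times> {t}) FN F sequentially" by (simp add: cconv_def)
  then have "uniform_limit (cball x 1) (\<lambda>N y. FN N (y, t)) (\<lambda>y. F (y, t)) sequentially"
    by (rule uniform_limit_compose') auto
  then show "\<exists>d>0. cball x d \<subseteq> UNIV \<and> uniform_limit (cball x d) (\<lambda>N y. FN N (y, t)) (\<lambda>y. F (y, t)) sequentially"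
    by (intro exI[of _ 1]) auto
qed (use hol in auto)

text \<open>Cauchy's inequality is applied to the difference of \<open>FN N\<close> and
  \<open>F\<close>, with \<open>t\<close> frozen; uniform closeness on the thickened set bounds the
  difference of the derivatives. The boundedness of the limit serves the uniform convergence of
  quotients.\<close>

lemma uniform_limit_partial_deriv:
  assumes conv: "\<And>P. compact P \<Longrightarrow> cconv P FN F"
    and hol: "\<And>N t. (\<lambda>x. FN N (x, t)) holomorphic_on UNIV"
    and K: "compact K"
  shows "uniform_limit K (\<lambda>N. partial_deriv (FN N)) (partial_deriv F) sequentially"
    and "bounded (partial_deriv F ` K)"
proof -
  have holF: "(\<lambda>x. F (x, t)) holomorphic_on UNIV" for t
    by (rule holomorphic_limit_first) (fact conv hol)+
  let ?P = "(\<lambda>q. (fst (fst q) + snd q, snd (fst q))) ` (K \<times> cball (0::complex) 1)"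
  have P: "compact ?P" by (rule compact_unit_thickening[OF K])
  have mem: "(w, snd p) \<in> ?P" if "p \<in> K" "norm (fst p - w) = 1" for p w
    using that by (intro image_eqI[of _ _ "(p, w - fst p)"]) (auto simp: norm_minus_commute)
  show "uniform_limit K (\<lambda>N. partial_deriv (FN N)) (partial_deriv F) sequentially"
  proof (rule uniform_limitI)
    fix e :: real assume e: "e > 0"
    have "uniform_limit ?P FN F sequentially" using conv[OF P] by (simp add: cconv_def)
    then have "\<forall>\<^sub>F N in sequentially. \<forall>q\<in>?P. dist (FN N q) (F q) < e / 2"
      by (rule uniform_limitD) (use e in simp)
    then show "\<forall>\<^sub>F N in sequentially. \<forall>p\<in>K. dist (partial_deriv (FN N) p) (partial_deriv F p) < e"
    proof eventually_elim
      case (elim N)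
      show ?case
      proof
        fix p assume p: "p \<in> K"
        have "norm (deriv (\<lambda>x. FN N (x, snd p) - F (x, snd p)) (fst p)) \<le> e / 2"
        proof (rule norm_deriv_le_unit_circle)
          show "(\<lambda>x. FN N (x, snd p) - F (x, snd p)) holomorphic_on UNIV"
            by (intro holomorphic_on_diff hol holF)
          show "norm (FN N (w, snd p) - F (w, snd p)) \<le> e / 2" if "norm (fst p - w) = 1" for w
            using elim[rule_format, OF mem[OF p that]] by (simp add: dist_norm)
        qed
        also have "deriv (\<lambda>x. FN N (x, snd p) - F (x, snd p)) (fst p)
            = partial_deriv (FN N) p - partial_deriv F p"
          unfolding partial_deriv_def
          by (rule deriv_diff) (use hol holF holomorphic_on_imp_differentiable_at[OF _ open_UNIV] in auto)
        finally show "dist (partial_deriv (FN N) p) (partial_deriv F p) < e"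
          using e by (simp add: dist_norm)
      qed
    qed
  qed
  have "continuous_on ?P F" using conv[OF P] by (simp add: cconv_def)
  then have "bounded (F ` ?P)" by (intro compact_imp_bounded compact_continuous_image P)
  then obtain B where B: "\<And>q. q \<in> ?P \<Longrightarrow> norm (F q) \<le> B" unfolding bounded_iff by blast
  have "norm (partial_deriv F p) \<le> B" if p: "p \<in> K" for p
    unfolding partial_deriv_def
    by (rule norm_deriv_le_unit_circle[OF holF]) (rule B[OF mem[OF p]])
  then show "bounded (partial_deriv F ` K)" by (intro boundedI[where B = B]) blast
qed

lemma has_log_deriv_quotient:
  assumes hol: "(\<lambda>x. F (x, of_real t)) holomorphic_on UNIV" "(\<lambda>x. G (x, of_real t)) holomorphic_on UNIV"
    and nz: "F (of_real x, of_real t) \<noteq> 0" "G (of_real x, of_real t) \<noteq> 0"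
  shows "has_log_deriv (\<lambda>y. F (of_real y, of_real t) / G (of_real y, of_real t))
    (partial_deriv F (of_real x, of_real t) / F (of_real x, of_real t)
      - partial_deriv G (of_real x, of_real t) / G (of_real x, of_real t)) x"
proof -
  have "((\<lambda>x. F (x, of_real t)) has_field_derivative partial_deriv F (of_real x, of_real t)) (at (of_real x))"
    using holomorphic_derivI[OF hol(1) open_UNIV, of "of_real x"] by (simp add: partial_deriv_def)
  moreover have "((\<lambda>x. G (x, of_real t)) has_field_derivative partial_deriv G (of_real x, of_real t)) (at (of_real x))"
    using holomorphic_derivI[OF hol(2) open_UNIV, of "of_real x"] by (simp add: partial_deriv_def)
  ultimately have "((\<lambda>x. F (x, of_real t) / G (x, of_real t)) has_field_derivative
      (partial_deriv F (of_real x, of_real t) * G (of_real x, of_real t)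
        - F (of_real x, of_real t) * partial_deriv G (of_real x, of_real t))
      / (G (of_real x, of_real t) * G (of_real x, of_real t))) (at (of_real x))"
    by (rule DERIV_divide) (rule nz(2))
  moreover have "(f' * g - f * g') / (g * g) = (f' / f - g' / g) * (f / g)"
    if "f \<noteq> 0" "g \<noteq> 0" for f g f' g' :: complex
    using that by (simp add: field_simps)
  note this[OF nz]
  ultimately show ?thesis
    unfolding has_log_deriv_iff using nz has_vector_derivative_real_field by force
qed

lemma compact_norm_lower_bound:
  fixes F :: "'a::topological_space \<Rightarrow> complex"
  assumes "compact K" "continuous_on K F" "\<And>p. p \<in> K \<Longrightarrow> F p \<noteq> 0"
  obtains b where "b > 0" "\<And>p. p \<in> K \<Longrightarrow> b \<le> norm (F p)"
proof (cases "K = {}")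
  case False
  obtain p where "p \<in> K" "\<And>q. q \<in> K \<Longrightarrow> norm (F p) \<le> norm (F q)"
    using continuous_attains_inf[OF assms(1) False continuous_on_norm[OF assms(2)]] by blast
  then show ?thesis using that[of "norm (F p)"] assms(3) by auto
qed (use that[of 1] in auto)

lemma eventually_nonzero_uniform:
  fixes F :: "'a \<Rightarrow> complex"
  assumes "uniform_limit K FN F sequentially" "b > 0" "\<And>p. p \<in> K \<Longrightarrow> b \<le> norm (F p)"
  shows "\<forall>\<^sub>F N in sequentially. \<forall>p\<in>K. FN N p \<noteq> 0"
  using uniform_limitD[OF assms(1,2)]
  by eventually_elim (use assms(3) in \<open>force simp: dist_norm\<close>)

text \<open>On the compact \<open>K\<close> the limits are bounded away from zero, so the
  approximants are nonzero from some \<open>N\<close> on, and the differences of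
  \<open>F' / F\<close> and \<open>G' / G\<close> converge uniformly. For small \<open>N\<close> a
  logarithmic derivative may fail to exist, hence the separate eventual statement.\<close>

lemma log_deriv_quotient_limit:
  fixes K :: "(real \<times> real) set"
  defines "c \<equiv> \<lambda>p :: real \<times> real. (complex_of_real (fst p), complex_of_real (snd p))"
  assumes FN: "\<And>P. compact P \<Longrightarrow> cconv P FN F" "\<And>N t. (\<lambda>x. FN N (x, t)) holomorphic_on UNIV"
    and GN: "\<And>P. compact P \<Longrightarrow> cconv P GN G" "\<And>N t. (\<lambda>x. GN N (x, t)) holomorphic_on UNIV"
    and K: "compact K" and nz: "\<And>p. p \<in> K \<Longrightarrow> F (c p) \<noteq> 0 \<and> G (c p) \<noteq> 0"
  shows "\<forall>(x, t)\<in>K. \<exists>d. has_log_deriv (\<lambda>y. F (c (y, t)) / G (c (y, t))) d x"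
    and "\<forall>\<^sub>F N in sequentially. \<forall>(x, t)\<in>K. \<exists>d. has_log_deriv (\<lambda>y. FN N (c (y, t)) / GN N (c (y, t))) d x"
    and "uniform_limit K (\<lambda>N (x, t). log_deriv (\<lambda>y. FN N (c (y, t)) / GN N (c (y, t))) x)
      (\<lambda>(x, t). log_deriv (\<lambda>y. F (c (y, t)) / G (c (y, t))) x) sequentially"
proof -
  let ?d = "\<lambda>F G p. partial_deriv F p / F p - partial_deriv G p / G p"
  have hol: "(\<lambda>x. F (x, t)) holomorphic_on UNIV" "(\<lambda>x. G (x, t)) holomorphic_on UNIV" for t
    by (rule holomorphic_limit_first, (fact FN GN)+)+
  have lim: "has_log_deriv (\<lambda>y. F (c (y, t)) / G (c (y, t))) (?d F G (c (x, t))) x" if "(x, t) \<in> K" for x t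
    using has_log_deriv_quotient[of F t G x] hol nz[OF that] by (simp add: c_def)
  then show "\<forall>(x, t)\<in>K. \<exists>d. has_log_deriv (\<lambda>y. F (c (y, t)) / G (c (y, t))) d x" by blast
  have cK: "compact (c ` K)"
    unfolding c_def by (intro compact_continuous_image K continuous_intros)
  have FK: "uniform_limit (c ` K) FN F sequentially" "continuous_on (c ` K) F"
    and GK: "uniform_limit (c ` K) GN G sequentially" "continuous_on (c ` K) G"
    using FN(1)[OF cK] GN(1)[OF cK] by (simp_all add: cconv_def)
  obtain b1 where b1: "b1 > 0" "\<And>p. p \<in> c ` K \<Longrightarrow> b1 \<le> norm (F p)"
    using compact_norm_lower_bound[OF cK FK(2)] nz by blast
  obtain b2 where b2: "b2 > 0" "\<And>p. p \<in> c ` K \<Longrightarrow> b2 \<le> norm (G p)"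
    using compact_norm_lower_bound[OF cK GK(2)] nz by blast
  have ev: "\<forall>\<^sub>F N in sequentially. \<forall>p\<in>K. FN N (c p) \<noteq> 0 \<and> GN N (c p) \<noteq> 0"
  proof -
    have "\<forall>\<^sub>F N in sequentially. \<forall>p\<in>c ` K. FN N p \<noteq> 0"
      by (rule eventually_nonzero_uniform[OF FK(1) b1(1)]) (rule b1(2))
    moreover have "\<forall>\<^sub>F N in sequentially. \<forall>p\<in>c ` K. GN N p \<noteq> 0"
      by (rule eventually_nonzero_uniform[OF GK(1) b2(1)]) (rule b2(2))
    ultimately show ?thesis by eventually_elim blast
  qed
  have evd: "\<forall>\<^sub>F N in sequentially. \<forall>(x, t)\<in>K.
      has_log_deriv (\<lambda>y. FN N (c (y, t)) / GN N (c (y, t))) (?d (FN N) (GN N) (c (x, t))) x"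
    using ev
  proof eventually_elim
    case (elim N)
    then show ?case
      using has_log_deriv_quotient[of "FN N" _ "GN N"] FN(2) GN(2) by (auto simp: c_def)
  qed
  then show "\<forall>\<^sub>F N in sequentially. \<forall>(x, t)\<in>K. \<exists>d. has_log_deriv (\<lambda>y. FN N (c (y, t)) / GN N (c (y, t))) d x"
    by eventually_elim blast
  have dF: "uniform_limit (c ` K) (\<lambda>N. partial_deriv (FN N)) (partial_deriv F) sequentially"
      "bounded (partial_deriv F ` c ` K)"
    by (rule uniform_limit_partial_deriv, (fact FN cK)+)+
  have dG: "uniform_limit (c ` K) (\<lambda>N. partial_deriv (GN N)) (partial_deriv G) sequentially"
      "bounded (partial_deriv G ` c ` K)"
    by (rule uniform_limit_partial_deriv, (fact GN cK)+)+
  have "uniform_limit (c ` K) (\<lambda>N. ?d (FN N) (GN N)) (?d F G) sequentially"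
    by (intro uniform_limit_minus uniform_lim_divide[OF dF(1) FK(1) dF(2) _ b1(1)]
        uniform_lim_divide[OF dG(1) GK(1) dG(2) _ b2(1)]) (fact b1 b2)+
  then have "uniform_limit K (\<lambda>N p. ?d (FN N) (GN N) (c p)) (\<lambda>p. ?d F G (c p)) sequentially"
    by (rule uniform_limit_compose') auto
  then show "uniform_limit K (\<lambda>N (x, t). log_deriv (\<lambda>y. FN N (c (y, t)) / GN N (c (y, t))) x)
      (\<lambda>(x, t). log_deriv (\<lambda>y. F (c (y, t)) / G (c (y, t))) x) sequentially"
  \<comment> \<open>\<open>log_deriv\<close> is a definite description, evaluated by exhibiting the
    derivative. For the approximants this is possible only from some \<open>N\<close> on, so the
    sequences are identified eventually.\<close>
  proof (rule uniform_limit_cong[THEN iffD1, rotated -1])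
    show "\<forall>\<^sub>F N in sequentially. \<forall>p\<in>K. ?d (FN N) (GN N) (c p)
        = (case p of (x, t) \<Rightarrow> log_deriv (\<lambda>y. FN N (c (y, t)) / GN N (c (y, t))) x)"
      using evd by eventually_elim (auto dest!: log_deriv_eq bspec)
    show "?d F G (c p) = (case p of (x, t) \<Rightarrow> log_deriv (\<lambda>y. F (c (y, t)) / G (c (y, t))) x)"
      if "p \<in> K" for p :: "real \<times> real"
      using log_deriv_eq[OF lim] that by (cases p) auto
  qed
qed

section \<open>Condensation of the solitons\<close>

text \<open>The weight \<open>4 \<bar>z\<bar>\<^sup>2\<close> is the Jacobian of the squaring map; it compensates the denominator of \<open>f_hat\<close>.\<close>

lemma discretization_square:
  fixes \<kappa> :: "complex \<Rightarrow> complex"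
  assumes \<kappa>: "\<kappa> = (\<lambda>w. w) \<or> \<kappa> = cnj"
    and Dp: "open Dp" "Dp \<noteq> {}" "bounded Dp" "closure Dp \<subseteq> {u. 0 < Re u \<and> 0 < Im u}"
    and z: "\<And>N j. j < N \<Longrightarrow> z N j \<in> Dp"
    and weak: "weakly_converges_to (\<lambda>N. empirical_measure N (z N)) (uniform_measure lborel Dp)"
  shows "discretization ((\<lambda>z. \<kappa> (z\<^sup>2)) ` closure Dp) (nu ((\<lambda>z. \<kappa> (z\<^sup>2)) ` Dp))
    (\<lambda>N j. measure lebesgue Dp / (pi * real N) * (4 * (norm (z N j))\<^sup>2)) (\<lambda>N j. \<kappa> ((z N j)\<^sup>2))"
    (is "discretization ?T ?M ?wt ?u")
proof -
  let ?g = "\<lambda>z. \<kappa> (z\<^sup>2)"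
  have \<kappa>_lin: "bounded_linear \<kappa>" using \<kappa> by (auto intro: bounded_linear_ident bounded_linear_cnj)
  have \<kappa>_inj: "\<kappa> a = \<kappa> b \<longleftrightarrow> a = b" for a b using \<kappa> by auto
  have cont_\<kappa>: "continuous_on S (\<lambda>x. \<kappa> (h x))" if "continuous_on S h" for S and h :: "complex \<Rightarrow> complex"
    using \<kappa> that by (auto intro: continuous_on_cnj)
  have cont: "continuous_on S ?g" for S by (intro cont_\<kappa> continuous_intros)
  have comp: "compact (closure Dp)" using Dp(3) by (simp add: compact_closure)
  have T: "compact ?T" by (intro compact_continuous_image cont comp)
  have sub: "?g ` Dp \<subseteq> ?T" using closure_subset by blast
  have inj: "inj_on ?g Dp"
    using inj_on_square_quadrant[of Dp] closure_subset Dp(4) by (auto simp: inj_on_def \<kappa>_inj)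
  \<comment> \<open>Invariance of domain covers the holomorphic and the antiholomorphic map
    alike.\<close>
  have opn: "open (?g ` Dp)" by (rule invariance_of_domain[OF cont Dp(1) inj])
  have bdd: "bounded (?g ` Dp)" using compact_imp_bounded[OF T] sub by (rule bounded_subset)
  have der: "(?g has_derivative (\<lambda>h. \<kappa> (2 * x * h))) (at x)" for x
  proof -
    have "((\<lambda>z. z\<^sup>2) has_derivative (\<lambda>h. 2 * x * h)) (at x)"
      by (auto intro!: derivative_eq_intros simp: fun_eq_iff power2_eq_square)
    from bounded_linear.has_derivative[OF \<kappa>_lin this] show ?thesis .
  qed
  have meas: "h \<in> borel_measurable ?M" if "continuous_on ?T h" for h :: "complex \<Rightarrow> complex"
  proof -
    have "h \<in> borel_measurable (lebesgue_on (?g ` Dp))"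
      by (rule continuous_imp_measurable_on_sets_lebesgue) (use that sub opn continuous_on_subset in auto)
    then show ?thesis unfolding nu_def by simp
  qed
  have fin: "finite_measure ?M"
  proof (rule finite_measureI)
    have b: "?g ` Dp \<in> sets lborel" using opn by simp
    then have lm: "?g ` Dp \<in> sets lebesgue" by (rule sets_completionI_sets)
    have "emeasure ?M (space ?M) = ennreal (1 / pi) * emeasure (lebesgue_on (?g ` Dp)) (?g ` Dp)"
      unfolding nu_def using lm by (simp add: emeasure_density_const space_restrict_space)
    also have "\<dots> = ennreal (1 / pi) * emeasure lborel (?g ` Dp)"
      using lm b by (simp add: emeasure_restrict_space)
    also have "\<dots> \<noteq> \<infinity>"
      using emeasure_bounded_finite[OF bdd] by (simp add: ennreal_mult_eq_top_iff)
    finally show "emeasure ?M (space ?M) \<noteq> \<infinity>" .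
  qed
  have conv: "(\<lambda>N. \<Sum>j<N. of_real (?wt N j) * h (?u N j)) \<longlonglongrightarrow> (\<integral>w. h w \<partial>?M)"
    if h: "continuous_on ?T h" for h :: "complex \<Rightarrow> complex"
  proof -
    \<comment> \<open>The pull-back of \<open>h\<close> under the squaring map, multiplied by its
      Jacobian.\<close>
    let ?H = "\<lambda>x. of_real ((norm (2 * x))\<^sup>2) * h (?g x)"
    have "continuous_on (closure Dp) ?H"
      by (intro continuous_intros continuous_on_compose2[OF h cont]) auto
    from weak_convergence_complex[OF weak Dp(1-3) z this]
    have "(\<lambda>N. (\<Sum>j<N. of_real (measure lebesgue Dp / (pi * real N)) * ?H (z N j)))
      \<longlonglongrightarrow> of_real (1 / pi) * (\<integral>u. ?H u \<partial>lebesgue_on Dp)" .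
    moreover have "(\<integral>u. ?H u \<partial>lebesgue_on Dp) = (\<integral>w. h w \<partial>lebesgue_on (?g ` Dp))"
    proof -
      obtain B where B: "\<And>w. w \<in> ?T \<Longrightarrow> norm (h w) \<le> B"
        using compact_imp_bounded[OF compact_continuous_image[OF h T]] unfolding bounded_iff by blast
      obtain C where C: "\<And>x. x \<in> Dp \<Longrightarrow> norm x \<le> C" using Dp(3) unfolding bounded_iff by blast
      show ?thesis
      proof (rule complex_change_of_variables[OF \<kappa> Dp(1,3) opn bdd inj, symmetric])
        show "norm (2 * x) \<le> 2 * C" if "x \<in> Dp" for x using C[OF that] by (simp add: norm_mult)
        show "norm (h w) \<le> B" if "w \<in> ?g ` Dp" for w using B sub that by blast
        show "continuous_on (?g ` Dp) h" using h sub by (rule continuous_on_subset)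
      qed (auto intro!: der continuous_intros)
    qed
    moreover have "of_real (1 / pi) * (\<integral>w. h w \<partial>lebesgue_on (?g ` Dp)) = (\<integral>w. h w \<partial>?M)"
    proof -
      have "h \<in> borel_measurable (lebesgue_on (?g ` Dp))" using meas[OF h] by (simp add: nu_def)
      then have "(\<integral>w. h w \<partial>?M) = (\<integral>w. (1 / pi) *\<^sub>R h w \<partial>lebesgue_on (?g ` Dp))"
        unfolding nu_def by (intro integral_density) auto
      then show ?thesis by (simp add: scaleR_conv_of_real)
    qed
    moreover have "of_real (measure lebesgue Dp / (pi * real N)) * ?H (z N j) = of_real (?wt N j) * h (?u N j)" for N j
      by (simp add: norm_mult power_mult_distrib)
    ultimately show ?thesis by (simp add: mult.assoc)
  qed
  show ?thesis
  proof (rule discretization.intro)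
    show "space ?M \<subseteq> ?T" using sub by (simp add: nu_def space_restrict_space)
    show "?u N j \<in> ?T" if "j < N" for N j using z[OF that] closure_subset by blast
    show "?wt N j \<ge> 0" for N j by simp
  qed (fact T fin | rule meas conv, assumption)+
qed

section \<open>The common form of both determinants, with complex parameters\<close>

text \<open>\<open>theta_hat\<close> with the real pair \<open>(x, t)\<close> replaced by a complex
  one, which makes the determinants entire in \<open>x\<close>.\<close>

definition phase :: "complex \<times> complex \<Rightarrow> complex \<Rightarrow> complex" where
  "phase p w = fst p * w + 2 * snd p * w\<^sup>2"

definition outer_factor :: "complex \<Rightarrow> (complex \<Rightarrow> complex) \<Rightarrow> complex \<times> complex \<Rightarrow> complex \<Rightarrow> complex" where
  "outer_factor e F p w = F w * exp (2 * e * \<i> * phase p w)"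

text \<open>The product of two \<open>Q\<close> kernels that share the variable \<open>l\<close>,
  stripped of what depends on \<open>w\<close> or \<open>w'\<close> alone: \<open>- 4 * l\<close> is
  the square of \<open>2 * \<i>\<close> times a root of \<open>l\<close>, and the shared square root
  and exponential have become \<open>outer_factor\<close>. The sign \<open>e\<close> is 1 on the
  domain and -1 on its mirror image.\<close>

definition inner_factor ::
  "complex \<Rightarrow> (complex \<Rightarrow> complex) \<Rightarrow> complex \<times> complex \<Rightarrow> complex \<Rightarrow> complex \<Rightarrow> complex \<Rightarrow> complex"
where
  "inner_factor e F p w w' l = - 4 * l * outer_factor e F p l / ((l - w) * (l - w'))"

definition tau_matrix where
  "tau_matrix wt1 u wt2 v e1 F1 e2 F2 N p = Matrix.mat N N (\<lambda>(i, j).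
    of_real (wt1 N i :: real) * outer_factor e1 F1 p (u N i) *
    (\<Sum>l<N. of_real (wt2 N l :: real) * inner_factor e2 F2 p (u N i) (u N j) (v N l)))"

definition continuum_tau where
  "continuum_tau M1 M2 e1 F1 e2 F2 = discretization_pair.fredholm_series M1 M2 (outer_factor e1 F1) (inner_factor e2 F2)"

lemma holomorphic_on_det:
  assumes "\<And>i j. i < n \<Longrightarrow> j < n \<Longrightarrow> f i j holomorphic_on S"
  shows "(\<lambda>x. Determinant.det (Matrix.mat n n (\<lambda>(i, j). f i j x))) holomorphic_on S"
proof -
  have "Determinant.det (Matrix.mat n n (\<lambda>(i, j). f i j x))
      = (\<Sum>p | p permutes {..<n}. of_int (sign p) * (\<Prod>i<n. f i (p i) x))" for x
    by (rule det_mat_lessThan)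
  moreover have "(\<lambda>x. \<Sum>p | p permutes {..<n}. of_int (sign p) * (\<Prod>i<n. f i (p i) x)) holomorphic_on S"
  proof (intro holomorphic_on_sum holomorphic_on_mult holomorphic_on_const holomorphic_on_prod assms)
    fix p i assume "p \<in> {p. p permutes {..<n}}" "i \<in> {..<n}"
    then show "i < n" "p i < n" using permutes_in_image[of p "{..<n}" i] by auto
  qed
  ultimately show ?thesis by simp
qed

lemma holomorphic_tau_matrix:
  "(\<lambda>x. Determinant.det (1\<^sub>m N + tau_matrix wt1 u wt2 v e1 F1 e2 F2 N (x, t))) holomorphic_on UNIV"
proof -
  have eq: "1\<^sub>m N + tau_matrix wt1 u wt2 v e1 F1 e2 F2 N (x, t) = Matrix.mat N N (\<lambda>(i, j).
      (if i = j then 1 else 0) +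
      of_real (wt1 N i) * (F1 (u N i) * exp (2 * e1 * \<i> * (x * u N i + 2 * t * (u N i)\<^sup>2))) *
    (\<Sum>l<N. of_real (wt2 N l) * (- 4 * v N l * (F2 (v N l) * exp (2 * e2 * \<i> * (x * v N l + 2 * t * (v N l)\<^sup>2)))
      / ((v N l - u N i) * (v N l - u N j)))))" for x
    by (rule eq_matI) (auto simp: tau_matrix_def outer_factor_def inner_factor_def phase_def)
  show ?thesis unfolding eq
  proof (rule holomorphic_on_det)
    fix i j
    \<comment> \<open>Denominators do not involve \<open>x\<close>. Division by a constant is
      multiplication by its \<open>inverse\<close>, so whether the constant vanishes is
      immaterial.\<close>
    have div: "(\<lambda>x. h x / c) holomorphic_on UNIV" if "h holomorphic_on UNIV" for h and c :: complex
      using holomorphic_on_mult[OF that holomorphic_on_const[of "inverse c"]] by (simp add: divide_inverse)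
    show "(\<lambda>x. (if i = j then 1 else 0) +
      of_real (wt1 N i) * (F1 (u N i) * exp (2 * e1 * \<i> * (x * u N i + 2 * t * (u N i)\<^sup>2))) *
    (\<Sum>l<N. of_real (wt2 N l) * (- 4 * v N l * (F2 (v N l) * exp (2 * e2 * \<i> * (x * v N l + 2 * t * (v N l)\<^sup>2)))
      / ((v N l - u N i) * (v N l - u N j))))) holomorphic_on UNIV"
      by (intro holomorphic_intros div)
  qed
qed

lemma continuous_on_phase:
  assumes "continuous_on S a" "continuous_on S b"
  shows "continuous_on S (\<lambda>q. phase (a q) (b q))"
  unfolding phase_def by (intro continuous_intros assms)

lemma continuous_on_outer_factor:
  assumes "continuous_on T F" "continuous_on S a" "continuous_on S b" "b ` S \<subseteq> T"
  shows "continuous_on S (\<lambda>q. outer_factor e F (a q) (b q))"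
  unfolding outer_factor_def
  by (intro continuous_intros continuous_on_phase continuous_on_compose2[OF assms(1,3,4)] assms(2,3))

lemma discretization_pair_tau:
  assumes "discretization T1 M1 wt1 u" "discretization T2 M2 wt2 v"
    and F: "continuous_on T1 F1" "continuous_on T2 F2" and disj: "T1 \<inter> T2 = {}" and P: "compact P"
  shows "discretization_pair T1 M1 wt1 u T2 M2 wt2 v P (outer_factor e1 F1) (inner_factor e2 F2)"
proof -
  interpret D1: discretization T1 M1 wt1 u by fact
  interpret D2: discretization T2 M2 wt2 v by fact
  show ?thesis
  proof
    show "continuous_on (P \<times> T1) (\<lambda>q. outer_factor e1 F1 (fst q) (snd q))"
      by (intro continuous_on_outer_factor[OF F(1)] continuous_intros) auto
    show "continuous_on ((P \<times> T1 \<times> T1) \<times> T2)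
      (\<lambda>q. inner_factor e2 F2 (fst (fst q)) (fst (snd (fst q))) (snd (snd (fst q))) (snd q))"
      unfolding inner_factor_def
      by (intro continuous_intros continuous_on_outer_factor[OF F(2)]) (use disj in auto)
  qed fact
qed

lemma cconv_tau_matrix:
  assumes "discretization T1 M1 wt1 u" "discretization T2 M2 wt2 v"
    and "continuous_on T1 F1" "continuous_on T2 F2" "T1 \<inter> T2 = {}" and "compact P"
  shows "cconv P (\<lambda>N p. Determinant.det (1\<^sub>m N + tau_matrix wt1 u wt2 v e1 F1 e2 F2 N p))
    (continuum_tau M1 M2 e1 F1 e2 F2)"
proof -
  interpret D: discretization_pair T1 M1 wt1 u T2 M2 wt2 v P "outer_factor e1 F1" "inner_factor e2 F2"
    by (rule discretization_pair_tau) fact+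
  show ?thesis
    using D.cconv_det_fredholm_series
    unfolding tau_matrix_def continuum_tau_def D.kerN_def D.D2.quad_def .
qed

text \<open>Half of the outer exponential goes with each copy of \<open>b\<close>, so the factor on
  either side of the kernel squares to \<open>outer_factor\<close>.\<close>

lemma fredholm_det_eq_continuum_tau:
  assumes "discretization T1 M1 wt1 u" "discretization T2 M2 wt2 v"
    and "continuous_on T1 F1" "continuous_on T2 F2" "T1 \<inter> T2 = {}"
    and b: "\<And>w. w \<in> space M1 \<Longrightarrow> (b w)\<^sup>2 = F1 w"
    and K: "\<And>w w' l. w \<in> space M1 \<Longrightarrow> w' \<in> space M1 \<Longrightarrow> l \<in> space M2 \<Longrightarrow>
      Q l w * Q l w' = b w * exp (e1 * \<i> * phase p w) * inner_factor e2 F2 p w w' l * (b w' * exp (e1 * \<i> * phase p w'))"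
  shows "fredholm_det M1 (kernel_comp M2 (kernel_transpose Q) Q) = continuum_tau M1 M2 e1 F1 e2 F2 p"
proof -
  \<comment> \<open>The series at a given \<open>p\<close> does not refer to the parameter set, so
    the empty one will do.\<close>
  interpret D: discretization_pair T1 M1 wt1 u T2 M2 wt2 v "{}" "outer_factor e1 F1" "inner_factor e2 F2"
    by (rule discretization_pair_tau) (fact | simp)+
  show ?thesis unfolding continuum_tau_def
  proof (rule D.fredholm_det_eq_series[where b = "\<lambda>w. b w * exp (e1 * \<i> * phase p w)"])
    fix w assume w: "w \<in> space M1"
    show "(b w * exp (e1 * \<i> * phase p w))\<^sup>2 = outer_factor e1 F1 p w"
      by (simp add: power_mult_distrib b[OF w] outer_factor_def flip: exp_double) (simp add: mult_ac)
    fix w' assume w': "w' \<in> space M1"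
    have "kernel_comp M2 (kernel_transpose Q) Q w w' = (\<integral>l. b w * exp (e1 * \<i> * phase p w) *
        inner_factor e2 F2 p w w' l * (b w' * exp (e1 * \<i> * phase p w')) \<partial>M2)"
      unfolding kernel_comp_def kernel_transpose_def
      by (rule Bochner_Integration.integral_cong) (simp_all add: K w w')
    then show "kernel_comp M2 (kernel_transpose Q) Q w w'
      = b w * exp (e1 * \<i> * phase p w) * D.ker p w w' * (b w' * exp (e1 * \<i> * phase p w'))"
      by (simp add: D.ker_def)
  qed
qed

text \<open>Diagonal matrices scale rows and columns, so an entry of the fourfold product is one sum
  over \<open>l\<close>. The minus sign in front of the product is the one contained in
  \<open>inner_factor\<close>.\<close>

lemma tau_matrix_eq_product:
  fixes al al' :: "nat \<Rightarrow> complex" and C :: "complex mat"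
  assumes C: "C \<in> carrier_mat N N"
    and outer: "\<And>i. i < N \<Longrightarrow> of_real (wt1 N i) * outer_factor e1 F1 p (u N i) = al' i"
    and inner: "\<And>i j l. i < N \<Longrightarrow> j < N \<Longrightarrow> l < N \<Longrightarrow>
      of_real (wt2 N l) * inner_factor e2 F2 p (u N i) (u N j) (v N l) = - (C $$ (l, i) * al l * C $$ (l, j))"
  shows "1\<^sub>m N - mat_diag N al' * transpose_mat C * mat_diag N al * C
    = 1\<^sub>m N + tau_matrix wt1 u wt2 v e1 F1 e2 F2 N p"
proof (rule eq_matI)
  fix i j assume "i < dim_row (1\<^sub>m N + tau_matrix wt1 u wt2 v e1 F1 e2 F2 N p)"
    "j < dim_col (1\<^sub>m N + tau_matrix wt1 u wt2 v e1 F1 e2 F2 N p)"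
  then have i: "i < N" and j: "j < N" by (auto simp: tau_matrix_def)
  have "mat_diag N al' * transpose_mat C * mat_diag N al = Matrix.mat N N (\<lambda>(i, l). al' i * C $$ (l, i) * al l)"
    using C by (subst mat_diag_mult_left[of _ N N], simp, subst mat_diag_mult_right[of _ N N]) (auto intro!: eq_matI)
  moreover have dims: "mat_diag N al' * transpose_mat C * mat_diag N al * C \<in> carrier_mat N N"
    by (intro mult_carrier_mat[where n = N]) (use C in \<open>simp_all add: mat_diag_dim\<close>)
  ultimately have "(mat_diag N al' * transpose_mat C * mat_diag N al * C) $$ (i, j)
      = (\<Sum>l<N. al' i * C $$ (l, i) * al l * C $$ (l, j))"
    using i j C by (simp add: scalar_prod_def atLeast0LessThan)
  also have "\<dots> = - (of_real (wt1 N i) * outer_factor e1 F1 p (u N i) *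
      (\<Sum>l<N. of_real (wt2 N l) * inner_factor e2 F2 p (u N i) (u N j) (v N l)))"
    using i j by (simp add: outer inner sum_distrib_left sum_negf mult.assoc)
  finally show "(1\<^sub>m N - mat_diag N al' * transpose_mat C * mat_diag N al * C) $$ (i, j)
      = (1\<^sub>m N + tau_matrix wt1 u wt2 v e1 F1 e2 F2 N p) $$ (i, j)"
    using i j C dims by (simp add: tau_matrix_def del: index_mult_mat)
qed (use C in \<open>auto simp: tau_matrix_def mat_diag_def\<close>)

section \<open>Identification of the finite and continuum tau functions\<close>

locale condensation =
  fixes Dp :: "complex set" and z :: "nat \<Rightarrow> nat \<Rightarrow> complex" and f :: "complex \<Rightarrow> complex"
  assumes open_Dp: "open Dp" and nonempty_Dp: "Dp \<noteq> {}" and bounded_Dp: "bounded Dp"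
    and quadrant: "closure Dp \<subseteq> {u. 0 < Re u \<and> 0 < Im u}"
    and nodes: "\<And>N j. j < N \<Longrightarrow> z N j \<in> Dp"
    and weak: "weakly_converges_to (\<lambda>N. empirical_measure N (z N)) (uniform_measure lborel Dp)"
    and cont_f: "continuous_on (closure Dp) f"
begin

definition wt :: "nat \<Rightarrow> nat \<Rightarrow> real" where
  "wt N j = measure lebesgue Dp / (pi * real N) * (4 * (norm (z N j))\<^sup>2)"

text \<open>\<open>f_hat\<close> selects its root by a description within \<open>Dp\<close> and says
  nothing on the boundary. The principal root agrees with it on the squared domain and extends it
  continuously to the squared closure.\<close>

definition F :: "complex \<Rightarrow> complex" where
  "F l = f (csqrt l) / of_real (4 * (norm (csqrt l))\<^sup>2)"

definition F_star :: "complex \<Rightarrow> complex" where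
  "F_star w = cnj (F (cnj w))"

abbreviation "T \<equiv> (\<lambda>z. z\<^sup>2) ` closure Dp"
abbreviation "T_star \<equiv> (\<lambda>z. cnj (z\<^sup>2)) ` closure Dp"
abbreviation "node N j \<equiv> (z N j)\<^sup>2"
abbreviation "node_star N j \<equiv> cnj ((z N j)\<^sup>2)"

definition tau_plus_approx :: "nat \<Rightarrow> complex \<times> complex \<Rightarrow> complex" where
  "tau_plus_approx N p =
    Determinant.det (1\<^sub>m N + tau_matrix wt node_star wt node (- 1) F_star 1 F N p)"

definition tau_minus_approx :: "nat \<Rightarrow> complex \<times> complex \<Rightarrow> complex" where
  "tau_minus_approx N p =
    Determinant.det (1\<^sub>m N + tau_matrix wt node wt node_star 1 F (- 1) F_star N p)"

definition tau_plus_limit :: "complex \<times> complex \<Rightarrow> complex" where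
  "tau_plus_limit = continuum_tau (nu (sq_dom_star Dp)) (nu (sq_dom Dp)) (- 1) F_star 1 F"

definition tau_minus_limit :: "complex \<times> complex \<Rightarrow> complex" where
  "tau_minus_limit = continuum_tau (nu (sq_dom Dp)) (nu (sq_dom_star Dp)) 1 F (- 1) F_star"

lemma csqrt_square_closure: "x \<in> closure Dp \<Longrightarrow> csqrt (x\<^sup>2) = x"
  using quadrant by (intro csqrt_square) auto

lemma Im_square_closure: "x \<in> closure Dp \<Longrightarrow> Im (x\<^sup>2) > 0"
  using quadrant by (auto simp: power2_eq_square)

lemma closure_Dp: "x \<in> Dp \<Longrightarrow> x \<in> closure Dp"
  using closure_subset by blast

lemma sq_dom_star_eq: "sq_dom_star Dp = (\<lambda>z. cnj (z\<^sup>2)) ` Dp"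
  by (simp add: sq_dom_star_def sq_dom_def image_image)

lemma disc: "discretization T (nu (sq_dom Dp)) wt node"
  using discretization_square[of "\<lambda>w. w" Dp z] open_Dp nonempty_Dp bounded_Dp quadrant nodes weak
  unfolding sq_dom_def wt_def by auto

lemma disc_star: "discretization T_star (nu (sq_dom_star Dp)) wt node_star"
  using discretization_square[of cnj Dp z] open_Dp nonempty_Dp bounded_Dp quadrant nodes weak
  unfolding sq_dom_star_eq wt_def by auto

text \<open>Squares of points of the open first quadrant lie in the upper half plane, and their
  conjugates in the lower one. This keeps the Cauchy denominators away from zero.\<close>

lemma disjoint: "T \<inter> T_star = {}" "T_star \<inter> T = {}"
proof -
  have ne: "x\<^sup>2 \<noteq> cnj (y\<^sup>2)" if "x \<in> closure Dp" "y \<in> closure Dp" for x y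
  proof
    assume "x\<^sup>2 = cnj (y\<^sup>2)"
    then have "Im (x\<^sup>2) = - Im (y\<^sup>2)" by (simp only: cnj.sel)
    then show False using Im_square_closure[OF that(1)] Im_square_closure[OF that(2)] by linarith
  qed
  show "T \<inter> T_star = {}"
  proof (rule equals0I)
    fix w assume "w \<in> T \<inter> T_star"
    then obtain x y where "x \<in> closure Dp" "y \<in> closure Dp" "x\<^sup>2 = cnj (y\<^sup>2)"
      by (elim IntE imageE) simp
    then show False using ne by blast
  qed
  then show "T_star \<inter> T = {}" by (simp only: Int_commute)
qed

lemma continuous_F: "continuous_on T F"
proof -
  have "continuous_on T csqrt"
    by (rule continuous_on_subset[OF continuous_on_csqrt])
       (use Im_square_closure in \<open>fastforce simp: complex_nonpos_Reals_iff\<close>)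
  moreover have "csqrt ` T \<subseteq> closure Dp" using csqrt_square_closure by auto
  moreover have "csqrt l \<noteq> 0" if "l \<in> T" for l using that Im_square_closure by fastforce
  ultimately show ?thesis
    unfolding F_def by (intro continuous_intros continuous_on_compose2[OF cont_f]) auto
qed

lemma continuous_F_star: "continuous_on T_star F_star"
  unfolding F_star_def
  by (intro continuous_on_cnj continuous_on_compose2[OF continuous_F] continuous_intros) auto

lemma z_plus_eq: "x \<in> Dp \<Longrightarrow> z_plus Dp (x\<^sup>2) = x"
  unfolding z_plus_def
  by (rule the_equality) (use inj_onD[OF inj_on_square_quadrant[OF quadrant]] closure_Dp in auto)

lemma z_plus_square: "l \<in> sq_dom Dp \<Longrightarrow> (z_plus Dp l)\<^sup>2 = l"
  by (auto simp: sq_dom_def z_plus_eq)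

lemma z_plus_star_square: "w \<in> sq_dom_star Dp \<Longrightarrow> (z_plus_star Dp w)\<^sup>2 = w"
  by (auto simp: sq_dom_star_def z_plus_star_def z_plus_square simp flip: complex_cnj_power)

lemma F_eq: "l \<in> sq_dom Dp \<Longrightarrow> F l = f_hat Dp f l"
proof -
  assume "l \<in> sq_dom Dp"
  then obtain x where x: "x \<in> Dp" "l = x\<^sup>2" by (auto simp: sq_dom_def)
  show ?thesis
    unfolding F_def f_hat_def x(2) z_plus_eq[OF x(1)] csqrt_square_closure[OF closure_Dp[OF x(1)]] by (rule refl)
qed

lemma F_star_eq: "w \<in> sq_dom_star Dp \<Longrightarrow> F_star w = f_hat_star Dp f w"
  by (auto simp: F_star_def f_hat_star_def sq_dom_star_def F_eq)

lemma cconv_tau_plus: "compact P \<Longrightarrow> cconv P tau_plus_approx tau_plus_limit"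
  unfolding tau_plus_approx_def tau_plus_limit_def
  by (rule cconv_tau_matrix[OF disc_star disc continuous_F_star continuous_F disjoint(2)])

lemma cconv_tau_minus: "compact P \<Longrightarrow> cconv P tau_minus_approx tau_minus_limit"
  unfolding tau_minus_approx_def tau_minus_limit_def
  by (rule cconv_tau_matrix[OF disc disc_star continuous_F continuous_F_star disjoint(1)])

lemma wt_F: "j < N \<Longrightarrow> of_real (wt N j) * F (node N j) = norming_const Dp f N (z N) j"
  using csqrt_square_closure[OF closure_Dp[OF nodes]] quadrant closure_Dp[OF nodes, of j N]
  by (auto simp: wt_def F_def norming_const_def)

lemma wt_F_star: "j < N \<Longrightarrow> of_real (wt N j) * F_star (node_star N j) = cnj (norming_const Dp f N (z N) j)"
  by (simp add: F_star_def flip: wt_F)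

lemma wt_outer: "j < N \<Longrightarrow> of_real (wt N j) * outer_factor e F p (node N j)
    = norming_const Dp f N (z N) j * exp (2 * e * \<i> * phase p (node N j))"
  unfolding outer_factor_def mult.assoc[symmetric] by (simp add: wt_F)

lemma wt_outer_star: "j < N \<Longrightarrow> of_real (wt N j) * outer_factor e F_star p (node_star N j)
    = cnj (norming_const Dp f N (z N) j) * exp (2 * e * \<i> * phase p (node_star N j))"
  unfolding outer_factor_def mult.assoc[symmetric] using wt_F_star by simp

lemma phase_of_real: "phase (of_real x, of_real t) w = theta_hat x t w"
  by (simp add: phase_def theta_hat_def)

text \<open>The outer variables are the conjugated nodes, with weight and phase from
  \<open>A_star_mat\<close>; the summed variables are the nodes, with those from
  \<open>A_mat\<close>. The two numerators \<open>2 * z\<close> of \<open>C_mat\<close> multiply to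
  four times the node.\<close>

lemma tauN_plus_eq:
  "tauN_plus N (z N) (norming_const Dp f N (z N)) x t = tau_plus_approx N (of_real x, of_real t)"
  unfolding tauN_plus_def A_mat_def A_star_mat_def tau_plus_approx_def
proof (rule arg_cong[where f = Determinant.det], rule tau_matrix_eq_product)
  fix i j l assume ij: "i < N" "j < N" and l: "l < N"
  let ?p = "(complex_of_real x, complex_of_real t)"
  have "of_real (wt N l) * inner_factor 1 F ?p (node_star N i) (node_star N j) (node N l)
    = - 4 * node N l * (of_real (wt N l) * outer_factor 1 F ?p (node N l))
      / ((node N l - node_star N i) * (node N l - node_star N j))"
    by (simp add: inner_factor_def mult_ac)
  then show "of_real (wt N l) * inner_factor 1 F ?p (node_star N i) (node_star N j) (node N l)
    = - (C_mat N (z N) $$ (l, i) * (norming_const Dp f N (z N) l * exp (2 * \<i> * theta_hat x t (node N l)))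
      * C_mat N (z N) $$ (l, j))"
    unfolding wt_outer[OF l] using ij l by (simp add: phase_of_real C_mat_def power2_eq_square)
qed (simp_all add: C_mat_def wt_outer_star[simplified] phase_of_real)

lemma tauN_minus_eq:
  "tauN_minus N (z N) (norming_const Dp f N (z N)) x t = tau_minus_approx N (of_real x, of_real t)"
  unfolding tauN_minus_def A_mat_def A_star_mat_def tau_minus_approx_def
proof (rule arg_cong[where f = Determinant.det], rule tau_matrix_eq_product)
  fix i j l assume ij: "i < N" "j < N" and l: "l < N"
  let ?p = "(complex_of_real x, complex_of_real t)"
  have "of_real (wt N l) * inner_factor (- 1) F_star ?p (node N i) (node N j) (node_star N l)
    = - 4 * node_star N l * (of_real (wt N l) * outer_factor (- 1) F_star ?p (node_star N l))
      / ((node_star N l - node N i) * (node_star N l - node N j))"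
    by (simp add: inner_factor_def mult_ac)
  then show "of_real (wt N l) * inner_factor (- 1) F_star ?p (node N i) (node N j) (node_star N l)
    = - (map_mat cnj (C_mat N (z N)) $$ (l, i)
      * (cnj (norming_const Dp f N (z N) l) * exp (- 2 * \<i> * theta_hat x t (node_star N l)))
      * map_mat cnj (C_mat N (z N)) $$ (l, j))"
    unfolding wt_outer_star[OF l] using ij l by (simp add: phase_of_real C_mat_def power2_eq_square)
qed (simp_all add: C_mat_def wt_outer phase_of_real)

lemma space_nu_sq_dom: "space (nu (sq_dom Dp)) = sq_dom Dp" "space (nu (sq_dom_star Dp)) = sq_dom_star Dp"
  by (simp_all add: nu_def space_restrict_space)

text \<open>In the product of two kernels with common \<open>l\<close>, both \<open>s l\<close> and
  \<open>z_plus Dp l\<close> occur twice and become \<open>F l\<close> and \<open>l\<close>. The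
  branch \<open>r\<close> survives only as an outer factor on each side, where its square is all
  that counts.\<close>

lemma tau_plus_eq:
  assumes s: "\<And>l. l \<in> sq_dom Dp \<Longrightarrow> (s l)\<^sup>2 = f_hat Dp f l"
    and r: "\<And>w. w \<in> sq_dom_star Dp \<Longrightarrow> (r w)\<^sup>2 = f_hat_star Dp f w"
  shows "tau_plus Dp s r x t = tau_plus_limit (of_real x, of_real t)"
  unfolding tau_plus_def tau_plus_limit_def
proof (rule fredholm_det_eq_continuum_tau[OF disc_star disc continuous_F_star continuous_F disjoint(2), where b = r],
    unfold space_nu_sq_dom)
  show "(r w)\<^sup>2 = F_star w" if "w \<in> sq_dom_star Dp" for w using that r F_star_eq by simp
  fix w w' l assume w: "w \<in> sq_dom_star Dp" "w' \<in> sq_dom_star Dp" and l: "l \<in> sq_dom Dp"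
  let ?th = "theta_hat x t"
  have "exp (\<i> * ?th l - \<i> * ?th w) * exp (\<i> * ?th l - \<i> * ?th w')
      = exp (- 1 * \<i> * ?th w) * exp (2 * 1 * \<i> * ?th l) * exp (- 1 * \<i> * ?th w')"
    by (simp flip: exp_add add: algebra_simps)
  moreover have "F l = s l * s l" "z_plus Dp l * z_plus Dp l = l"
    using l s[OF l] z_plus_square[OF l] by (simp_all add: F_eq power2_eq_square)
  moreover have "(2 * \<i> * zp * sl * a * e / c) * (2 * \<i> * zp * sl * a' * e' / c')
      = (a * (- 4 * (zp * zp) * (sl * sl) * (e * e') * a')) / (c * c')"
    for zp sl a a' e e' c c' :: complex
    by (simp add: algebra_simps)
  ultimately show "Q_plus Dp s r x t l w * Q_plus Dp s r x t l w'
      = r w * exp (- 1 * \<i> * phase (of_real x, of_real t) w)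
        * inner_factor 1 F (of_real x, of_real t) w w' l
        * (r w' * exp (- 1 * \<i> * phase (of_real x, of_real t) w'))"
    unfolding Q_plus_def inner_factor_def outer_factor_def phase_of_real by simp
qed

lemma tau_minus_eq:
  assumes s: "\<And>l. l \<in> sq_dom Dp \<Longrightarrow> (s l)\<^sup>2 = f_hat Dp f l"
    and r: "\<And>w. w \<in> sq_dom_star Dp \<Longrightarrow> (r w)\<^sup>2 = f_hat_star Dp f w"
  shows "tau_minus Dp s r x t = tau_minus_limit (of_real x, of_real t)"
  unfolding tau_minus_def tau_minus_limit_def
proof (rule fredholm_det_eq_continuum_tau[OF disc disc_star continuous_F continuous_F_star disjoint(1), where b = s],
    unfold space_nu_sq_dom)
  show "(s l)\<^sup>2 = F l" if "l \<in> sq_dom Dp" for l using that s F_eq by simp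
  fix l l' w assume l: "l \<in> sq_dom Dp" "l' \<in> sq_dom Dp" and w: "w \<in> sq_dom_star Dp"
  let ?th = "theta_hat x t"
  have "exp (- \<i> * ?th w + \<i> * ?th l) * exp (- \<i> * ?th w + \<i> * ?th l')
      = exp (1 * \<i> * ?th l) * exp (2 * (- 1) * \<i> * ?th w) * exp (1 * \<i> * ?th l')"
    by (simp flip: exp_add add: algebra_simps)
  moreover have "F_star w = r w * r w" "z_plus_star Dp w * z_plus_star Dp w = w"
    using w r[OF w] z_plus_star_square[OF w] by (simp_all add: F_star_eq power2_eq_square)
  moreover have "(2 * \<i> * zp * sl * a * e / c) * (2 * \<i> * zp * sl * a' * e' / c')
      = (a * (- 4 * (zp * zp) * (sl * sl) * (e * e') * a')) / (c * c')"
    for zp sl a a' e e' c c' :: complex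
    by (simp add: algebra_simps)
  ultimately show "Q_minus Dp s r x t w l * Q_minus Dp s r x t w l'
      = s l * exp (1 * \<i> * phase (of_real x, of_real t) l)
        * inner_factor (- 1) F_star (of_real x, of_real t) l l' w
        * (s l' * exp (1 * \<i> * phase (of_real x, of_real t) l'))"
    unfolding Q_minus_def inner_factor_def outer_factor_def phase_of_real by simp
qed

end

text \<open>The positive exponent makes the \<open>powr\<close> bound tend to zero even though its
  base tends to zero.\<close>

lemma hoelder_on_imp_continuous_on:
  assumes "hoelder_on \<alpha> S f" "\<alpha> > 0"
  shows "continuous_on S f"
proof -
  obtain C where C: "\<And>u v. u \<in> S \<Longrightarrow> v \<in> S \<Longrightarrow> norm (f u - f v) \<le> C * norm (u - v) powr \<alpha>"
    using assms(1) unfolding hoelder_on_def by blast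
  show ?thesis unfolding continuous_on_def
  proof
    fix v assume v: "v \<in> S"
    have "((\<lambda>u. C * norm (u - v) powr \<alpha>) \<longlongrightarrow> C * norm (v - v) powr \<alpha>) (at v within S)"
      by (intro tendsto_intros tendsto_powr') (use assms(2) in auto)
    then have lim: "((\<lambda>u. C * norm (u - v) powr \<alpha>) \<longlongrightarrow> 0) (at v within S)" using assms(2) by simp
    have "((\<lambda>u. f u - f v) \<longlongrightarrow> 0) (at v within S)"
      by (rule Lim_null_comparison[OF _ lim]) (use C v in \<open>auto simp: eventually_at_filter\<close>)
    then show "(f \<longlongrightarrow> f v) (at v within S)" by (simp add: LIM_zero_iff)
  qed
qed

theorem theorem7p8:
  fixes Dp :: "complex set" and z :: "nat \<Rightarrow> nat \<Rightarrow> complex"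
    and f s r :: "complex \<Rightarrow> complex" and \<alpha> :: real
  assumes "open Dp" "Dp \<noteq> {}" "simply_connected Dp" "bounded Dp"
    and "closure Dp \<subseteq> {u. 0 < Re u \<and> 0 < Im u}"
    and "\<And>N j. j < N \<Longrightarrow> z N j \<in> Dp"
    and "\<And>N. inj_on (z N) {..<N}"
    and "weakly_converges_to (\<lambda>N. empirical_measure N (z N)) (uniform_measure lborel Dp)"
    and "0 < \<alpha>" "\<alpha> < 1" "hoelder_on \<alpha> (closure Dp) f"
    and "in_Linf (nu (sq_dom Dp)) (f_hat Dp f)" "in_L2 (nu (sq_dom Dp)) (f_hat Dp f)"
    and "in_Linf (nu (sq_dom_star Dp)) (f_hat_star Dp f)"
        "in_L2 (nu (sq_dom_star Dp)) (f_hat_star Dp f)"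
    and "s \<in> borel_measurable (nu (sq_dom Dp))"
        "\<And>l. l \<in> sq_dom Dp \<Longrightarrow> (s l)\<^sup>2 = f_hat Dp f l"
    and "r \<in> borel_measurable (nu (sq_dom_star Dp))"
        "\<And>w. w \<in> sq_dom_star Dp \<Longrightarrow> (r w)\<^sup>2 = f_hat_star Dp f w"
  defines "\<tau>N_plus \<equiv> \<lambda>N. tauN_plus N (z N) (norming_const Dp f N (z N))"
    and "\<tau>N_minus \<equiv> \<lambda>N. tauN_minus N (z N) (norming_const Dp f N (z N))"
    and "\<tau>_plus \<equiv> tau_plus Dp s r"
    and "\<tau>_minus \<equiv> tau_minus Dp s r"
  shows "(\<forall>K::(real \<times> real) set. compact K \<longrightarrow>
            uniform_limit K (\<lambda>N (x, t). \<tau>N_plus N x t) (\<lambda>(x, t). \<tau>_plus x t) sequentially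
          \<and> uniform_limit K (\<lambda>N (x, t). \<tau>N_minus N x t) (\<lambda>(x, t). \<tau>_minus x t) sequentially)
       \<and> (\<forall>K::(real \<times> real) set. compact K \<and> (\<forall>(x, t)\<in>K. \<tau>_plus x t * \<tau>_minus x t \<noteq> 0) \<longrightarrow>
            (\<forall>(x, t)\<in>K. \<exists>d. has_log_deriv (\<lambda>y. \<tau>_plus y t / \<tau>_minus y t) d x)
          \<and> (\<forall>\<^sub>F N in sequentially. \<forall>(x, t)\<in>K.
                \<exists>d. has_log_deriv (\<lambda>y. \<tau>N_plus N y t / \<tau>N_minus N y t) d x)
          \<and> uniform_limit K
              (\<lambda>N (x, t). log_deriv (\<lambda>y. \<tau>N_plus N y t / \<tau>N_minus N y t) x)
              (\<lambda>(x, t). log_deriv (\<lambda>y. \<tau>_plus y t / \<tau>_minus y t) x) sequentially)"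
proof -
  interpret condensation Dp z f
    by standard (use assms(1-11) hoelder_on_imp_continuous_on in blast)+
  \<comment> \<open>All four tau functions are restrictions along this embedding of functions on
    complex pairs. It maps compact sets to compact sets, so uniform convergence there restricts to
    compact sets of real parameters.\<close>
  let ?c = "\<lambda>p :: real \<times> real. (complex_of_real (fst p), complex_of_real (snd p))"
  have N_plus: "\<tau>N_plus N x t = tau_plus_approx N (?c (x, t))" for N x t
    by (simp add: \<tau>N_plus_def tauN_plus_eq)
  have N_minus: "\<tau>N_minus N x t = tau_minus_approx N (?c (x, t))" for N x t
    by (simp add: \<tau>N_minus_def tauN_minus_eq)
  have plus: "\<tau>_plus x t = tau_plus_limit (?c (x, t))" for x t
    using tau_plus_eq[of s r] assms(17,19) by (simp add: \<tau>_plus_def)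
  have minus: "\<tau>_minus x t = tau_minus_limit (?c (x, t))" for x t
    using tau_minus_eq[of s r] assms(17,19) by (simp add: \<tau>_minus_def)
  have uniform: "uniform_limit K (\<lambda>N (x, t). FN N (?c (x, t))) (\<lambda>(x, t). G (?c (x, t))) sequentially"
    if "\<And>P. compact P \<Longrightarrow> cconv P FN G" "compact K" for FN G and K :: "(real \<times> real) set"
  proof -
    have "compact (?c ` K)" by (intro compact_continuous_image that(2) continuous_intros)
    then have "uniform_limit (?c ` K) FN G sequentially" using that(1) by (simp add: cconv_def)
    then have "uniform_limit K (\<lambda>N p. FN N (?c p)) (\<lambda>p. G (?c p)) sequentially"
      by (rule uniform_limit_compose') auto
    then show ?thesis by (simp add: case_prod_unfold)
  qed
  have hol: "(\<lambda>x. tau_plus_approx N (x, t)) holomorphic_on UNIV"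
      "(\<lambda>x. tau_minus_approx N (x, t)) holomorphic_on UNIV" for N t
    unfolding tau_plus_approx_def tau_minus_approx_def by (rule holomorphic_tau_matrix)+
  show ?thesis
    unfolding N_plus N_minus plus minus
  proof (intro conjI allI impI; (elim conjE)?)
    fix K :: "(real \<times> real) set" assume K: "compact K"
    show "uniform_limit K (\<lambda>N (x, t). tau_plus_approx N (?c (x, t))) (\<lambda>(x, t). tau_plus_limit (?c (x, t))) sequentially"
      by (rule uniform[OF cconv_tau_plus K])
    show "uniform_limit K (\<lambda>N (x, t). tau_minus_approx N (?c (x, t))) (\<lambda>(x, t). tau_minus_limit (?c (x, t))) sequentially"
      by (rule uniform[OF cconv_tau_minus K])
    assume nz: "\<forall>(x, t)\<in>K. tau_plus_limit (?c (x, t)) * tau_minus_limit (?c (x, t)) \<noteq> 0"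
    have nz': "tau_plus_limit (?c p) \<noteq> 0 \<and> tau_minus_limit (?c p) \<noteq> 0" if "p \<in> K" for p
      using nz that by (cases p) auto
    note * = log_deriv_quotient_limit[OF cconv_tau_plus hol(1) cconv_tau_minus hol(2) K nz']
    show "\<forall>(x, t)\<in>K. \<exists>d. has_log_deriv (\<lambda>y. tau_plus_limit (?c (y, t)) / tau_minus_limit (?c (y, t))) d x"
      by (rule *(1))
    show "\<forall>\<^sub>F N in sequentially. \<forall>(x, t)\<in>K.
        \<exists>d. has_log_deriv (\<lambda>y. tau_plus_approx N (?c (y, t)) / tau_minus_approx N (?c (y, t))) d x"
      by (rule *(2))
    show "uniform_limit K
        (\<lambda>N (x, t). log_deriv (\<lambda>y. tau_plus_approx N (?c (y, t)) / tau_minus_approx N (?c (y, t))) x)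
        (\<lambda>(x, t). log_deriv (\<lambda>y. tau_plus_limit (?c (y, t)) / tau_minus_limit (?c (y, t))) x) sequentially"
      by (rule *(3))
  qed
qed

end
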